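(* Let $X=Y\oplus Z$ be a separable real Hilbert space, with $Y$ a closed subspace and $Z=Y^\perp$. Let $I:X\to\mathbb{R}$ be a functional such that: (i) $I\in Lip_{loc}(X,\mathbb{R})$ is $\tau$-upper semicontinuous and $$I(u)=\tfrac12\|u^+\|^2-\tfrac12\|u^-\|^2-\Psi(u),$$ where $\Psi\in Lip_{loc}(X,\mathbb{R})$ is bounded from below. (ii) There exist $z_0\in Z\setminus\{0\}$, $\delta>0$ and $R>r>0$ such that $I|_S\ge\delta$ and $I|_{\mathcal{M}_0}\le0$, where $$S=\{u\in Z:\|u\|=r\},\qquad \mathcal{M}=\{u=y+tz_0:\ y\in Y,\ t\ge0,\ \|u\|\le R\},$$ $$\mathcal{M}_0=\{u=y+tz_0:\ y\in Y,\ \text{and either } \|u\|=R,\ t\ge0,\ \text{or}\ \|u\|\le R,\ t=0\}.$$ If $I$ satisfies condition $(H)$ (stated in the context), then there exists a $(C)_c$-sequence for $I$, where $$c=\inf_{\gamma\in\Gamma}\ \sup_{u\in\mathcal{M}}I(\gamma(1,u)).$$ In addition, $c\ge\delta$.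
   Context: For $u\in X$, $u^+$ and $u^-$ are the orthogonal projections of $u$ on $Z$ and $Y$; $\|\cdot\|$ is the norm of $X$ and $(\cdot,\cdot)$ its inner product. $Lip_{loc}(X,\mathbb{R})$ is the set of locally Lipschitz functionals on $X$. Topology $\tau$: let $(e_k)$ be a total orthonormal sequence in $Y$ and set $|||u|||=\max\{\|u^+\|,\sum_{k=1}^\infty\frac1{2^k}|(u^-,e_k)|\}$; $\tau$ is the topology on $X$ generated by the norm $|||\cdot|||$. Generalized gradient: $I^\circ(u;v)=\limsup_{h\to0,\,s\downarrow0}\frac1s\left(I(u+h+sv)-I(u+h)\right)$, $\partial I(u)=\{\xi\in X^*: I^\circ(u;v)\ge\langle\xi,v\rangle\ \forall v\in X\}$, and $\lambda_I(u)=\min\{\|\xi\|_*:\xi\in\partial I(u)\}$, where $\|\cdot\|_*$ is the norm of $X^*$. Condition $(H)$: for all reals $\alpha\le\beta$, if $(u_n)\subset I^{-1}([\alpha,\beta])$ and $u_n\to u_0$ in $\tau$, then there exists $M>0$ such that $\partial\Psi(u_n)\subset B_M(0)\subset X^*$ for all $n$; in addition, if $\xi_n\in\partial I(u_n)$ and $\xi_n\rightharpoonup\xi_0$ weakly-$*$ in $X^*$, then $\xi_0\in\partial I(u_0)$. A sequence $(u_n)\subset X$ is a $(C)_c$-sequence (Cerami sequence at level $c$) for $I$ if $I(u_n)\to c$ and $(1+\|u_n\|)\lambda_I(u_n)\to0$. A homotopy $\gamma:[0,1]\times\mathcal{M}\to X$, written $\gamma(s,u)=u-g(s,u)$, is admissible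 if: (a) it is $\tau$-continuous, i.e. $\gamma(s_n,u_n)\to\gamma(s,u)$ in $\tau$ whenever $u_n\to u$ in $\tau$ and $s_n\to s$; (b) $g$ is $\tau$-locally finite-dimensional, i.e. each $(s,u)\in[0,1]\times\mathcal{M}$ has a neighbourhood $\mathcal{N}$ in the product topology of $[0,1]$ and $(X,\tau)$ such that $g(\mathcal{N}\cap([0,1]\times\mathcal{M}))$ is contained in a finite-dimensional subspace of $X$. $\Gamma$ is the set of all $\gamma\in C([0,1]\times\mathcal{M},X)$ that are admissible and satisfy $\gamma(0,u)=u$ for all $u\in\mathcal{M}$ and $I(\gamma(s,u))\le\max\{I(u),-1\}$ for all $s\in[0,1]$, $u\in\mathcal{M}$. *)

theory Defs
  imports "HOL-Analysis.Analysis"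
begin

definition orth_proj :: "'a::real_inner set \<Rightarrow> 'a \<Rightarrow> 'a" where
  "orth_proj W u = (THE p. p \<in> W \<and> u - p \<in> orthogonal_comp W)"

(* The index set J is {1..} if Y is infinite-dimensional and {1..n} if dim Y = n. *)
definition total_orthonormal_seq :: "'a::real_inner set \<Rightarrow> nat set \<Rightarrow> (nat \<Rightarrow> 'a) \<Rightarrow> bool" where
  "total_orthonormal_seq Y J e \<longleftrightarrow>
     (J = {1..} \<or> (\<exists>n. J = {1..n})) \<and>
     (\<forall>i\<in>J. \<forall>j\<in>J. inner (e i) (e j) = (if i = j then 1 else 0)) \<and>
     closure (span (e ` J)) = Y"

(* The series is dominated by (\<Sum>k. norm u / 2^k), so infsum is its actual value. *)
definition tau_norm :: "'a::real_inner set \<Rightarrow> nat set \<Rightarrow> (nat \<Rightarrow> 'a) \<Rightarrow> 'a \<Rightarrow> real" where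
  "tau_norm Y J e u =
     max (norm (orth_proj (orthogonal_comp Y) u))
         (\<Sum>\<^sub>\<infinity>k\<in>J. 1 / 2 ^ k * \<bar>inner (orth_proj Y u) (e k)\<bar>)"

definition tau_topology :: "'a::real_inner set \<Rightarrow> nat set \<Rightarrow> (nat \<Rightarrow> 'a) \<Rightarrow> 'a topology" where
  "tau_topology Y J e = Metric_space.mtopology UNIV (\<lambda>u v. tau_norm Y J e (u - v))"

definition locally_lipschitz :: "('a::metric_space \<Rightarrow> real) \<Rightarrow> bool" where
  "locally_lipschitz f \<longleftrightarrow> (\<forall>u. \<exists>r>0. \<exists>L. L-lipschitz_on (ball u r) f)"

definition upper_semicontinuous_wrt :: "'a topology \<Rightarrow> ('a \<Rightarrow> real) \<Rightarrow> bool" where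
  "upper_semicontinuous_wrt T f \<longleftrightarrow> (\<forall>a. openin T {u \<in> topspace T. f u < a})"

(* As usual for Clarke's derivative, h = 0 is not excluded in the limit h \<longlonglongrightarrow> 0; hence nhds 0. *)
definition clarke_deriv :: "('a::real_normed_vector \<Rightarrow> real) \<Rightarrow> 'a \<Rightarrow> 'a \<Rightarrow> ereal" where
  "clarke_deriv f u v =
     Limsup (nhds 0 \<times>\<^sub>F at_right 0) (\<lambda>(h, s). ereal (1 / s * (f (u + h + s *\<^sub>R v) - f (u + h))))"

definition gen_gradient :: "('a::real_normed_vector \<Rightarrow> real) \<Rightarrow> 'a \<Rightarrow> ('a \<Rightarrow>\<^sub>L real) set" where
  "gen_gradient f u = {\<xi>. \<forall>v. clarke_deriv f u v \<ge> ereal (blinfun_apply \<xi> v)}"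

(* For locally Lipschitz f the minimum is attained. *)
definition min_grad_norm :: "('a::real_normed_vector \<Rightarrow> real) \<Rightarrow> 'a \<Rightarrow> real" where
  "min_grad_norm f u = (LEAST m. m \<in> norm ` gen_gradient f u)"

definition weak_star_lim :: "(nat \<Rightarrow> 'a::real_normed_vector \<Rightarrow>\<^sub>L real) \<Rightarrow> ('a \<Rightarrow>\<^sub>L real) \<Rightarrow> bool" where
  "weak_star_lim \<xi> \<xi>0 \<longleftrightarrow> (\<forall>v. (\<lambda>n. blinfun_apply (\<xi> n) v) \<longlonglongrightarrow> blinfun_apply \<xi>0 v)"

definition condition_H ::
    "'a::real_normed_vector topology \<Rightarrow> ('a \<Rightarrow> real) \<Rightarrow> ('a \<Rightarrow> real) \<Rightarrow> bool" where
  "condition_H T I \<Psi> \<longleftrightarrow>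
     (\<forall>\<alpha> \<beta> u u0. \<alpha> \<le> \<beta> \<and> (\<forall>n. I (u n) \<in> {\<alpha>..\<beta>}) \<and> limitin T u u0 sequentially \<longrightarrow>
        (\<exists>M>0. \<forall>n. gen_gradient \<Psi> (u n) \<subseteq> ball 0 M) \<and>
        (\<forall>\<xi> \<xi>0. (\<forall>n. \<xi> n \<in> gen_gradient I (u n)) \<and> weak_star_lim \<xi> \<xi>0 \<longrightarrow>
            \<xi>0 \<in> gen_gradient I u0))"

definition cerami_seq :: "('a::real_normed_vector \<Rightarrow> real) \<Rightarrow> real \<Rightarrow> (nat \<Rightarrow> 'a) \<Rightarrow> bool" where
  "cerami_seq I c u \<longleftrightarrow>
     (\<lambda>n. I (u n)) \<longlonglongrightarrow> c \<and> (\<lambda>n. (1 + norm (u n)) * min_grad_norm I (u n)) \<longlonglongrightarrow> 0"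

definition tau_continuous_homotopy ::
    "'a topology \<Rightarrow> 'a set \<Rightarrow> (real \<Rightarrow> 'a \<Rightarrow> 'a) \<Rightarrow> bool" where
  "tau_continuous_homotopy T M \<gamma> \<longleftrightarrow>
     (\<forall>s s0 u u0. (\<forall>n. s n \<in> {0..1}) \<and> s0 \<in> {0..1} \<and> (\<forall>n. u n \<in> M) \<and> u0 \<in> M \<and>
        limitin T u u0 sequentially \<and> s \<longlonglongrightarrow> s0 \<longrightarrow>
        limitin T (\<lambda>n. \<gamma> (s n) (u n)) (\<gamma> s0 u0) sequentially)"

definition tau_locally_finite_dim ::
    "'a::real_vector topology \<Rightarrow> 'a set \<Rightarrow> (real \<Rightarrow> 'a \<Rightarrow> 'a) \<Rightarrow> bool" where
  "tau_locally_finite_dim T M g \<longleftrightarrow>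
     (\<forall>s\<in>{0..1}. \<forall>u\<in>M. \<exists>N. openin (prod_topology (top_of_set {0..1}) T) N \<and> (s, u) \<in> N \<and>
        (\<exists>B. finite B \<and> (\<lambda>(t, v). g t v) ` (N \<inter> {0..1} \<times> M) \<subseteq> span B))"

definition admissible_homotopy ::
    "'a::real_vector topology \<Rightarrow> 'a set \<Rightarrow> (real \<Rightarrow> 'a \<Rightarrow> 'a) \<Rightarrow> bool" where
  "admissible_homotopy T M \<gamma> \<longleftrightarrow>
     tau_continuous_homotopy T M \<gamma> \<and> tau_locally_finite_dim T M (\<lambda>s u. u - \<gamma> s u)"

definition Gamma_class ::
    "'a::real_normed_vector topology \<Rightarrow> ('a \<Rightarrow> real) \<Rightarrow> 'a set \<Rightarrow> (real \<Rightarrow> 'a \<Rightarrow> 'a) set" where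
  "Gamma_class T I M = {\<gamma>.
     continuous_on ({0..1} \<times> M) (\<lambda>(s, u). \<gamma> s u) \<and>
     admissible_homotopy T M \<gamma> \<and>
     (\<forall>u\<in>M. \<gamma> 0 u = u) \<and>
     (\<forall>s\<in>{0..1}. \<forall>u\<in>M. I (\<gamma> s u) \<le> max (I u) (-1))}"

end

theory Submission
  imports Defs "HOL-Homology.Homology" "HOL-Library.Diagonal_Subsequence"
begin

text \<open>If there is no Cerami sequence at level \<open>c\<close>, then \<open>(1 + \<parallel>u\<parallel>) \<lambda>\<^sub>I(u)\<close> is bounded below near that level, and
  condition (H) with weak compactness makes the resulting descent directions stable in
  \<open>\<tau>\<close>-neighbourhoods. Since \<open>\<M>\<close> is \<open>\<tau>\<close>-compact, a finite partition of unity over the image of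
  \<open>\<gamma>(1, \<cdot>)\<close> yields a finite-rank \<open>\<tau>\<close>-continuous field \<open>V\<close> for which a single Euler step
  \<open>u \<mapsto> u - s V(u)\<close> lowers the level; no flow is needed. Since the size of the step depends on the compact
  set, the steps are iterated greedily, as in Ekeland's variational principle: the maps converge
  uniformly, and the field of the limit set contradicts the greedy choice. The bound \<open>c \<ge> \<delta>\<close> is a
  linking argument on a finite-dimensional subspace, reduced to the non-contractibility of spheres.\<close>

section \<open>Hilbert spaces\<close>

text \<open>The obstacle is that \<open>I\<close> is only upper semicontinuous for tau, and that
  deformations may displace points only within finite-dimensional spaces. The value -1 in the
  definition of \<open>\<Gamma>\<close> supplies the lower energy bound that (H) needs: descent is
  claimed only above -1, and since c >= \<delta> > 0, a band of width \<epsilon> <= 1 around c stays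
  above it. The Cerami weight enters by letting descent vectors have length up to 1 +
  \<open>norm x\<close>; weak lower semicontinuity of the norm turns this into 2 * (1 +
  \<open>norm y\<close>) at tau-nearby points \<open>y\<close>. Displacements of relative size 2 * s
  make norms grow at most like the exponential of twice the sum of the steps. The steps are summable
  because each costs a * s of level and no level is below c. The limit of the maps need not belong
  to \<open>\<Gamma>\<close>, as the finite-dimensional ranges may grow. Only its tau-continuity is
  used, to obtain a tau-compact limit set, and the last deformation is applied to a late iterate.
  All gradients are handled as vectors through Riesz representation.\<close>

lemma convex_min_norm_exists:
  fixes C :: "'a::{real_inner, complete_space} set"
  assumes "convex C" "closed C" "C \<noteq> {}"
  obtains p where "p \<in> C" "\<And>x. x \<in> C \<Longrightarrow> norm p \<le> norm x"
    "\<And>x. x \<in> C \<Longrightarrow> inner p x \<ge> (norm p)\<^sup>2"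
proof -
  define d where "d = (INF x\<in>C. norm x)"
  have bdd: "bdd_below (norm ` C)" by (rule bdd_belowI[of _ 0]) auto
  have d_le: "d \<le> norm x" if "x \<in> C" for x
    unfolding d_def using bdd that by (rule cINF_lower)
  have d0: "d \<ge> 0" unfolding d_def using assms(3) by (intro cINF_greatest) auto
  have "\<exists>x\<in>C. norm x < d + 1 / Suc n" for n
    using cInf_lessD[of "norm ` C" "d + 1 / Suc n"] assms(3) by (auto simp: d_def)
  then obtain x where x: "\<And>n. x n \<in> C" "\<And>n. norm (x n) < d + 1 / Suc n" by metis
  have lim: "(\<lambda>n. norm (x n)) \<longlonglongrightarrow> d"
  proof (rule tendsto_sandwich[of "\<lambda>_. d" _ _ "\<lambda>n. d + 1 / Suc n"])
    show "\<forall>\<^sub>F n in sequentially. norm (x n) \<le> d + 1 / real (Suc n)"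
      using x(2) by (intro always_eventually allI less_imp_le)
    show "(\<lambda>n. d + 1 / real (Suc n)) \<longlonglongrightarrow> d" using tendsto_add[OF tendsto_const LIMSEQ_Suc[OF lim_1_over_n], of d] by simp
  qed (use d_le x in auto)
  \<comment> \<open>Parallelogram law: the midpoint lies in \<open>C\<close>, so its norm is at
    least \<open>d\<close>. Minimizing sequences are therefore Cauchy.\<close>
  have par: "(norm (a - b))\<^sup>2 \<le> 2 * (norm a)\<^sup>2 + 2 * (norm b)\<^sup>2 - 4 * d\<^sup>2"
    if "a \<in> C" "b \<in> C" for a b
  proof -
    have "(1/2) *\<^sub>R a + (1/2) *\<^sub>R b \<in> C" using that assms(1) by (auto intro: convexD)
    then have "d\<^sup>2 \<le> (norm ((1/2) *\<^sub>R a + (1/2) *\<^sub>R b))\<^sup>2" using d_le d0 by (simp add: power_mono)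
    also have "\<dots> = (norm (a + b))\<^sup>2 / 4"
      unfolding scaleR_add_right[symmetric] by (simp add: power_divide)
    finally have "4 * d\<^sup>2 \<le> (norm (a + b))\<^sup>2" by simp
    moreover have "(norm (a + b))\<^sup>2 + (norm (a - b))\<^sup>2 = 2 * (norm a)\<^sup>2 + 2 * (norm b)\<^sup>2"
      by (simp add: power2_norm_eq_inner algebra_simps)
    ultimately show ?thesis by linarith
  qed
  have "Cauchy x"
  proof (rule metric_CauchyI)
    fix e :: real assume e: "e > 0"
    have "(\<lambda>n. (norm (x n))\<^sup>2) \<longlonglongrightarrow> d\<^sup>2" by (intro tendsto_power lim)
    then have "\<forall>\<^sub>F n in sequentially. (norm (x n))\<^sup>2 < d\<^sup>2 + e\<^sup>2 / 4"
      using e by (intro order_tendstoD(2)) auto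
    then obtain N where N: "\<And>n. n \<ge> N \<Longrightarrow> (norm (x n))\<^sup>2 < d\<^sup>2 + e\<^sup>2 / 4"
      unfolding eventually_sequentially by blast
    have "dist (x m) (x n) < e" if "m \<ge> N" "n \<ge> N" for m n
    proof -
      have "(norm (x m - x n))\<^sup>2 < e\<^sup>2"
        using par[OF x(1)[of m] x(1)[of n]] N[OF that(1)] N[OF that(2)] by linarith
      then show ?thesis using e by (simp add: dist_norm power_less_imp_less_base)
    qed
    then show "\<exists>M. \<forall>m\<ge>M. \<forall>n\<ge>M. dist (x m) (x n) < e" by blast
  qed
  then obtain p where p: "x \<longlonglongrightarrow> p" using Cauchy_convergent convergent_def by blast
  have pC: "p \<in> C" using closed_sequentially[OF assms(2)] x(1) p by blast
  have "norm p = d" using LIMSEQ_unique[OF tendsto_norm[OF p] lim] .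
  then have min: "\<And>x. x \<in> C \<Longrightarrow> norm p \<le> norm x" using d_le by simp
  have "inner p y \<ge> (norm p)\<^sup>2" if y: "y \<in> C" for y
  proof (rule ccontr)
    assume "\<not> ?thesis"
    then have k: "inner p (y - p) < 0" by (simp add: power2_norm_eq_inner inner_diff_right)
    define k where "k = - inner p (y - p)"
    define n where "n = (norm (y - p))\<^sup>2"
    have kn: "k > 0" "n \<ge> 0" using k by (auto simp: k_def n_def)
    \<comment> \<open>Small enough that the quadratic term satisfies \<open>t * n \<le> k\<close>,
      whereas minimality would force \<open>t * n\<close> to be at least
      \<open>2 * k\<close>.\<close>
    define t where "t = min 1 (k / (n + 1))"
    have t: "t > 0" "t \<le> 1" "t \<le> k / (n + 1)" using kn by (auto simp: t_def)
    have "p + t *\<^sub>R (y - p) = (1 - t) *\<^sub>R p + t *\<^sub>R y" by (simp add: algebra_simps)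
    then have "p + t *\<^sub>R (y - p) \<in> C" using assms(1) pC y t by (auto intro: convexD)
    then have "(norm p)\<^sup>2 \<le> (norm (p + t *\<^sub>R (y - p)))\<^sup>2" using min by (simp add: power_mono)
    also have "\<dots> = (norm p)\<^sup>2 - 2 * t * k + t\<^sup>2 * n"
      unfolding power2_norm_eq_inner k_def n_def
      by (simp add: inner_add_left inner_add_right inner_commute power2_eq_square)
    finally have "2 * t * k \<le> t * (t * n)" by (simp add: power2_eq_square)
    then have "2 * k \<le> t * n" using t(1) by simp
    moreover have "t * n \<le> k / (n + 1) * n" using t(3) kn by (intro mult_right_mono) auto
    moreover have "k / (n + 1) * n \<le> k" using kn by (simp add: field_simps)
    ultimately show False using kn by linarith
  qed
  then show ?thesis using that pC min by blast
qed

lemma nearest_point_exists: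
  fixes C :: "'a::{real_inner, complete_space} set"
  assumes "convex C" "closed C" "C \<noteq> {}"
  obtains p where "p \<in> C" "\<And>x. x \<in> C \<Longrightarrow> inner (z - p) (x - p) \<le> 0"
proof -
  obtain q where q: "q \<in> (\<lambda>x. x - z) ` C"
    "\<And>x. x \<in> (\<lambda>x. x - z) ` C \<Longrightarrow> inner q x \<ge> (norm q)\<^sup>2"
  proof (rule convex_min_norm_exists[of "(\<lambda>x. x - z) ` C"])
    have eq: "(\<lambda>x. x - z) ` C = (+) (- z) ` C" by (auto simp: image_iff)
    show "convex ((\<lambda>x. x - z) ` C)" "closed ((\<lambda>x. x - z) ` C)"
      unfolding eq using assms convex_translation[of C "- z"] closed_translation[of C "- z"] by simp_all
  qed (use assms in auto)
  from q(1) obtain p where p: "p \<in> C" "q = p - z" by auto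
  have "inner (z - p) (x - p) \<le> 0" if "x \<in> C" for x
    using q(2)[of "x - z"] that p(2)
    by (simp add: power2_norm_eq_inner inner_diff_left inner_diff_right inner_commute)
  then show ?thesis using p(1) that by blast
qed

lemma subspace_nearest_point_exists:
  fixes W :: "'a::{real_inner, complete_space} set"
  assumes "subspace W" "closed W"
  obtains p where "p \<in> W" "z - p \<in> W\<^sup>\<bottom>"
proof -
  obtain p where p: "p \<in> W" "\<And>x. x \<in> W \<Longrightarrow> inner (z - p) (x - p) \<le> 0"
    using nearest_point_exists[OF subspace_imp_convex[OF assms(1)] assms(2)] assms(1) subspace_0
    by (metis empty_iff)
  have "inner (z - p) x = 0" if "x \<in> W" for x
    using p(2)[of "p + x"] p(2)[of "p - x"] that p(1) assms(1)
    by (simp add: subspace_add subspace_diff)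
  then show ?thesis using that p(1) by (auto simp: orthogonal_comp_def orthogonal_def inner_commute)
qed

lemma orthogonal_compD: "x \<in> W\<^sup>\<bottom> \<Longrightarrow> y \<in> W \<Longrightarrow> inner x y = 0"
  by (auto simp: orthogonal_comp_def orthogonal_def inner_commute)

text \<open>Uniqueness behind the definite description: two candidates differ by a vector lying both
  in \<open>W\<close> and in its orthogonal complement.\<close>

lemma orth_proj_eqI:
  assumes "subspace W" "p \<in> W" "u - p \<in> W\<^sup>\<bottom>"
  shows "orth_proj W u = p"
  unfolding orth_proj_def
proof (rule the_equality)
  fix q assume q: "q \<in> W \<and> u - q \<in> W\<^sup>\<bottom>"
  have "q - p \<in> W" using q assms by (simp add: subspace_diff)
  moreover have "(u - p) - (u - q) \<in> W\<^sup>\<bottom>"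
    using q assms subspace_orthogonal_comp by (blast intro: subspace_diff)
  ultimately have "inner (q - p) (q - p) = 0" using orthogonal_compD by fastforce
  then show "q = p" by simp
qed (use assms in simp)

text \<open>For a nonzero functional, a normal vector \<open>n\<close> of the closed kernel spans
  its complement; the factor \<open>\<xi> n / inner n n\<close> makes the inner product agree with
  the functional on \<open>n\<close>, hence everywhere.\<close>

lemma riesz_representation:
  fixes \<xi> :: "'a::{real_inner, complete_space} \<Rightarrow>\<^sub>L real"
  obtains x where "\<xi> = blinfun_inner_right x"
proof (cases "\<xi> = 0")
  case True
  then have "\<xi> = blinfun_inner_right 0" by (intro blinfun_eqI) simp
  then show ?thesis by (rule that)
next
  case False
  then obtain v where v: "\<xi> v \<noteq> 0" by (metis blinfun_eqI blinfun.zero_left)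
  define K where "K = {x. blinfun_apply \<xi> x = 0}"
  have sK: "subspace K" by (auto simp: K_def subspace_def blinfun.add_right blinfun.scaleR_right)
  have cK: "closed K" unfolding K_def by (intro closed_Collect_eq continuous_intros)
  obtain p where p: "p \<in> K" "v - p \<in> K\<^sup>\<bottom>" using subspace_nearest_point_exists[OF sK cK] .
  define n where "n = v - p"
  have n: "\<xi> n \<noteq> 0" "n \<in> K\<^sup>\<bottom>" using p v by (auto simp: n_def K_def blinfun.diff_right)
  then have n0: "inner n n \<noteq> 0" by auto
  define k where "k = \<xi> n / inner n n"
  have "\<xi> y = inner (k *\<^sub>R n) y" for y
  proof -
    have "y - (\<xi> y / \<xi> n) *\<^sub>R n \<in> K" using n by (simp add: K_def blinfun.diff_right blinfun.scaleR_right)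
    then have "inner n (y - (\<xi> y / \<xi> n) *\<^sub>R n) = 0" using n orthogonal_compD by blast
    then have "inner n y = \<xi> y / \<xi> n * inner n n" by (simp add: inner_diff_right)
    then show ?thesis using n(1) n0 by (simp add: k_def)
  qed
  then have "\<xi> = blinfun_inner_right (k *\<^sub>R n)" by (intro blinfun_eqI) simp
  then show ?thesis by (rule that)
qed

lemma norm_blinfun_inner_right: "norm (blinfun_inner_right (x::'a::real_inner)) = norm x"
proof (rule antisym)
  show "norm (blinfun_inner_right x) \<le> norm x"
    by (rule norm_blinfun_bound) (simp_all add: Cauchy_Schwarz_ineq2)
  show "norm x \<le> norm (blinfun_inner_right x)"
    using norm_blinfun[of "blinfun_inner_right x" x]
    by (cases "x = 0") (auto simp: power2_norm_eq_inner[symmetric] power2_eq_square)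
qed

section \<open>Weak sequential compactness in separable Hilbert spaces\<close>

lemma bounded_real_subseq_diagonal:
  fixes a :: "nat \<Rightarrow> nat \<Rightarrow> real"
  assumes "\<And>n k. \<bar>a n k\<bar> \<le> b k"
  obtains r where "strict_mono (r :: nat \<Rightarrow> nat)" "\<And>k. convergent (\<lambda>n. a (r n) k)"
proof -
  have "Diagonal_Subsequence.subseqs (\<lambda>k r. convergent (\<lambda>n. a (r n) k))"
  proof
    fix k :: nat and s :: "nat \<Rightarrow> nat"
    have "bounded (range (\<lambda>n. a (s n) k))" using assms by (auto simp: bounded_iff)
    then obtain l r where "strict_mono r" "((\<lambda>n. a (s n) k) \<circ> r) \<longlonglongrightarrow> l"
      using bounded_imp_convergent_subsequence by blast
    then show "\<exists>r'. strict_mono r' \<and> convergent (\<lambda>n. a ((s \<circ> r') n) k)"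
      by (auto simp: o_def convergent_def)
  qed
  then interpret Diagonal_Subsequence.subseqs "\<lambda>k r. convergent (\<lambda>n. a (r n) k)" .
  have "convergent (\<lambda>n. a (diagseq n) k)" for k
  proof -
    \<comment> \<open>The diagonal sequence is a subsequence of the \<open>k\<close>-th extraction
      only from index \<open>Suc k\<close> on, so convergence is first obtained for a tail.\<close>
    have "convergent (\<lambda>n. a ((diagseq \<circ> (+) (Suc k)) n) k)"
    proof (rule diagseq_holds)
      fix n r and s :: "nat \<Rightarrow> nat" assume "strict_mono s" "convergent (\<lambda>i. a (r i) n)"
      then show "convergent (\<lambda>i. a ((r \<circ> s) i) n)"
        using convergent_subseq_convergent[of "\<lambda>i. a (r i) n" s] by (simp add: o_def)
    qed
    then have "convergent (\<lambda>n. a (diagseq (n + Suc k)) k)" by (simp add: o_def add.commute)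
    then show ?thesis using convergent_ignore_initial_segment[of "\<lambda>n. a (diagseq n) k" "Suc k"] by simp
  qed
  then show ?thesis using that subseq_diagseq by blast
qed

text \<open>Diagonal extraction settles a countable dense set of test vectors, boundedness carries
  convergence over to all of them, and Riesz turns the bounded linear limit functional into the
  vector \<open>l\<close>.\<close>

lemma bounded_weakly_convergent_subseq:
  fixes x :: "nat \<Rightarrow> 'a::{real_inner, complete_space}"
  assumes sep: "separable_space (euclidean :: 'a topology)"
    and bd: "\<And>n. norm (x n) \<le> b"
  obtains r l where "strict_mono (r :: nat \<Rightarrow> nat)" "\<And>v. (\<lambda>n. inner (x (r n)) v) \<longlonglongrightarrow> inner l v"
    "norm l \<le> b"
proof -
  have b0: "b \<ge> 0" using bd[of 0] norm_ge_zero order_trans by blast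
  obtain D :: "'a set" where D: "countable D" "closure D = UNIV"
    using sep by (auto simp: separable_space_def)
  then have "D \<noteq> {}" by auto
  define d where "d = from_nat_into D"
  have d: "range d = D" unfolding d_def using D \<open>D \<noteq> {}\<close> by (simp add: range_from_nat_into)
  obtain r where r: "strict_mono (r :: nat \<Rightarrow> nat)" "\<And>k. convergent (\<lambda>n. inner (x (r n)) (d k))"
  proof (rule bounded_real_subseq_diagonal[of "\<lambda>n k. inner (x n) (d k)" "\<lambda>k. b * norm (d k)"])
    fix n k show "\<bar>inner (x n) (d k)\<bar> \<le> b * norm (d k)"
      using Cauchy_Schwarz_ineq2[of "x n" "d k"] mult_right_mono[OF bd[of n], of "norm (d k)"] by auto
  qed blast
  have "Cauchy (\<lambda>n. inner (x (r n)) v)" for v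
  proof (rule metric_CauchyI)
    fix e :: real assume e: "e > 0"
    \<comment> \<open>Replacing \<open>v\<close> by a nearby \<open>d k\<close> changes each inner
      product by at most \<open>e / 4\<close>; twice that plus the \<open>e / 2\<close> along the
      dense set stays within \<open>e\<close>.\<close>
    define e' where "e' = e / (4 * (b + 1))"
    have e': "e' > 0" using e b0 by (simp add: e'_def)
    have "v \<in> closure D" using D by simp
    then obtain y where "y \<in> D" "dist y v < e'" using e' closure_approachable by blast
    then obtain k where k: "norm (d k - v) < e'" using d by (auto simp: dist_norm)
    have "Cauchy (\<lambda>n. inner (x (r n)) (d k))" using r(2) convergent_Cauchy by blast
    then obtain N where N: "\<And>m n. m \<ge> N \<Longrightarrow> n \<ge> N \<Longrightarrow> dist (inner (x (r m)) (d k)) (inner (x (r n)) (d k)) < e / 2"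
      using metric_CauchyD[of _ "e/2"] e by (meson half_gt_zero)
    have near: "\<bar>inner (x n) v - inner (x n) (d k)\<bar> \<le> e / 4" for n
    proof -
      have "\<bar>inner (x n) (v - d k)\<bar> \<le> norm (x n) * norm (v - d k)" by (rule Cauchy_Schwarz_ineq2)
      also have "\<dots> \<le> b * e'" using bd[of n] k b0 by (intro mult_mono) (auto simp: norm_minus_commute)
      also have "\<dots> \<le> e / 4" using e b0 by (simp add: e'_def field_simps)
      finally show ?thesis by (simp add: inner_diff_right)
    qed
    have "dist (inner (x (r m)) v) (inner (x (r n)) v) < e" if "m \<ge> N" "n \<ge> N" for m n
      using N[OF that] near[of "r m"] near[of "r n"] unfolding dist_real_def by linarith
    then show "\<exists>M. \<forall>m\<ge>M. \<forall>n\<ge>M. dist (inner (x (r m)) v) (inner (x (r n)) v) < e" by blast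
  qed
  then have "convergent (\<lambda>n. inner (x (r n)) v)" for v using Cauchy_convergent by blast
  then obtain f where f: "\<And>v. (\<lambda>n. inner (x (r n)) v) \<longlonglongrightarrow> f v" unfolding convergent_def by metis
  have f_le: "\<bar>f v\<bar> \<le> b * norm v" for v
  proof (rule LIMSEQ_le_const2[OF tendsto_rabs[OF f[of v]]])
    have "\<bar>inner (x n) v\<bar> \<le> b * norm v" for n
      using Cauchy_Schwarz_ineq2[of "x n" v] mult_right_mono[OF bd[of n], of "norm v"] by auto
    then show "\<exists>N. \<forall>n\<ge>N. \<bar>inner (x (r n)) v\<bar> \<le> b * norm v" by blast
  qed
  have "bounded_linear f"
  proof (rule bounded_linear_intro[where K = b])
    fix u v :: 'a and c :: real
    show "f (u + v) = f u + f v"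
      using LIMSEQ_unique[OF f[of "u + v"]] tendsto_add[OF f[of u] f[of v]] by (simp add: inner_add_right)
    show "f (c *\<^sub>R u) = c *\<^sub>R f u"
      using LIMSEQ_unique[OF f[of "c *\<^sub>R u"]] tendsto_mult_left[OF f[of u], of c] by simp
    show "norm (f u) \<le> norm u * b" using f_le[of u] by (simp add: mult.commute)
  qed
  then obtain \<xi> where \<xi>: "f = blinfun_apply \<xi>" by (metis bounded_linear_Blinfun_apply)
  obtain l where l: "\<xi> = blinfun_inner_right l" by (rule riesz_representation)
  have fl: "f v = inner l v" for v using \<xi> l by simp
  have "norm l * norm l \<le> b * norm l" using f_le[of l] fl by (simp add: power2_norm_eq_inner[symmetric] power2_eq_square)
  then have "norm l \<le> b" using b0 by (cases "l = 0") auto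
  then show ?thesis using that r(1) f fl by auto
qed

section \<open>Clarke's generalized gradient\<close>

lemma half_div_mult: "K > 0 \<Longrightarrow> x / (2 * K) * K = x / 2" for x K :: real
  by simp

section \<open>Calculus of Clarke's directional derivative\<close>

lemma eventually_nhds_0_at_right_0:
  fixes P :: "'a::real_normed_vector \<times> real \<Rightarrow> bool"
  shows "eventually P (nhds 0 \<times>\<^sub>F at_right 0) \<longleftrightarrow>
    (\<exists>d>0. \<forall>h s. norm h < d \<and> 0 < s \<and> s < d \<longrightarrow> P (h, s))" (is "?L \<longleftrightarrow> ?R")
proof
  assume ?L
  then obtain A B where AB: "eventually A (nhds (0::'a))" "eventually B (at_right (0::real))"
    "\<And>x y. A x \<Longrightarrow> B y \<Longrightarrow> P (x, y)"
    unfolding eventually_prod_filter by blast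
  from AB(1) obtain d where d: "d > 0" "\<And>x. norm x < d \<Longrightarrow> A x"
    unfolding eventually_nhds_metric by (auto simp: dist_norm)
  from AB(2) obtain c where c: "c > 0" "\<And>y. 0 < y \<Longrightarrow> y < c \<Longrightarrow> B y"
    unfolding eventually_at_right_field by auto
  show ?R by (rule exI[of _ "min d c"]) (use d c AB(3) in auto)
next
  assume ?R
  then obtain d where d: "d > 0" "\<And>h s. norm h < d \<Longrightarrow> 0 < s \<Longrightarrow> s < d \<Longrightarrow> P (h, s)" by blast
  have "eventually (\<lambda>x::'a. norm x < d) (nhds 0)"
    unfolding eventually_nhds_metric using d(1) by (auto simp: dist_norm)
  moreover have "eventually (\<lambda>s. 0 < s \<and> s < d) (at_right 0)"
    unfolding eventually_at_right_field using d(1) by auto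
  ultimately show ?L unfolding eventually_prod_filter using d(2) by blast
qed

text \<open>An extended real is determined by its real upper bounds. Clearing the denominator
  \<open>s\<close> leaves an inequality between reals, the form through which the derivative is
  handled later.\<close>

lemma clarke_deriv_le_iff:
  fixes f :: "'a::real_normed_vector \<Rightarrow> real"
  shows "clarke_deriv f u v \<le> ereal b \<longleftrightarrow>
    (\<forall>\<epsilon>>0. \<exists>d>0. \<forall>h s. norm h < d \<and> 0 < s \<and> s < d \<longrightarrow>
        f (u + h + s *\<^sub>R v) - f (u + h) \<le> (b + \<epsilon>) * s)" (is "?L \<longleftrightarrow> ?R")
proof
  assume L: ?L
  show ?R
  proof (intro allI impI)
    fix \<epsilon> :: real assume "\<epsilon> > 0"
    then have "ereal (b + \<epsilon>) > ereal b" by simp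
    then have "eventually (\<lambda>(h, s). ereal (b + \<epsilon>) > ereal (1 / s * (f (u + h + s *\<^sub>R v) - f (u + h))))
        (nhds 0 \<times>\<^sub>F at_right 0)"
      using L unfolding clarke_deriv_def Limsup_le_iff case_prod_beta by blast
    then obtain d where "d > 0" "\<And>h s. norm h < d \<Longrightarrow> 0 < s \<Longrightarrow> s < d \<Longrightarrow>
        1 / s * (f (u + h + s *\<^sub>R v) - f (u + h)) < b + \<epsilon>"
      unfolding eventually_nhds_0_at_right_0 by auto
    then show "\<exists>d>0. \<forall>h s. norm h < d \<and> 0 < s \<and> s < d \<longrightarrow>
        f (u + h + s *\<^sub>R v) - f (u + h) \<le> (b + \<epsilon>) * s"
      by (intro exI[of _ d]) (auto simp: field_simps intro: less_imp_le)
  qed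
next
  assume R: ?R
  show ?L unfolding clarke_deriv_def Limsup_le_iff
  proof (intro allI impI)
    fix y assume y: "ereal b < y"
    then obtain c where c: "b < c" "ereal c < y" using ereal_dense2 by force
    then obtain d where "d > 0" "\<And>h s. norm h < d \<Longrightarrow> 0 < s \<Longrightarrow> s < d \<Longrightarrow>
        f (u + h + s *\<^sub>R v) - f (u + h) \<le> c * s"
      using R[rule_format, of "c - b"] by auto
    then have "\<forall>h s. norm h < d \<and> 0 < s \<and> s < d \<longrightarrow>
        ereal (1 / s * (f (u + h + s *\<^sub>R v) - f (u + h))) < y"
      using c(2) by (auto simp: field_simps intro!: order.strict_trans1[OF _ c(2)])
    then show "\<forall>\<^sub>F x in nhds 0 \<times>\<^sub>F at_right 0.
        (case x of (h, s) \<Rightarrow> ereal (1 / s * (f (u + h + s *\<^sub>R v) - f (u + h)))) < y"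
      unfolding eventually_nhds_0_at_right_0 using \<open>d > 0\<close> by auto
  qed
qed

text \<open>The limit superior runs over all base points near \<open>u\<close>, so
  \<open>h + s *\<^sub>R v\<close> is again an admissible perturbation and the increment telescopes.
  The radius is divided by \<open>norm v + 1\<close> to keep it small; the \<open>+ 1\<close> covers
  \<open>v = 0\<close>.\<close>

lemma clarke_deriv_add_le:
  fixes f :: "'a::real_normed_vector \<Rightarrow> real"
  assumes "clarke_deriv f u v \<le> ereal a" "clarke_deriv f u w \<le> ereal b"
  shows "clarke_deriv f u (v + w) \<le> ereal (a + b)"
  unfolding clarke_deriv_le_iff
proof (intro allI impI)
  fix \<epsilon> :: real assume e: "\<epsilon> > 0"
  obtain d1 where d1: "d1 > 0" "\<And>h s. norm h < d1 \<Longrightarrow> 0 < s \<Longrightarrow> s < d1 \<Longrightarrow>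
      f (u + h + s *\<^sub>R v) - f (u + h) \<le> (a + \<epsilon>/2) * s"
    using assms(1)[unfolded clarke_deriv_le_iff, rule_format, of "\<epsilon>/2"] e by auto
  obtain d2 where d2: "d2 > 0" "\<And>h s. norm h < d2 \<Longrightarrow> 0 < s \<Longrightarrow> s < d2 \<Longrightarrow>
      f (u + h + s *\<^sub>R w) - f (u + h) \<le> (b + \<epsilon>/2) * s"
    using assms(2)[unfolded clarke_deriv_le_iff, rule_format, of "\<epsilon>/2"] e by auto
  define d where "d = min d1 (d2 / (2 * (norm v + 1)))"
  have nv: "norm v + 1 > 0" by (simp add: add_nonneg_pos)
  have d: "d > 0" "d \<le> d1" "d * (norm v + 1) \<le> d2 / 2"
  proof -
    show "d > 0" "d \<le> d1" using d1 d2 nv by (auto simp: d_def)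
    have "d * (norm v + 1) \<le> d2 / (2 * (norm v + 1)) * (norm v + 1)"
      using nv by (intro mult_right_mono) (auto simp: d_def)
    then show "d * (norm v + 1) \<le> d2 / 2" unfolding half_div_mult[OF nv] .
  qed
  have "f (u + h + s *\<^sub>R (v + w)) - f (u + h) \<le> (a + b + \<epsilon>) * s"
    if hs: "norm h < d" "0 < s" "s < d" for h s
  proof -
    have "norm (h + s *\<^sub>R v) \<le> norm h + s * norm v"
      using norm_triangle_ineq[of h "s *\<^sub>R v"] hs by simp
    also have "s * norm v \<le> d * norm v" using hs by (intro mult_right_mono) auto
    also have "norm h + d * norm v < d + d * norm v" using hs by simp
    also have "\<dots> < d2" using d(3) d2(1) by (simp add: algebra_simps)
    finally have n: "norm (h + s *\<^sub>R v) < d2" by simp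
    have "d * 1 \<le> d * (norm v + 1)" using d(1) by (intro mult_left_mono) auto
    then have "d < d2" using d(3) d2(1) by linarith
    then have "f (u + (h + s *\<^sub>R v) + s *\<^sub>R w) - f (u + (h + s *\<^sub>R v)) \<le> (b + \<epsilon>/2) * s"
      using d2(2)[OF n] hs by simp
    moreover have "f (u + h + s *\<^sub>R v) - f (u + h) \<le> (a + \<epsilon>/2) * s"
      using d1(2) hs d(2) by simp
    moreover have "u + (h + s *\<^sub>R v) + s *\<^sub>R w = u + h + s *\<^sub>R (v + w)"
      "u + (h + s *\<^sub>R v) = u + h + s *\<^sub>R v" by (simp_all add: algebra_simps)
    ultimately show ?thesis by (simp add: algebra_simps)
  qed
  then show "\<exists>d>0. \<forall>h s. norm h < d \<and> 0 < s \<and> s < d \<longrightarrow>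
      f (u + h + s *\<^sub>R (v + w)) - f (u + h) \<le> (a + b + \<epsilon>) * s" using d(1) by blast
qed

lemma clarke_deriv_scale_le:
  fixes f :: "'a::real_normed_vector \<Rightarrow> real"
  assumes "clarke_deriv f u v \<le> ereal a" "t > 0"
  shows "clarke_deriv f u (t *\<^sub>R v) \<le> ereal (t * a)"
  unfolding clarke_deriv_le_iff
proof (intro allI impI)
  fix \<epsilon> :: real assume e: "\<epsilon> > 0"
  obtain d where d: "d > 0" "\<And>h s. norm h < d \<Longrightarrow> 0 < s \<Longrightarrow> s < d \<Longrightarrow>
      f (u + h + s *\<^sub>R v) - f (u + h) \<le> (a + \<epsilon>/t) * s"
    using assms(1)[unfolded clarke_deriv_le_iff, rule_format, of "\<epsilon>/t"] e assms(2) by auto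
  have "f (u + h + s *\<^sub>R (t *\<^sub>R v)) - f (u + h) \<le> (t * a + \<epsilon>) * s"
    if "norm h < min d (d/t)" "0 < s" "s < min d (d/t)" for h s
  proof -
    have "f (u + h + (s * t) *\<^sub>R v) - f (u + h) \<le> (a + \<epsilon>/t) * (s * t)"
      using d(2)[of h "s * t"] that assms(2) by (simp add: field_simps)
    also have "\<dots> = (t * a + \<epsilon>) * s" using assms(2) by (simp add: algebra_simps)
    finally show ?thesis by simp
  qed
  then show "\<exists>d>0. \<forall>h s. norm h < d \<and> 0 < s \<and> s < d \<longrightarrow>
      f (u + h + s *\<^sub>R (t *\<^sub>R v)) - f (u + h) \<le> (t * a + \<epsilon>) * s"
    using d(1) assms(2) by (intro exI[of _ "min d (d/t)"]) auto
qed

text \<open>Excludes negative values in direction 0, which is what later makes the gradient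
  nonempty.\<close>

lemma clarke_deriv_zero:
  fixes f :: "'a::real_normed_vector \<Rightarrow> real"
  shows "clarke_deriv f u 0 \<le> ereal b \<longleftrightarrow> b \<ge> 0"
proof
  assume L: "clarke_deriv f u 0 \<le> ereal b"
  show "b \<ge> 0"
  proof (rule field_le_epsilon)
    fix e :: real assume "e > 0"
    then obtain d where d: "d > 0" "\<forall>h::'a. \<forall>s. norm h < d \<and> 0 < s \<and> s < d \<longrightarrow> 0 \<le> (b + e) * s"
      using L[unfolded clarke_deriv_le_iff, rule_format, of e] by auto
    then have "0 \<le> (b + e) * (d / 2)" using d(2)[rule_format, of 0 "d/2"] d(1) by simp
    then show "0 \<le> b + e" using d(1) by (simp add: zero_le_mult_iff)
  qed
next
  assume "b \<ge> 0"
  then show "clarke_deriv f u 0 \<le> ereal b"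
    unfolding clarke_deriv_le_iff by (auto intro!: exI[of _ 1])
qed

text \<open>This linear growth bound later yields closedness of the epigraph and excludes vertical
  separating hyperplanes.\<close>

lemma clarke_deriv_lipschitz:
  fixes f :: "'a::real_normed_vector \<Rightarrow> real"
  assumes "locally_lipschitz f"
  obtains L where "L \<ge> 0" "\<And>v. clarke_deriv f u v \<le> ereal (L * norm v)"
proof -
  obtain r L where r: "r > 0" and L: "L-lipschitz_on (ball u r) f"
    using assms unfolding locally_lipschitz_def by blast
  have L0: "L \<ge> 0" using L lipschitz_on_nonneg by blast
  have "clarke_deriv f u v \<le> ereal (L * norm v)" for v
    unfolding clarke_deriv_le_iff
  proof (intro allI impI)
    fix \<epsilon> :: real assume e: "\<epsilon> > 0"
    have nv: "norm v + 1 > 0" by (simp add: add_nonneg_pos)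
    define d where "d = r / (2 * (norm v + 1))"
    have "d > 0" using r nv by (simp add: d_def)
    moreover have "d * (norm v + 1) = r / 2" unfolding d_def using nv by (rule half_div_mult)
    ultimately have d: "d > 0" "d * (norm v + 1) < r" using r by linarith+
    have "f (u + h + s *\<^sub>R v) - f (u + h) \<le> (L * norm v + \<epsilon>) * s"
      if hs: "norm h < d" "0 < s" "s < d" for h s
    proof -
      have "norm (h + s *\<^sub>R v) \<le> norm h + s * norm v"
        using norm_triangle_ineq[of h "s *\<^sub>R v"] hs by simp
      also have "s * norm v \<le> d * norm v" using hs by (intro mult_right_mono) auto
      also have "norm h + d * norm v < d + d * norm v" using hs by simp
      finally have n: "norm (h + s *\<^sub>R v) < r" using d(2) by (simp add: algebra_simps)
      have "d \<le> d * (norm v + 1)" using d(1) by (simp add: algebra_simps)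
      then have "norm h < r" using hs d(2) by linarith
      moreover have "u + x \<in> ball u r" if "norm x < r" for x using that by (simp add: dist_norm)
      ultimately have "u + h + s *\<^sub>R v \<in> ball u r" "u + h \<in> ball u r"
        using n by (simp_all add: add.assoc)
      then have "dist (f (u + h + s *\<^sub>R v)) (f (u + h)) \<le> L * dist (u + h + s *\<^sub>R v) (u + h)"
        using lipschitz_onD[OF L] by blast
      then have "f (u + h + s *\<^sub>R v) - f (u + h) \<le> L * (s * norm v)"
        using hs by (simp add: dist_norm dist_real_def)
      moreover have "0 \<le> \<epsilon> * s" using e hs by simp
      ultimately show ?thesis by (simp add: algebra_simps)
    qed
    then show "\<exists>d>0. \<forall>h s. norm h < d \<and> 0 < s \<and> s < d \<longrightarrow>
        f (u + h + s *\<^sub>R v) - f (u + h) \<le> (L * norm v + \<epsilon>) * s" using d(1) by blast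
  qed
  then show ?thesis using that L0 by blast
qed

text \<open>The Riesz representatives of \<open>gen_gradient\<close>. Quantifying over real upper
  bounds \<open>b\<close> avoids extended reals and displays the set as an intersection of closed
  half-spaces.\<close>

definition grad_vectors :: "('a::real_inner \<Rightarrow> real) \<Rightarrow> 'a \<Rightarrow> 'a set" where
  "grad_vectors f u = {x. \<forall>v b. clarke_deriv f u v \<le> ereal b \<longrightarrow> inner x v \<le> b}"

lemma blinfun_inner_right_in_gen_gradient_iff:
  "blinfun_inner_right x \<in> gen_gradient f u \<longleftrightarrow> x \<in> grad_vectors f u" (is "?L \<longleftrightarrow> ?R")
proof
  assume L: ?L
  show ?R unfolding grad_vectors_def
  proof (intro CollectI allI impI)
    fix v b assume b: "clarke_deriv f u v \<le> ereal b"
    have "ereal (inner x v) \<le> clarke_deriv f u v" using L by (simp add: gen_gradient_def)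
    then show "inner x v \<le> b" using b ereal_less_eq(3) order_trans by blast
  qed
next
  assume R: ?R
  have "ereal (inner x v) \<le> clarke_deriv f u v" for v
  proof (rule ccontr)
    assume "\<not> ?thesis"
    then obtain b where "clarke_deriv f u v < ereal b" "ereal b < ereal (inner x v)"
      using ereal_dense2 by (meson not_le)
    moreover from this(1) have "inner x v \<le> b"
      using R unfolding grad_vectors_def by (simp add: less_imp_le)
    ultimately show False by simp
  qed
  then show ?L by (simp add: gen_gradient_def)
qed

lemma gen_gradient_eq:
  fixes f :: "'a::{real_inner, complete_space} \<Rightarrow> real"
  shows "gen_gradient f u = blinfun_inner_right ` grad_vectors f u"
proof (intro equalityI subsetI)
  fix \<xi> assume "\<xi> \<in> gen_gradient f u"
  then show "\<xi> \<in> blinfun_inner_right ` grad_vectors f u"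
    by (metis riesz_representation blinfun_inner_right_in_gen_gradient_iff imageI)
qed (auto simp: blinfun_inner_right_in_gen_gradient_iff)

lemma grad_vectors_convex: "convex (grad_vectors f u)"
  and grad_vectors_closed: "closed (grad_vectors f u)"
proof -
  have eq: "grad_vectors f u = (\<Inter>(v, b)\<in>{(v, b). clarke_deriv f u v \<le> ereal b}. {x. inner v x \<le> b})"
    unfolding grad_vectors_def by (auto simp: inner_commute)
  show "convex (grad_vectors f u)" unfolding eq by (intro convex_INT) (auto intro: convex_halfspace_le)
  show "closed (grad_vectors f u)" unfolding eq by (intro closed_INT) (auto intro: closed_halfspace_le)
qed

text \<open>In a Hilbert space the Hahn--Banach theorem for the sublinear function
  \<^term>\<open>clarke_deriv f u\<close> reduces to projecting onto its epigraph, a closed convex cone.\<close>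

lemma grad_vector_separation:
  fixes f :: "'a::{real_inner, complete_space} \<Rightarrow> real"
  assumes lip: "locally_lipschitz f" and nb: "\<not> clarke_deriv f u v \<le> ereal b"
  obtains x where "x \<in> grad_vectors f u" "inner x v > b"
proof -
  obtain L where L: "L \<ge> 0" "\<And>v. clarke_deriv f u v \<le> ereal (L * norm v)"
    using clarke_deriv_lipschitz[OF lip] by blast
  define E where "E = {z. clarke_deriv f u (fst z) \<le> ereal (snd z)}"
  have add: "z + w \<in> E" if "z \<in> E" "w \<in> E" for z w
    using that clarke_deriv_add_le by (auto simp: E_def)
  have zero: "(0, r) \<in> E" if "r \<ge> 0" for r
    using that by (simp add: E_def clarke_deriv_zero)
  have scale: "t *\<^sub>R z \<in> E" if "z \<in> E" "t \<ge> 0" for t z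
  proof (cases "t = 0")
    case True then show ?thesis using zero[of 0] by (simp add: zero_prod_def)
  next
    case False then show ?thesis using that clarke_deriv_scale_le[of f u "fst z" "snd z" t] by (simp add: E_def)
  qed
  have convE: "convex E" by (rule convexI) (auto intro!: add scale)
  have clE: "closed E"
    unfolding closed_sequential_limits
  proof (intro allI impI, elim conjE)
    fix z l assume z: "\<forall>n. z n \<in> E" and lim: "z \<longlonglongrightarrow> l"
    \<comment> \<open>Subadditivity compares the directions \<open>fst l\<close> and
      \<open>fst (z n)\<close>; the Lipschitz bound makes the error vanish in the limit.\<close>
    have le: "clarke_deriv f u (fst l) \<le> ereal (snd (z n) + L * norm (fst l - fst (z n)))" for n
      using clarke_deriv_add_le[of f u "fst (z n)" "snd (z n)" "fst l - fst (z n)"] z L(2)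
      by (simp add: E_def)
    have "(\<lambda>n. snd (z n) + L * norm (fst l - fst (z n))) \<longlonglongrightarrow> snd l + L * norm (fst l - fst l)"
      by (intro tendsto_intros lim)
    then have "(\<lambda>n. ereal (snd (z n) + L * norm (fst l - fst (z n)))) \<longlonglongrightarrow> ereal (snd l)" by simp
    then have "clarke_deriv f u (fst l) \<le> ereal (snd l)"
      by (rule LIMSEQ_le_const) (use le in blast)
    then show "l \<in> E" by (simp add: E_def)
  qed
  obtain p where p: "p \<in> E" "\<And>e. e \<in> E \<Longrightarrow> inner ((v, b) - p) (e - p) \<le> 0"
    using nearest_point_exists[OF convE clE] zero[of 0] by (metis empty_iff order_refl)
  define n where "n = (v, b) - p"
  have "(v, b) \<notin> E" using nb by (simp add: E_def)
  then have n0: "n \<noteq> 0" using p(1) by (auto simp: n_def)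
  \<comment> \<open>\<open>E\<close> is a cone: testing the projection inequality with
    \<open>2 *\<^sub>R p\<close> and with 0 gives both signs.\<close>
  have "inner n p = 0"
    using p(2)[OF scale[OF p(1), of 2]] p(2)[OF zero[of 0]]
    by (simp add: n_def scaleR_2 zero_prod_def[symmetric])
  then have nE: "inner n e \<le> 0" if "e \<in> E" for e
    using p(2)[OF that] by (simp add: n_def inner_diff_right)
  have "inner n (v, b) = inner n n" using \<open>inner n p = 0\<close> by (simp add: n_def inner_diff_right)
  then have nz: "inner n (v, b) > 0" using n0 by simp
  define \<eta> \<sigma> where "\<eta> = fst n" and "\<sigma> = - snd n"
  have ni: "inner n (x, r) = inner \<eta> x - \<sigma> * r" for x r by (simp add: inner_prod_def \<eta>_def \<sigma>_def)
  have "\<sigma> \<ge> 0" using nE[OF zero[of 1]] ni by simp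
  \<comment> \<open>A vertical hyperplane is impossible, since the epigraph contains a point above
    every direction, in particular above \<open>\<eta>\<close>.\<close>
  moreover have "\<sigma> \<noteq> 0"
  proof
    assume "\<sigma> = 0"
    then have "inner \<eta> \<eta> \<le> 0" using nE[of "(\<eta>, L * norm \<eta>)"] L(2) ni by (simp add: E_def)
    then have "\<eta> = 0" using inner_gt_zero_iff[of \<eta>] by linarith
    then show False using n0 \<open>\<sigma> = 0\<close> by (simp add: \<eta>_def \<sigma>_def prod_eq_iff)
  qed
  ultimately have \<sigma>: "\<sigma> > 0" by simp
  show ?thesis
  proof (rule that[of "\<eta> /\<^sub>R \<sigma>"])
    show "\<eta> /\<^sub>R \<sigma> \<in> grad_vectors f u" unfolding grad_vectors_def
    proof (intro CollectI allI impI)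
      fix w r assume "clarke_deriv f u w \<le> ereal r"
      then have "inner \<eta> w \<le> \<sigma> * r" using nE[of "(w, r)"] ni by (simp add: E_def)
      then show "inner (\<eta> /\<^sub>R \<sigma>) w \<le> r" using \<sigma> by (simp add: field_simps)
    qed
    show "inner (\<eta> /\<^sub>R \<sigma>) v > b" using nz ni \<sigma> by (simp add: field_simps)
  qed
qed

text \<open>The Hahn-Banach half of duality: Clarke's derivative is at most the support function of
  \<open>grad_vectors\<close>. A bound on all gradients thereby becomes a rate of decrease.\<close>

lemma clarke_deriv_le_of_grad_vectors:
  fixes f :: "'a::{real_inner, complete_space} \<Rightarrow> real"
  assumes "locally_lipschitz f" "\<And>x. x \<in> grad_vectors f u \<Longrightarrow> inner x w \<ge> a"
  shows "clarke_deriv f u (- w) \<le> ereal (- a)"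
proof (rule ccontr)
  assume "\<not> ?thesis"
  then obtain x where "x \<in> grad_vectors f u" "inner x (- w) > - a"
    using grad_vector_separation[OF assms(1)] by blast
  then show False using assms(2) by fastforce
qed

text \<open>The gradient set is nonempty, closed and convex, so the minimum behind
  \<open>LEAST\<close> exists. By the variational inequality a single vector, if nonzero, has
  positive inner product with all gradients and so gives a common descent direction.\<close>

lemma min_grad_norm_attained:
  fixes f :: "'a::{real_inner, complete_space} \<Rightarrow> real"
  assumes "locally_lipschitz f"
  obtains x where "x \<in> grad_vectors f u" "min_grad_norm f u = norm x"
    "\<And>y. y \<in> grad_vectors f u \<Longrightarrow> inner x y \<ge> (norm x)\<^sup>2"
proof -
  have "\<not> clarke_deriv f u 0 \<le> ereal (-1)" by (simp add: clarke_deriv_zero)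
  then have "grad_vectors f u \<noteq> {}" using grad_vector_separation[OF assms] by blast
  then obtain x where x: "x \<in> grad_vectors f u" "\<And>y. y \<in> grad_vectors f u \<Longrightarrow> norm x \<le> norm y"
    "\<And>y. y \<in> grad_vectors f u \<Longrightarrow> inner x y \<ge> (norm x)\<^sup>2"
    using convex_min_norm_exists[OF grad_vectors_convex grad_vectors_closed] by blast
  have "norm ` gen_gradient f u = norm ` grad_vectors f u"
    by (simp add: gen_gradient_eq image_image norm_blinfun_inner_right)
  then have "min_grad_norm f u = norm x"
    unfolding min_grad_norm_def using x(1,2) by (intro Least_equality) auto
  then show ?thesis using that x by blast
qed

text \<open>Sum rule for a term \<open>q\<close> strictly differentiable at \<open>u\<close> with
  gradient \<open>G\<close>. The increment of \<open>g\<close> in direction \<open>v\<close> is read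
  backwards from the base point \<open>h - s *\<^sub>R v\<close>. This links gradients of
  \<open>I\<close> to those of \<open>\<Psi>\<close>, whose boundedness (H) provides.\<close>

lemma grad_vectors_diff:
  fixes q g :: "'a::real_inner \<Rightarrow> real"
  assumes strict: "\<And>v \<epsilon>. \<epsilon> > 0 \<Longrightarrow> \<exists>d>0. \<forall>h s. norm h < d \<and> 0 < s \<and> s < d \<longrightarrow>
      q (u + h + s *\<^sub>R v) - q (u + h) \<le> (inner G v + \<epsilon>) * s"
    and x: "x \<in> grad_vectors (\<lambda>u. q u - g u) u"
  shows "G - x \<in> grad_vectors g u"
  unfolding grad_vectors_def
proof (intro CollectI allI impI)
  fix v b assume b: "clarke_deriv g u v \<le> ereal b"
  have "clarke_deriv (\<lambda>u. q u - g u) u (- v) \<le> ereal (b - inner G v)"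
    unfolding clarke_deriv_le_iff
  proof (intro allI impI)
    fix \<epsilon> :: real assume e: "\<epsilon> > 0"
    obtain d1 where d1: "d1 > 0" "\<And>h s. norm h < d1 \<Longrightarrow> 0 < s \<Longrightarrow> s < d1 \<Longrightarrow>
        g (u + h + s *\<^sub>R v) - g (u + h) \<le> (b + \<epsilon>/2) * s"
      using b[unfolded clarke_deriv_le_iff, rule_format, of "\<epsilon>/2"] e by auto
    obtain d2 where d2: "d2 > 0" "\<And>h s. norm h < d2 \<Longrightarrow> 0 < s \<Longrightarrow> s < d2 \<Longrightarrow>
        q (u + h + s *\<^sub>R (- v)) - q (u + h) \<le> (inner G (- v) + \<epsilon>/2) * s"
      using strict[of "\<epsilon>/2" "- v"] e by auto
    have nv: "norm v + 1 > 0" by (simp add: add_nonneg_pos)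
    define d where "d = min d2 (d1 / (2 * (norm v + 1)))"
    have d: "d > 0" "d \<le> d2" "d * (norm v + 1) \<le> d1 / 2"
    proof -
      show "d > 0" "d \<le> d2" using d1 d2 nv by (auto simp: d_def)
      have "d * (norm v + 1) \<le> d1 / (2 * (norm v + 1)) * (norm v + 1)"
        using nv by (intro mult_right_mono) (auto simp: d_def)
      then show "d * (norm v + 1) \<le> d1 / 2" unfolding half_div_mult[OF nv] .
    qed
    have "q (u + h + s *\<^sub>R (- v)) - g (u + h + s *\<^sub>R (- v)) - (q (u + h) - g (u + h))
        \<le> (b - inner G v + \<epsilon>) * s"
      if hs: "norm h < d" "0 < s" "s < d" for h s
    proof -
      have "norm (h - s *\<^sub>R v) \<le> norm h + s * norm v"
        using norm_triangle_ineq4[of h "s *\<^sub>R v"] hs by simp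
      also have "s * norm v \<le> d * norm v" using hs by (intro mult_right_mono) auto
      also have "norm h + d * norm v < d + d * norm v" using hs by simp
      also have "\<dots> < d1" using d(3) d1(1) by (simp add: algebra_simps)
      finally have n: "norm (h - s *\<^sub>R v) < d1" by simp
      have "d * 1 \<le> d * (norm v + 1)" using d(1) by (intro mult_left_mono) auto
      then have "d < d1" using d(3) d1(1) by linarith
      then have "g (u + (h - s *\<^sub>R v) + s *\<^sub>R v) - g (u + (h - s *\<^sub>R v)) \<le> (b + \<epsilon>/2) * s"
        using d1(2)[OF n hs(2)] hs(3) by (meson less_trans)
      moreover have "q (u + h + s *\<^sub>R (- v)) - q (u + h) \<le> (- inner G v + \<epsilon>/2) * s"
        using d2(2)[of h s] hs d(2) by simp
      moreover have "u + (h - s *\<^sub>R v) + s *\<^sub>R v = u + h"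
        "u + (h - s *\<^sub>R v) = u + h + s *\<^sub>R (- v)" by (simp_all add: algebra_simps)
      ultimately show ?thesis by (simp add: algebra_simps)
    qed
    then show "\<exists>d>0. \<forall>h s. norm h < d \<and> 0 < s \<and> s < d \<longrightarrow>
        q (u + h + s *\<^sub>R (- v)) - g (u + h + s *\<^sub>R (- v)) - (q (u + h) - g (u + h))
        \<le> (b - inner G v + \<epsilon>) * s" using d(1) by blast
  qed
  then have "inner x (- v) \<le> b - inner G v" using x unfolding grad_vectors_def by blast
  then show "inner (G - x) v \<le> b" by (simp add: inner_diff_left)
qed

text \<open>The function cannot cross the barrier \<open>max (h 0 - b * t) m\<close> raised by a
  small increasing term, which absorbs the error in the one-sided quotients. These are controlled
  only above the level \<open>m\<close>, hence the maximum.\<close>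

lemma dini_descent:
  fixes h :: "real \<Rightarrow> real"
  assumes cont: "continuous_on {0..T} h"
    and dini: "\<And>t \<epsilon>. 0 \<le> t \<Longrightarrow> t < T \<Longrightarrow> h t > m \<Longrightarrow> \<epsilon> > 0 \<Longrightarrow>
      \<exists>d>0. \<forall>s. 0 < s \<and> s < d \<longrightarrow> h (t + s) \<le> h t + (\<epsilon> - b) * s"
    and b: "b \<ge> 0" and t: "0 \<le> t" "t \<le> T"
  shows "h t \<le> max (h 0 - b * t) m"
proof (rule field_le_epsilon)
  fix e0 :: real assume "e0 > 0"
  \<comment> \<open>Makes the excess \<open>e * (1 + t)\<close> of the raised barrier equal to
    \<open>e0\<close> at the time in question.\<close>
  define e where "e = e0 / (1 + t)"
  have e: "e > 0" using \<open>e0 > 0\<close> t by (simp add: e_def)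
  define r where "r = (\<lambda>t. max (h 0 - b * t) m + e * (1 + t))"
  define f where "f = (\<lambda>t. h t - r t)"
  have fc: "continuous_on {0..T} f" unfolding f_def r_def by (intro continuous_intros cont)
  have "f t \<le> 0"
  proof (rule ccontr)
    assume bad: "\<not> f t \<le> 0"
    define B where "B = {s\<in>{0..T}. f s > 0}"
    \<comment> \<open>The infimum of the violations. Continuity gives \<open>f a \<le> 0\<close>,
      and the local estimates extend this to the right of \<open>a\<close>, contradicting the choice
      of \<open>a\<close>.\<close>
    define a where "a = Inf B"
    have tB: "t \<in> B" using bad t by (simp add: B_def)
    have bB: "bdd_below B" by (rule bdd_belowI[of _ 0]) (auto simp: B_def)
    have a0: "a \<ge> 0" unfolding a_def using tB by (intro cInf_greatest) (auto simp: B_def)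
    have at: "a \<le> t" unfolding a_def using tB bB by (rule cInf_lower)
    have below: "f s \<le> 0" if "0 \<le> s" "s < a" for s
    proof (rule ccontr)
      assume "\<not> f s \<le> 0"
      then have "s \<in> B" using that at t by (simp add: B_def)
      then show False using cInf_lower[OF _ bB] that(2) unfolding a_def by fastforce
    qed
    have f0: "f 0 < 0" using e by (simp add: f_def r_def)
    have nbhd: "\<exists>d>0. \<forall>s\<in>{0..T}. \<bar>s - a\<bar> < d \<longrightarrow> \<bar>f s - f a\<bar> < \<epsilon>" if "\<epsilon> > 0" for \<epsilon>
      using fc[unfolded continuous_on_iff, rule_format, of a \<epsilon>] a0 at t that
      by (auto simp: dist_real_def)
    have fa: "f a \<le> 0"
    proof (rule ccontr)
      assume fa: "\<not> f a \<le> 0"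
      then have "a > 0" using f0 a0 by (cases "a = 0") auto
      obtain d where d: "d > 0" "\<And>s. s \<in> {0..T} \<Longrightarrow> \<bar>s - a\<bar> < d \<Longrightarrow> \<bar>f s - f a\<bar> < f a"
        using nbhd[of "f a"] fa by auto
      define s where "s = max 0 (a - d/2)"
      have "0 \<le> s" "s < a" "\<bar>s - a\<bar> < d" using \<open>a > 0\<close> d(1) by (auto simp: s_def)
      then show False using below[of s] d(2)[of s] at t by auto
    qed
    have aT: "a < T" using fa at t bad by (cases "a = t") auto
    have "\<exists>d>0. \<forall>s. a \<le> s \<and> s < a + d \<and> s \<le> T \<longrightarrow> f s \<le> 0"
    proof (cases "h a > m")
      case True
      then obtain d where d: "d > 0" "\<And>s. 0 < s \<Longrightarrow> s < d \<Longrightarrow> h (a + s) \<le> h a + (e - b) * s"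
        using dini[OF a0 aT _ e] by blast
      have "f s \<le> 0" if "a \<le> s" "s < a + d" for s
      proof (cases "s = a")
        case False
        then have "h s \<le> h a + (e - b) * (s - a)" using d(2)[of "s - a"] that by simp
        moreover have "h a \<le> max (h 0 - b * a) m + e * (1 + a)" using fa by (simp add: f_def r_def)
        moreover have "max (h 0 - b * a) m - b * (s - a) \<le> max (h 0 - b * s) m"
          using mult_nonneg_nonneg[OF b, of "s - a"] that by (simp add: max_def algebra_simps)
        ultimately show ?thesis by (simp add: f_def r_def algebra_simps)
      qed (use fa in simp)
      then show ?thesis using d(1) by blast
    next
      case False
      \<comment> \<open>At or below level \<open>m\<close> the raised barrier leaves strictly
        positive room, so continuity alone suffices.\<close>
      have "e * (1 + a) > 0" using e a0 by simp
      then have "f a < 0" using False unfolding f_def r_def by linarith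
      then obtain d where d: "d > 0" "\<And>s. s \<in> {0..T} \<Longrightarrow> \<bar>s - a\<bar> < d \<Longrightarrow> \<bar>f s - f a\<bar> < - f a"
        using nbhd[of "- f a"] by auto
      have "f s \<le> 0" if "a \<le> s" "s < a + d" "s \<le> T" for s
        using d(2)[of s] that a0 by auto
      then show ?thesis using d(1) by blast
    qed
    then obtain d where d: "d > 0" "\<And>s. a \<le> s \<Longrightarrow> s < a + d \<Longrightarrow> s \<le> T \<Longrightarrow> f s \<le> 0" by blast
    obtain s where s: "s \<in> B" "s < a + d" using cInf_lessD[of B "a + d"] tB d(1) by (auto simp: a_def)
    then show False using d(2)[of s] cInf_lower[OF s(1) bB] by (auto simp: B_def a_def)
  qed
  then show "h t \<le> max (h 0 - b * t) m + e0" using t by (simp add: f_def r_def e_def)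
qed

section \<open>The topology \<open>\<tau>\<close>\<close>

lemma orthonormal_basis_exists:
  fixes B :: "'a::real_inner set"
  assumes "finite B"
  obtains C where "finite C" "span C = span B" "\<And>c. c \<in> C \<Longrightarrow> norm c = 1" "pairwise orthogonal C"
proof -
  obtain C where C: "finite C" "span C = span B" "pairwise orthogonal C"
    using basis_orthogonal[OF assms] by blast
  define D where "D = (\<lambda>c. c /\<^sub>R norm c) ` (C - {0})"
  have "span D = span (C - {0})" unfolding D_def using C(1) by (intro span_image_scale) auto
  then have "span D = span B" using C(2) by simp
  moreover have "pairwise orthogonal D"
    using C(3) by (auto simp: D_def pairwise_def orthogonal_def)
  moreover have "norm c = 1" if "c \<in> D" for c
  proof -
    from that obtain d where d: "c = d /\<^sub>R norm d" "d \<in> C - {0}" unfolding D_def by (rule imageE)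
    then show ?thesis unfolding d(1) by simp
  qed
  moreover have "finite D" unfolding D_def using C(1) by simp
  ultimately show ?thesis using that by blast
qed

locale split_space =
  fixes Y Z :: "'a::{real_inner, complete_space} set" and J :: "nat set" and e :: "nat \<Rightarrow> 'a"
  assumes separable: "separable_space (euclidean :: 'a topology)"
    and Y: "subspace Y" "closed Y"
    and Z: "Z = orthogonal_comp Y"
    and e: "total_orthonormal_seq Y J e"
begin

text \<open>\<open>P u\<close> is the component u^- in \<open>Y\<close>, and \<open>Q u\<close>
  below is the component u^+ in \<open>Z\<close>.\<close>

definition P :: "'a \<Rightarrow> 'a" where "P = orth_proj Y"
definition Q :: "'a \<Rightarrow> 'a" where "Q = orth_proj Z"
definition N :: "'a \<Rightarrow> real" where "N = tau_norm Y J e"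

lemma subspace_Z: "subspace Z" using Z subspace_orthogonal_comp by simp

lemma P_in: "P u \<in> Y" and diff_P_in: "u - P u \<in> Z"
proof -
  obtain p where p: "p \<in> Y" "u - p \<in> Y\<^sup>\<bottom>" using subspace_nearest_point_exists[OF Y] by blast
  then have "P u = p" unfolding P_def using orth_proj_eqI Y(1) by blast
  then show "P u \<in> Y" "u - P u \<in> Z" using p Z by auto
qed

lemma Q_eq: "Q u = u - P u"
  unfolding Q_def
proof (rule orth_proj_eqI[OF subspace_Z diff_P_in])
  show "u - (u - P u) \<in> Z\<^sup>\<bottom>" using P_in[of u] orthogonal_comp_subset[of Y] Z by auto
qed

lemma Q_in: "Q u \<in> Z" using diff_P_in by (simp add: Q_eq)

lemma P_add_Q: "P u + Q u = u" by (simp add: Q_eq)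

lemma P_eqI: "p \<in> Y \<Longrightarrow> u - p \<in> Z \<Longrightarrow> P u = p"
  unfolding P_def using orth_proj_eqI Y(1) Z by blast

lemma inner_YZ: "y \<in> Y \<Longrightarrow> z \<in> Z \<Longrightarrow> inner y z = 0"
  using Z orthogonal_compD inner_commute by metis

lemma linear_P: "linear P"
proof (rule linearI)
  fix u v and c :: real
  have "(u - P u) + (v - P v) \<in> Z" by (intro subspace_add subspace_Z diff_P_in)
  then show "P (u + v) = P u + P v"
    by (intro P_eqI) (auto intro!: subspace_add Y P_in simp: algebra_simps)
  have "c *\<^sub>R (u - P u) \<in> Z" by (intro subspace_scale subspace_Z diff_P_in)
  then show "P (c *\<^sub>R u) = c *\<^sub>R P u"
    by (intro P_eqI) (auto intro!: subspace_scale Y P_in simp: algebra_simps)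
qed

lemma linear_Q: "linear Q"
  unfolding Q_eq[abs_def] by (intro linear_compose_sub linear_ident linear_P)

lemma norm_split: "(norm u)\<^sup>2 = (norm (P u))\<^sup>2 + (norm (Q u))\<^sup>2"
proof -
  have "(norm (P u + Q u))\<^sup>2 = (norm (P u))\<^sup>2 + (norm (Q u))\<^sup>2"
    unfolding power2_norm_eq_inner using inner_YZ[OF P_in Q_in, of u u]
    by (simp add: inner_add_left inner_add_right inner_commute)
  then show ?thesis by (simp add: P_add_Q)
qed

lemma norm_P_le: "norm (P u) \<le> norm u" and norm_Q_le: "norm (Q u) \<le> norm u"
  using norm_split[of u] by (auto intro: power2_le_imp_le)

lemma bounded_linear_P: "bounded_linear P"
  using linear_P norm_P_le by (intro bounded_linear.intro bounded_linear_axioms.intro exI[of _ 1]) auto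

lemma bounded_linear_Q: "bounded_linear Q"
  using linear_Q norm_Q_le by (intro bounded_linear.intro bounded_linear_axioms.intro exI[of _ 1]) auto

lemmas P_simps = linear_add[OF linear_P] linear_diff[OF linear_P] linear_scale[OF linear_P]
  linear_neg[OF linear_P] linear_0[OF linear_P]
lemmas Q_simps = linear_add[OF linear_Q] linear_diff[OF linear_Q] linear_scale[OF linear_Q]
  linear_neg[OF linear_Q] linear_0[OF linear_Q]

lemma P_of_Y: "u \<in> Y \<Longrightarrow> P u = u" by (rule P_eqI) (auto intro: subspace_0 subspace_Z)
lemma Q_of_Y: "u \<in> Y \<Longrightarrow> Q u = 0" by (simp add: Q_eq P_of_Y)
lemma P_of_Z: "u \<in> Z \<Longrightarrow> P u = 0" by (rule P_eqI) (auto intro: subspace_0 Y)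
lemma Q_of_Z: "u \<in> Z \<Longrightarrow> Q u = u" by (simp add: Q_eq P_of_Z)

lemma inner_Q: "inner (Q u) v = inner u (Q v)"
proof -
  have "inner (Q u) v = inner (Q u) (Q v)"
    using inner_YZ[OF P_in Q_in, of v u] inner_add_right[of "Q u" "P v" "Q v"]
    by (simp add: P_add_Q inner_commute)
  also have "\<dots> = inner u (Q v)"
    using inner_YZ[OF P_in Q_in, of u v] inner_add_left[of "P u" "Q u" "Q v"] by (simp add: P_add_Q)
  finally show ?thesis .
qed

lemma inner_P: "inner (P u) v = inner u (P v)"
proof -
  have "inner (u - Q u) v = inner u (v - Q v)" by (simp add: inner_diff_left inner_diff_right inner_Q)
  then show ?thesis by (simp add: Q_eq)
qed

lemma e_in:
  assumes "k \<in> J"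
  shows "e k \<in> Y"
proof -
  have "e k \<in> span (e ` J)" using assms by (intro span_base imageI)
  then have "e k \<in> closure (span (e ` J))" by (rule subsetD[OF closure_subset])
  then show ?thesis using e unfolding total_orthonormal_seq_def by metis
qed

lemma norm_e: "k \<in> J \<Longrightarrow> norm (e k) = 1"
  using e unfolding total_orthonormal_seq_def norm_eq_1 by metis

lemma J_pos: "k \<in> J \<Longrightarrow> k > 0"
  using e unfolding total_orthonormal_seq_def by auto

text \<open>Extended by 0 outside \<open>J\<close>, so that finite- and infinite-dimensional
  \<open>Y\<close> share one series over the naturals. The full \<open>u\<close> may replace its
  projection because each \<open>e k\<close> lies in \<open>Y\<close>.\<close>

definition coord :: "'a \<Rightarrow> nat \<Rightarrow> real" where
  "coord u k = (if k \<in> J then (1/2) ^ k * \<bar>inner u (e k)\<bar> else 0)"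

text \<open>Index 0 is dropped because \<open>J\<close> starts at 1; the weights then sum to 1 and
  not 2, which gives \<open>N u \<le> norm u\<close> with constant 1.\<close>

definition half_sum :: "nat \<Rightarrow> real" where "half_sum k = (if k = 0 then 0 else (1/2) ^ k)"

lemma half_sum_sums: "half_sum sums 1"
  using sums_Suc[of half_sum 1] power_half_series by (simp add: half_sum_def)

lemma coord_nonneg: "coord u k \<ge> 0" by (simp add: coord_def)

lemma coord_le: "coord u k \<le> half_sum k * norm u"
proof (cases "k \<in> J")
  case True
  have "\<bar>inner u (e k)\<bar> \<le> norm u" using Cauchy_Schwarz_ineq2[of u "e k"] norm_e[OF True] by simp
  then show ?thesis using True J_pos[OF True] by (simp add: coord_def half_sum_def mult_left_mono)
qed (simp add: coord_def half_sum_def)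

lemma coord_summable: "summable (coord u)"
proof (rule summable_comparison_test'[of "\<lambda>k. half_sum k * norm u" 0])
  show "summable (\<lambda>k. half_sum k * norm u)"
    using half_sum_sums by (intro summable_mult2) (rule sums_summable)
qed (use coord_le coord_nonneg in \<open>auto simp: abs_of_nonneg\<close>)

lemma N_eq: "N u = max (norm (Q u)) (suminf (\<lambda>k. coord u k))"
proof -
  have "(\<Sum>\<^sub>\<infinity>k\<in>J. 1 / 2 ^ k * \<bar>inner (P u) (e k)\<bar>) = (\<Sum>\<^sub>\<infinity>k. coord u k)"
  proof (rule infsum_cong_neutral)
    fix k assume "k \<in> J \<inter> UNIV"
    then show "1 / 2 ^ k * \<bar>inner (P u) (e k)\<bar> = coord u k"
      by (simp add: coord_def inner_P P_of_Y e_in power_one_over)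
  qed (auto simp: coord_def)
  also have "\<dots> = (suminf (\<lambda>k. coord u k))"
  proof -
    have "coord u summable_on UNIV"
      using coord_summable coord_nonneg by (simp add: summable_on_UNIV_nonneg_real_iff)
    then show ?thesis using has_sum_infsum has_sum_imp_sums sums_unique by metis
  qed
  finally show ?thesis unfolding N_def tau_norm_def P_def Q_def Z[symmetric] by simp
qed

lemma N_nonneg: "N u \<ge> 0" by (simp add: N_eq max.coboundedI1)

lemma norm_Q_le_N: "norm (Q u) \<le> N u" by (simp add: N_eq)

lemma N_scale: "N (c *\<^sub>R u) = \<bar>c\<bar> * N u"
proof -
  have "(suminf (\<lambda>k. coord (c *\<^sub>R u) k)) = (suminf (\<lambda>k. \<bar>c\<bar> * coord u k))"
    by (intro suminf_cong) (simp add: coord_def abs_mult)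
  also have "\<dots> = \<bar>c\<bar> * (suminf (\<lambda>k. coord u k))" by (rule suminf_mult[OF coord_summable])
  finally show ?thesis by (simp add: N_eq Q_simps max_mult_distrib_left)
qed

lemma N_minus: "N (- u) = N u" using N_scale[of "-1" u] by simp

lemma N_minus_commute: "N (u - v) = N (v - u)" using N_minus[of "u - v"] by simp

lemma N_zero: "N 0 = 0" using N_scale[of 0 0] by simp

lemma N_triangle: "N (u + v) \<le> N u + N v"
proof -
  have "(suminf (\<lambda>k. coord (u + v) k)) \<le> (suminf (\<lambda>k. coord u k + coord v k))"
  proof (rule suminf_le)
    fix k
    have "(1/2::real) ^ k * \<bar>inner (u + v) (e k)\<bar> \<le> (1/2) ^ k * (\<bar>inner u (e k)\<bar> + \<bar>inner v (e k)\<bar>)"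
      by (intro mult_left_mono) (auto simp: inner_add_left)
    then show "coord (u + v) k \<le> coord u k + coord v k" by (simp add: coord_def algebra_simps)
  qed (intro coord_summable summable_add)+
  also have "\<dots> = (suminf (\<lambda>k. coord u k)) + (suminf (\<lambda>k. coord v k))"
    by (rule suminf_add[symmetric]; rule coord_summable)
  finally have "(suminf (\<lambda>k. coord (u + v) k)) \<le> N u + N v" by (simp add: N_eq)
  moreover have "norm (Q (u + v)) \<le> N u + N v"
    using norm_triangle_ineq[of "Q u" "Q v"] norm_Q_le_N[of u] norm_Q_le_N[of v] by (simp add: Q_simps)
  ultimately show ?thesis by (subst N_eq) simp
qed

lemma N_le_norm: "N u \<le> norm u"
proof -
  have s: "(\<lambda>k. half_sum k * norm u) sums (1 * norm u)" by (intro sums_mult2 half_sum_sums)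
  have "(suminf (\<lambda>k. coord u k)) \<le> (suminf (\<lambda>k. half_sum k * norm u))"
    by (intro suminf_le coord_le coord_summable sums_summable[OF s])
  then have "(suminf (\<lambda>k. coord u k)) \<le> norm u" using sums_unique[OF s] by simp
  then show ?thesis using norm_Q_le by (simp add: N_eq)
qed

text \<open>The vectors orthogonal to \<open>P u\<close> form a closed subspace containing every
  \<open>e k\<close>, hence all of \<open>Y\<close> by totality, hence \<open>P u\<close>
  itself.\<close>

lemma P_zeroI:
  assumes "\<And>k. k \<in> J \<Longrightarrow> inner u (e k) = 0"
  shows "P u = 0"
proof -
  have sub: "subspace {y. inner (P u) y = 0}" by (auto simp: subspace_def inner_add_right)
  have "e ` J \<subseteq> {y. inner (P u) y = 0}" using assms by (auto simp: inner_P P_of_Y e_in)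
  then have "span (e ` J) \<subseteq> {y. inner (P u) y = 0}" using sub by (rule span_minimal)
  moreover have "closed {y. inner (P u) y = 0}" by (rule closed_hyperplane)
  ultimately have "closure (span (e ` J)) \<subseteq> {y. inner (P u) y = 0}" by (rule closure_minimal)
  then have "inner (P u) (P u) = 0" using P_in[of u] e unfolding total_orthonormal_seq_def by (metis (mono_tags, lifting) mem_Collect_eq subsetD)
  then show ?thesis by simp
qed

lemma coord_le_N: "coord u k \<le> N u"
proof -
  have "coord u k \<le> (suminf (\<lambda>k. coord u k))"
    using sum_le_suminf[OF coord_summable, of "{k}"] coord_nonneg by auto
  then show ?thesis by (simp add: N_eq)
qed

lemma N_eq_0: "N u = 0 \<longleftrightarrow> u = 0"
proof
  assume "N u = 0"
  then have q: "Q u = 0" using norm_Q_le_N[of u] by simp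
  have "P u = 0"
  proof (rule P_zeroI)
    fix k assume k: "k \<in> J"
    have "coord u k = 0" using coord_le_N[of u k] coord_nonneg[of u k] \<open>N u = 0\<close> by linarith
    then show "inner u (e k) = 0" using k by (simp add: coord_def)
  qed
  then show "u = 0" using q P_add_Q[of u] by simp
qed (simp add: N_zero)

sublocale tau: Metric_space UNIV "\<lambda>u v. N (u - v)"
proof
  fix x y z :: 'a
  show "0 \<le> N (x - y)" by (rule N_nonneg)
  show "N (x - y) = N (y - x)" by (rule N_minus_commute)
  show "(N (x - y) = 0) = (x = y)" by (simp add: N_eq_0)
  show "N (x - z) \<le> N (x - y) + N (y - z)" using N_triangle[of "x - y" "y - z"] by simp
qed

lemma tau_topology_eq: "tau_topology Y J e = tau.mtopology"
  by (simp add: tau_topology_def N_def)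

lemma limitin_tau: "limitin tau.mtopology x l sequentially \<longleftrightarrow> (\<lambda>n. N (x n - l)) \<longlonglongrightarrow> 0"
  by (simp add: tau.limitin_metric_dist_null)

lemma openin_tau: "openin tau.mtopology U \<longleftrightarrow> (\<forall>x\<in>U. \<exists>\<rho>>0. \<forall>y. N (y - x) < \<rho> \<longrightarrow> y \<in> U)"
  unfolding tau.openin_mtopology by (auto simp: subset_iff N_minus_commute)

lemma tau_lim_of_norm_lim:
  assumes "x \<longlonglongrightarrow> l" shows "(\<lambda>n. N (x n - l)) \<longlonglongrightarrow> 0"
proof (rule tendsto_sandwich[of "\<lambda>_. 0" _ _ "\<lambda>n. norm (x n - l)"])
  show "(\<lambda>n. norm (x n - l)) \<longlonglongrightarrow> 0" using assms by (simp add: LIM_zero tendsto_norm_zero)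
qed (auto simp: N_nonneg N_le_norm)

lemma tau_lim_coord:
  assumes "(\<lambda>n. N (x n - l)) \<longlonglongrightarrow> 0" "k \<in> J"
  shows "(\<lambda>n. inner (x n) (e k)) \<longlonglongrightarrow> inner l (e k)"
proof -
  have "(\<lambda>n. coord (x n - l) k) \<longlonglongrightarrow> 0"
    by (rule tendsto_sandwich[OF _ _ tendsto_const assms(1)]) (auto simp: coord_nonneg coord_le_N)
  then have "(\<lambda>n. 2 ^ k * coord (x n - l) k) \<longlonglongrightarrow> 2 ^ k * 0" by (intro tendsto_mult_left)
  then have "(\<lambda>n. \<bar>inner (x n - l) (e k)\<bar>) \<longlonglongrightarrow> 0"
    using assms(2) by (simp add: coord_def power_one_over)
  then have "(\<lambda>n. inner (x n - l) (e k)) \<longlonglongrightarrow> 0" by (simp add: tendsto_rabs_zero_iff)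
  then show ?thesis by (simp add: inner_diff_left LIM_zero_iff)
qed

lemma tau_lim_Q:
  assumes "(\<lambda>n. N (x n - l)) \<longlonglongrightarrow> 0"
  shows "(\<lambda>n. Q (x n)) \<longlonglongrightarrow> Q l"
proof -
  have "(\<lambda>n. norm (Q (x n - l))) \<longlonglongrightarrow> 0"
    by (rule tendsto_sandwich[OF _ _ tendsto_const assms]) (auto simp: norm_Q_le_N)
  then show ?thesis by (simp add: Q_simps tendsto_norm_zero_iff LIM_zero_iff)
qed

text \<open>A weak cluster point of the bounded sequence has the same coordinates and the same
  \<open>Z\<close>-part as the tau-limit, so both coincide, and weak limits do not increase the norm
  bound.\<close>

lemma tau_lim_norm_le:
  assumes lim: "(\<lambda>n. N (x n - l)) \<longlonglongrightarrow> 0" and bd: "\<And>n. norm (x n) \<le> b"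
  shows "norm l \<le> b"
proof -
  obtain r l' where r: "strict_mono (r :: nat \<Rightarrow> nat)"
    and l': "\<And>v. (\<lambda>n. inner (x (r n)) v) \<longlonglongrightarrow> inner l' v" "norm l' \<le> b"
    by (rule bounded_weakly_convergent_subseq[of x b, OF separable bd]) (rule that)
  have lim': "(\<lambda>n. N (x (r n) - l)) \<longlonglongrightarrow> 0"
    using LIMSEQ_subseq_LIMSEQ[OF lim r] by (simp add: o_def)
  have "P (l' - l) = 0"
  proof (rule P_zeroI)
    fix k assume "k \<in> J"
    then show "inner (l' - l) (e k) = 0"
      using LIMSEQ_unique[OF l'(1) tau_lim_coord[OF lim']] by (simp add: inner_diff_left)
  qed
  moreover have "inner (Q (l' - l)) v = 0" for v
  proof -
    have "(\<lambda>n. inner (Q (x (r n))) v) \<longlonglongrightarrow> inner (Q l) v"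
      by (intro tendsto_intros tau_lim_Q lim')
    moreover have "(\<lambda>n. inner (Q (x (r n))) v) \<longlonglongrightarrow> inner (Q l') v"
      unfolding inner_Q by (rule l')
    ultimately have "inner (Q l) v = inner (Q l') v" by (rule LIMSEQ_unique)
    then show ?thesis by (simp add: Q_simps inner_diff_left)
  qed
  then have "Q (l' - l) = 0" by (metis inner_eq_zero_iff)
  ultimately have "l' = l" using P_add_Q[of "l' - l"] by simp
  then show ?thesis using l'(2) by simp
qed

text \<open>Each coordinate converges by weak convergence, and the norm bound provides the summable
  majorant for exchanging limit and series. Tau measures the \<open>Z\<close>-part in norm, so its
  strong convergence has to be assumed.\<close>

lemma tau_lim_of_weak_lim:
  assumes w: "\<And>v. (\<lambda>n. inner (x n) v) \<longlonglongrightarrow> inner l v" and bd: "\<And>n. norm (x n) \<le> b"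
    and q: "(\<lambda>n. Q (x n)) \<longlonglongrightarrow> Q l"
  shows "(\<lambda>n. N (x n - l)) \<longlonglongrightarrow> 0"
proof -
  have "(\<lambda>n. suminf (\<lambda>k. coord (x n - l) k)) \<longlonglongrightarrow> (suminf (\<lambda>k. 0))"
  proof (rule tannerys_theorem[THEN conjunct2, THEN conjunct2])
    fix k
    have "(\<lambda>n. (1/2) ^ k * \<bar>inner (x n) (e k) - inner l (e k)\<bar>) \<longlonglongrightarrow> (1/2) ^ k * \<bar>inner l (e k) - inner l (e k)\<bar>"
      by (intro tendsto_intros w)
    then show "(\<lambda>n. coord (x n - l) k) \<longlonglongrightarrow> 0"
      by (cases "k \<in> J") (auto simp: coord_def inner_diff_left)
    show "summable (\<lambda>k. half_sum k * (b + norm l))"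
      using half_sum_sums by (intro summable_mult2) (rule sums_summable)
    have "norm (coord (x n - l) k) \<le> half_sum k * (b + norm l)" for n k
    proof -
      have "norm (x n - l) \<le> b + norm l" using norm_triangle_ineq4[of "x n" l] bd[of n] by linarith
      then have "half_sum k * norm (x n - l) \<le> half_sum k * (b + norm l)"
        by (intro mult_left_mono) (auto simp: half_sum_def)
      then show ?thesis using coord_le[of "x n - l" k] coord_nonneg[of "x n - l" k] by simp
    qed
    then show "\<forall>\<^sub>F (k, n) in at_top \<times>\<^sub>F sequentially. norm (coord (x n - l) k) \<le> half_sum k * (b + norm l)"
      by (intro always_eventually) auto
  qed simp
  moreover have "(\<lambda>n. norm (Q (x n - l))) \<longlonglongrightarrow> 0"
    using q by (simp add: Q_simps tendsto_norm_zero_iff LIM_zero_iff)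
  ultimately have "(\<lambda>n. max (norm (Q (x n - l))) (suminf (\<lambda>k. coord (x n - l) k))) \<longlonglongrightarrow> max 0 0"
    by (intro tendsto_max) auto
  then show ?thesis by (simp add: N_eq)
qed

text \<open>Equivalence of norms in finite dimension: a normalized counterexample sequence converges
  weakly along a subsequence, hence strongly through its finitely many coordinates, to a unit vector
  on which \<open>N\<close> vanishes.\<close>

lemma norm_le_N_on_span:
  assumes "finite B"
  obtains C where "C > 0" "\<And>v. v \<in> span B \<Longrightarrow> norm v \<le> C * N v"
proof (rule ccontr)
  assume no: "\<not> thesis"
  obtain C where C: "finite C" "span C = span B" "\<And>c. c \<in> C \<Longrightarrow> norm c = 1" "pairwise orthogonal C"
    using orthonormal_basis_exists[OF assms] by blast
  have expand: "(\<Sum>c\<in>C. inner v c *\<^sub>R c) = v" if "v \<in> span B" for v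
    using orthonormal_basis_expand[OF C(4) C(3) _ C(1)] that C(2) by simp
  have "\<exists>v\<in>span B. norm v > real (Suc n) * N v" for n
    using no that[of "real (Suc n)"] by force
  then obtain v where v: "\<And>n. v n \<in> span B" "\<And>n. norm (v n) > real (Suc n) * N (v n)" by metis
  define w where "w n = v n /\<^sub>R norm (v n)" for n
  have pos: "norm (v n) > 0" for n
    using v(2)[of n] N_nonneg[of "v n"] by (meson mult_nonneg_nonneg of_nat_0_le_iff order.strict_trans1)
  have w1: "norm (w n) = 1" for n using pos[of n] by (simp add: w_def)
  have wB: "w n \<in> span B" for n using v(1) by (simp add: w_def span_scale)
  have wN: "N (w n) \<le> 1 / real (Suc n)" for n
    using v(2)[of n] pos[of n] by (simp add: w_def N_scale field_simps)
  obtain r l where r: "strict_mono (r :: nat \<Rightarrow> nat)"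
    and l: "\<And>v. (\<lambda>n. inner (w (r n)) v) \<longlonglongrightarrow> inner l v" and "norm l \<le> 1"
    by (rule bounded_weakly_convergent_subseq[of w 1, OF separable eq_refl[OF w1]]) (rule that)
  have "(\<lambda>n. \<Sum>c\<in>C. inner (w (r n)) c *\<^sub>R c) \<longlonglongrightarrow> (\<Sum>c\<in>C. inner l c *\<^sub>R c)"
    by (intro tendsto_intros l)
  then obtain l' where lim: "(\<lambda>n. w (r n)) \<longlonglongrightarrow> l'" using expand wB by auto
  then have nl: "norm l' = 1" using LIMSEQ_unique[OF tendsto_norm[OF lim]] w1 by simp
  have "(\<lambda>n. N (w (r n) - l') + 1 / real (Suc (r n))) \<longlonglongrightarrow> 0 + 0"
    by (intro tendsto_add tau_lim_of_norm_lim lim)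
      (use LIMSEQ_subseq_LIMSEQ[OF LIMSEQ_Suc[OF lim_1_over_n] r] in \<open>simp add: o_def\<close>)
  moreover have "N l' \<le> N (w (r n) - l') + 1 / real (Suc (r n))" for n
    using N_triangle[of "w (r n)" "l' - w (r n)"] wN[of "r n"] by (simp add: N_minus_commute)
  ultimately have "N l' \<le> 0 + 0" by (intro LIMSEQ_le_const) auto
  then have "l' = 0" using N_nonneg[of l'] N_eq_0[of l'] by simp
  then show False using nl by simp
qed

end

section \<open>Compactness of the linking set in the topology tau\<close>

locale linking_space = split_space +
  fixes z0 :: 'a and R :: real
  assumes z0: "z0 \<in> Z" "z0 \<noteq> 0"
begin

definition M :: "'a set" where
  "M = {u. \<exists>y t. u = y + t *\<^sub>R z0 \<and> y \<in> Y \<and> t \<ge> 0 \<and> norm u \<le> R}"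

text \<open>Weak compactness of the ball suffices because the \<open>Z\<close>-parts lie on the
  single ray through \<open>z0\<close>: their coefficients are values of a bounded functional, so
  weak convergence makes the \<open>Z\<close>-parts converge in norm.\<close>

lemma compactin_M: "compactin tau.mtopology M"
  unfolding tau.compactin_sequentially
proof (intro conjI allI impI)
  fix x :: "nat \<Rightarrow> 'a" assume "range x \<subseteq> M"
  then have "\<forall>n. \<exists>y t. x n = y + t *\<^sub>R z0 \<and> y \<in> Y \<and> t \<ge> 0 \<and> norm (x n) \<le> R"
    by (force simp: M_def)
  then obtain y t where x: "\<And>n. x n = y n + t n *\<^sub>R z0" "\<And>n. y n \<in> Y" "\<And>n. t n \<ge> 0" "\<And>n. norm (x n) \<le> R"
    by metis
  obtain r l where r: "strict_mono (r :: nat \<Rightarrow> nat)"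
    and l: "\<And>v. (\<lambda>n. inner (x (r n)) v) \<longlonglongrightarrow> inner l v" "norm l \<le> R"
    by (rule bounded_weakly_convergent_subseq[of x R, OF separable x(4)]) (rule that)
  have nz: "inner z0 z0 > 0" using z0(2) by simp
  have t: "t n = inner (x n) z0 / inner z0 z0" for n
    using inner_YZ[OF x(2)[of n] z0(1)] nz by (simp add: x(1) inner_add_left)
  define t' where "t' = inner l z0 / inner z0 z0"
  have tl: "(\<lambda>n. t (r n)) \<longlonglongrightarrow> t'"
    unfolding t t'_def using nz by (intro tendsto_intros l) auto
  have t0: "t' \<ge> 0" using LIMSEQ_le_const[OF tl] x(3) by blast
  have Qx: "Q (x n) = t n *\<^sub>R z0" for n using x z0(1) by (simp add: Q_simps Q_of_Y Q_of_Z)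
  have "inner (Q l) v = inner (t' *\<^sub>R z0) v" for v
  proof -
    have "(\<lambda>n. inner (t (r n) *\<^sub>R z0) v) \<longlonglongrightarrow> inner (Q l) v"
      unfolding Qx[symmetric] inner_Q by (rule l)
    moreover have "(\<lambda>n. inner (t (r n) *\<^sub>R z0) v) \<longlonglongrightarrow> inner (t' *\<^sub>R z0) v"
      by (intro tendsto_intros tl)
    ultimately show ?thesis by (rule LIMSEQ_unique)
  qed
  then have Ql: "Q l = t' *\<^sub>R z0" by (metis inner_eq_zero_iff inner_diff_left right_minus_eq)
  have "(\<lambda>n. N (x (r n) - l)) \<longlonglongrightarrow> 0"
  proof (rule tau_lim_of_weak_lim[OF l(1)])
    show "(\<lambda>n. Q (x (r n))) \<longlonglongrightarrow> Q l" unfolding Qx Ql by (intro tendsto_intros tl)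
  qed (rule x(4))
  moreover have "l \<in> M"
    unfolding M_def using P_add_Q[of l] Ql P_in[of l] t0 l(2) by (metis (mono_tags, lifting) mem_Collect_eq)
  ultimately show "\<exists>l r. l \<in> M \<and> strict_mono r \<and> limitin tau.mtopology (x \<circ> r) l sequentially"
    using r by (auto simp: limitin_tau o_def)
qed simp

end

section \<open>Linking\<close>

lemma continuous_map_scaleR_const:
  fixes b :: "'b::real_normed_vector"
  assumes "continuous_map X euclideanreal f"
  shows "continuous_map X euclidean (\<lambda>x. f x *\<^sub>R b)"
  using assms by (simp add: continuous_map_atin tendsto_scaleR)

text \<open>A zero-free map would contract the sphere of radius \<open>\<rho>\<close> in the subspace to a point.\<close>

lemma zero_exists_of_translation_on_sphere:
  fixes B :: "'a::real_inner set"
  assumes B: "finite B" "span B \<noteq> {0}" and p: "p \<in> span B" and \<rho>: "\<rho> > 0"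
    and cont: "continuous_on (span B) \<Phi>" and maps: "\<And>u. u \<in> span B \<Longrightarrow> \<Phi> u \<in> span B"
    and bd: "\<And>u. u \<in> span B \<Longrightarrow> norm (u - p) = \<rho> \<Longrightarrow> \<Phi> u = u - p"
  obtains u where "u \<in> span B" "\<Phi> u = 0"
proof (rule ccontr)
  assume no: "\<not> thesis"
  then have nz: "\<And>u. u \<in> span B \<Longrightarrow> \<Phi> u \<noteq> 0" using that by blast
  obtain C where C: "finite C" "span C = span B" "\<And>c. c \<in> C \<Longrightarrow> norm c = 1" "pairwise orthogonal C"
    using orthonormal_basis_exists[OF B(1)] by blast
  have "C \<noteq> {}" using B(2) C(2) span_empty by metis
  obtain b where b: "bij_betw b {0..<card C} C" using ex_bij_betw_nat_finite[OF C(1)] by blast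
  \<comment> \<open>\<open>nsphere n\<close> consists of points with n + 1 coordinates, so the basis
    is indexed by \<open>{..n}\<close>.\<close>
  define n where "n = card C - 1"
  have "card C > 0" using C(1) \<open>C \<noteq> {}\<close> by (simp add: card_gt_0_iff)
  then have "{0..<card C} = {..n}" by (auto simp: n_def)
  then have b: "bij_betw b {..n} C" using b by simp
  have expand: "(\<Sum>i\<le>n. inner v (b i) *\<^sub>R b i) = v" if "v \<in> span B" for v
  proof -
    have "(\<Sum>i\<le>n. inner v (b i) *\<^sub>R b i) = (\<Sum>c\<in>C. inner v c *\<^sub>R c)"
      by (rule sum.reindex_bij_betw[OF b])
    then show ?thesis using orthonormal_basis_expand[OF C(4) C(3) _ C(1)] that C(2) by simp
  qed
  have on: "inner (b i) (b j) = (if i = j then 1 else 0)" if "i \<le> n" "j \<le> n" for i j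
  proof -
    have m: "b i \<in> C" "b j \<in> C" using that b by (auto simp: bij_betw_def)
    have "i = j \<longleftrightarrow> b i = b j" using that b by (auto simp: bij_betw_def inj_on_def)
    then show ?thesis using m C(3,4) by (auto simp: pairwise_def orthogonal_def norm_eq_1)
  qed
  have bB: "b i \<in> span B" if "i \<le> n" for i
    using that b span_superset[of C] unfolding C(2)[symmetric] by (auto simp: bij_betw_def)
  define E :: "(nat \<Rightarrow> real) \<Rightarrow> 'a" where "E x = (\<Sum>i\<le>n. x i *\<^sub>R b i)" for x
  have EB: "E x \<in> span B" for x unfolding E_def by (intro span_sum span_scale bB) simp
  have E_inner: "inner (E x) (b j) = x j" if "j \<le> n" for x j
  proof -
    have "inner (E x) (b j) = (\<Sum>i\<le>n. if i = j then x i else 0)"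
      unfolding E_def inner_sum_left using on that by (intro sum.cong) auto
    then show ?thesis using that by simp
  qed
  have inner_expand: "inner u v = (\<Sum>i\<le>n. inner u (b i) * inner v (b i))" if "v \<in> span B" for u v
  proof -
    have "inner u (\<Sum>i\<le>n. inner v (b i) *\<^sub>R b i) = (\<Sum>i\<le>n. inner u (b i) * inner v (b i))"
      by (simp add: inner_sum_right mult.commute)
    then show ?thesis using expand[OF that] by simp
  qed
  have E_norm: "norm (E x) = 1" if "(\<Sum>i\<le>n. (x i)\<^sup>2) = 1" for x
  proof -
    have "inner (E x) (E x) = (\<Sum>i\<le>n. (x i)\<^sup>2)"
      unfolding inner_expand[OF EB] by (intro sum.cong) (auto simp: E_inner power2_eq_square)
    then show ?thesis using that by (simp add: norm_eq_1)
  qed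
  \<comment> \<open>At time 0 this traverses the sphere of radius \<open>\<rho>\<close> about
    \<open>p\<close>, at time 1 it rests at \<open>p\<close>. Followed by normalized
    \<open>\<Phi>\<close>, it deforms the identity of the unit sphere into a constant.\<close>
  define k where "k = (\<lambda>z :: real \<times> (nat \<Rightarrow> real). p + ((1 - fst z) * \<rho>) *\<^sub>R E (snd z))"
  define G where "G = (\<lambda>i u. inner (\<Phi> u) (b i) / norm (\<Phi> u))"
  define h where "h = (\<lambda>z i. if i \<le> n then G i (k z) else 0)"
  let ?X = "prod_topology (top_of_set {0..1::real}) (nsphere n)"
  have proj: "continuous_map ?X euclideanreal (\<lambda>z. snd z i)" for i
    using continuous_map_compose[OF continuous_map_snd continuous_map_nsphere_projection, of "top_of_set {0..1::real}" n i]
    by (simp add: o_def)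
  have fst: "continuous_map ?X euclideanreal fst"
    using continuous_map_fst[of "top_of_set {0..1::real}" "nsphere n"]
    by (simp add: continuous_map_in_subtopology)
  have "continuous_map ?X euclidean k"
    unfolding k_def E_def scaleR_sum_right scaleR_scaleR
    by (intro continuous_map_add continuous_map_sum continuous_map_scaleR_const
        continuous_map_real_mult continuous_map_diff proj fst) auto
  then have kc: "continuous_map ?X (top_of_set (span B)) k"
    by (auto simp: continuous_map_in_subtopology k_def intro!: span_add p span_scale EB)
  have kB: "k z \<in> span B" for z unfolding k_def by (intro span_add p span_scale EB)
  have Gc: "continuous_map (top_of_set (span B)) euclideanreal (G i)" for i
    unfolding G_def using nz by (auto intro!: continuous_intros cont)
  have hc: "continuous_map ?X euclideanreal (\<lambda>z. h z i)" for i
    using continuous_map_compose[OF kc Gc, of i] by (auto simp: h_def o_def)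
  have h_sphere: "(\<Sum>i\<le>n. (h z i)\<^sup>2) = 1" for z
  proof -
    let ?v = "\<Phi> (k z)"
    have "(\<Sum>i\<le>n. (h z i)\<^sup>2) = (\<Sum>i\<le>n. inner ?v (b i) * inner ?v (b i)) / (norm ?v)\<^sup>2"
      unfolding sum_divide_distrib by (intro sum.cong) (auto simp: h_def G_def power_divide power2_eq_square)
    also have "\<dots> = 1"
      unfolding inner_expand[OF maps[OF kB], of "?v" z, symmetric]
      using nz[OF kB[of z]] by (simp add: power2_norm_eq_inner)
    finally show ?thesis .
  qed
  have "continuous_map ?X (nsphere n) h"
    unfolding nsphere continuous_map_in_subtopology continuous_map_componentwise_UNIV
    using hc h_sphere by (auto simp: h_def nsphere)
  moreover have "h (0, x) = x" if "x \<in> topspace (nsphere n)" for x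
  proof
    fix i
    have x: "(\<Sum>i\<le>n. (x i)\<^sup>2) = 1" "\<forall>i>n. x i = 0" using that by (auto simp: nsphere)
    have "\<Phi> (k (0, x)) = \<rho> *\<^sub>R E x"
      using bd[OF kB, of "(0, x)"] E_norm[OF x(1)] \<rho> by (simp add: k_def)
    then show "h (0, x) i = x i"
      using x(2) \<rho> E_norm[OF x(1)] by (auto simp: h_def G_def E_inner)
  qed
  moreover have "h (1, x) = h (1, y)" for x y
  proof -
    have k1: "k (1, x) = p" for x by (simp add: k_def)
    show ?thesis by (simp only: h_def k1)
  qed
  ultimately have "homotopic_with (\<lambda>x. True) (nsphere n) (nsphere n) id (\<lambda>x. h (1, \<lambda>_. 0))"
    by (subst homotopic_with) (auto intro!: exI[of _ h])
  then have "contractible_space (nsphere n)" unfolding contractible_space_def by blast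
  then show False using non_contractible_space_nsphere by blast
qed

context linking_space
begin

lemma M_iff: "u \<in> M \<longleftrightarrow> (\<exists>t\<ge>0. Q u = t *\<^sub>R z0) \<and> norm u \<le> R"
proof
  assume "u \<in> M"
  then obtain y t where "u = y + t *\<^sub>R z0" "y \<in> Y" "t \<ge> 0" "norm u \<le> R" by (auto simp: M_def)
  then show "(\<exists>t\<ge>0. Q u = t *\<^sub>R z0) \<and> norm u \<le> R" using z0(1) by (auto simp: Q_simps Q_of_Y Q_of_Z)
next
  assume "(\<exists>t\<ge>0. Q u = t *\<^sub>R z0) \<and> norm u \<le> R"
  then obtain t where "t \<ge> 0" "Q u = t *\<^sub>R z0" "norm u \<le> R" by blast
  then show "u \<in> M" unfolding M_def using P_add_Q[of u] P_in[of u] by (metis (mono_tags, lifting) mem_Collect_eq)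
qed

text \<open>Compactness of the product of the time interval with \<open>M\<close> leaves finitely
  many of the local subspaces, and these lie in a common one.\<close>

lemma admissible_finite_dim:
  fixes g :: "real \<Rightarrow> 'a \<Rightarrow> 'a"
  assumes "tau_locally_finite_dim tau.mtopology M g"
  obtains B where "finite B" "\<And>s u. s \<in> {0..1} \<Longrightarrow> u \<in> M \<Longrightarrow> g s u \<in> span B"
proof -
  let ?X = "prod_topology (top_of_set {0..1::real}) tau.mtopology"
  define U where "U = {V. openin ?X V \<and>
      (\<exists>B. finite B \<and> (\<lambda>(t, v). g t v) ` (V \<inter> {0..1} \<times> M) \<subseteq> span B)}"
  have comp: "compactin ?X ({0..1} \<times> M)"
    using compactin_M by (simp add: compactin_Times compactin_subtopology)
  have "{0..1} \<times> M \<subseteq> \<Union>U"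
    using assms unfolding tau_locally_finite_dim_def U_def by fast
  then obtain F where F: "finite F" "F \<subseteq> U" "{0..1} \<times> M \<subseteq> \<Union>F"
    using compactinD[OF comp, of U] by (auto simp: U_def)
  then have "\<forall>V\<in>F. \<exists>B. finite B \<and> (\<lambda>(t, v). g t v) ` (V \<inter> {0..1} \<times> M) \<subseteq> span B"
    by (auto simp: U_def)
  then obtain B where B: "\<And>V. V \<in> F \<Longrightarrow> finite (B V)"
    "\<And>V. V \<in> F \<Longrightarrow> (\<lambda>(t, v). g t v) ` (V \<inter> {0..1} \<times> M) \<subseteq> span (B V)"
    by metis
  show ?thesis
  proof (rule that[of "\<Union>V\<in>F. B V"])
    show "finite (\<Union>V\<in>F. B V)" using F(1) B(1) by blast
    fix s :: real and u assume su: "s \<in> {0..1}" "u \<in> M"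
    then obtain V where V: "V \<in> F" "(s, u) \<in> V" using F(3) by blast
    then have "g s u \<in> span (B V)" using B(2)[OF V(1)] su by force
    then show "g s u \<in> span (\<Union>V\<in>F. B V)" using span_mono[of "B V" "\<Union>V\<in>F. B V"] V(1) by blast
  qed
qed

text \<open>The cut-off \<open>\<theta>\<close> below glues the homotopy into a single map agreeing with the translation by
  \<open>- p\<close> on the relative boundary of \<open>M\<close>, so that no degree theory is needed.\<close>

lemma linking:
  fixes \<gamma> :: "real \<Rightarrow> 'a \<Rightarrow> 'a"
  assumes B: "finite B" "\<And>s u. s \<in> {0..1} \<Longrightarrow> u \<in> M \<Longrightarrow> u - \<gamma> s u \<in> span B"
    and cont: "continuous_on ({0..1} \<times> M) (\<lambda>(s, u). \<gamma> s u)"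
    and start: "\<And>u. u \<in> M \<Longrightarrow> \<gamma> 0 u = u"
    and r: "0 < r" "r < R"
    and bdry: "\<And>s u. s \<in> {0..1} \<Longrightarrow> u \<in> M \<Longrightarrow> norm u = R \<or> Q u = 0 \<Longrightarrow>
      \<not> (P (\<gamma> s u) = 0 \<and> norm (Q (\<gamma> s u)) = r)"
  obtains u where "u \<in> M" "P (\<gamma> 1 u) = 0" "norm (Q (\<gamma> 1 u)) = r"
proof -
  \<comment> \<open>A finite-dimensional space on which the problem closes up: it contains
    \<open>z0\<close> and the \<open>Y\<close>-parts of all displacements
    \<open>u - \<gamma> s u\<close>.\<close>
  define F where "F = span (insert z0 (P ` B))"
  define p where "p = (r / norm z0) *\<^sub>R z0"
  \<comment> \<open>The \<open>Z\<close>-part is collapsed to a multiple of \<open>z0\<close>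
    through its norm, so the zeros of \<open>h s\<close> are exactly the points that
    \<open>\<gamma> s\<close> sends into the sphere of radius \<open>r\<close> in \<open>Z\<close>.
    On \<open>M\<close>, time 0 gives the translation by \<open>- p\<close>.\<close>
  define h where "h s u = P (\<gamma> s u) + ((norm (Q (\<gamma> s u)) - r) / norm z0) *\<^sub>R z0" for s u
  have nz: "norm z0 > 0" "inner z0 z0 > 0" using z0(2) by auto
  have subF: "subspace F" unfolding F_def by simp
  have z0F: "z0 \<in> F" unfolding F_def by (simp add: span_base)
  have QF: "\<exists>t. Q u = t *\<^sub>R z0" if "u \<in> F" for u
  proof -
    have "F \<subseteq> {u. \<exists>t. Q u = t *\<^sub>R z0}" unfolding F_def
    proof (rule span_minimal)
      have "\<exists>t. Q z0 = t *\<^sub>R z0" using z0(1) by (intro exI[of _ 1]) (simp add: Q_of_Z)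
      moreover have "\<exists>t. Q (P b) = t *\<^sub>R z0" for b by (intro exI[of _ 0]) (simp add: Q_of_Y P_in)
      ultimately show "insert z0 (P ` B) \<subseteq> {u. \<exists>t. Q u = t *\<^sub>R z0}" by auto
      show "subspace {u. \<exists>t. Q u = t *\<^sub>R z0}"
        unfolding subspace_def
      proof (intro conjI ballI allI)
        show "0 \<in> {u. \<exists>t. Q u = t *\<^sub>R z0}" by (auto simp: Q_simps intro!: exI[of _ 0])
        fix x y and c :: real
        assume x: "x \<in> {u. \<exists>t. Q u = t *\<^sub>R z0}"
        then show "c *\<^sub>R x \<in> {u. \<exists>t. Q u = t *\<^sub>R z0}" by (auto simp: Q_simps)
        assume "y \<in> {u. \<exists>t. Q u = t *\<^sub>R z0}"
        with x show "x + y \<in> {u. \<exists>t. Q u = t *\<^sub>R z0}" by (auto simp: Q_simps scaleR_left_distrib[symmetric])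
      qed
    qed
    then show ?thesis using that by blast
  qed
  have inner_z0: "inner u z0 = t * inner z0 z0" if "Q u = t *\<^sub>R z0" for u t
  proof -
    have "inner u z0 = inner (Q u) z0" using z0(1) by (simp add: inner_Q Q_of_Z)
    then show ?thesis using that by simp
  qed
  have MF: "u \<in> M \<longleftrightarrow> inner u z0 \<ge> 0 \<and> norm u \<le> R" if "u \<in> F" for u
  proof -
    obtain t where t: "Q u = t *\<^sub>R z0" using QF[OF \<open>u \<in> F\<close>] by blast
    have "u \<in> M \<longleftrightarrow> t \<ge> 0 \<and> norm u \<le> R" unfolding M_iff t using z0(2) by auto
    moreover have "t \<ge> 0 \<longleftrightarrow> inner u z0 \<ge> 0"
      unfolding inner_z0[OF t] zero_le_mult_iff using nz(2) by linarith
    ultimately show ?thesis by simp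
  qed
  have Q0F: "Q u = 0 \<longleftrightarrow> inner u z0 = 0" if "u \<in> F" for u
  proof -
    obtain t where t: "Q u = t *\<^sub>R z0" using QF[OF \<open>u \<in> F\<close>] by blast
    then show ?thesis using inner_z0[OF t] nz by simp
  qed
  have PF: "P u \<in> F" if "u \<in> F" for u
  proof -
    obtain t where t: "Q u = t *\<^sub>R z0" using QF[OF \<open>u \<in> F\<close>] by blast
    have "P u = u - t *\<^sub>R z0" using P_add_Q[of u] t by (metis add_diff_cancel_right')
    then show ?thesis using subF that z0F by (simp add: subspace_diff subspace_scale)
  qed
  have hF: "h s u \<in> F" if "s \<in> {0..1}" "u \<in> M" "u \<in> F" for s u
  proof -
    have "P (u - \<gamma> s u) \<in> P ` span B" using B(2)[OF that(1,2)] by blast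
    also have "\<dots> = span (P ` B)" by (rule linear_span_image[OF linear_P, symmetric])
    also have "\<dots> \<subseteq> F" unfolding F_def by (rule span_mono) auto
    finally have "P u - P (u - \<gamma> s u) \<in> F" using PF[OF that(3)] subF by (simp add: subspace_diff)
    then have "P (\<gamma> s u) \<in> F" by (simp add: P_simps)
    then show ?thesis unfolding h_def using subF z0F by (simp add: subspace_add subspace_scale)
  qed
  have h_zero: "P (\<gamma> s u) = 0 \<and> norm (Q (\<gamma> s u)) = r" if "h s u = 0" for s u
  proof -
    have "P (h s u) = P (\<gamma> s u)" using z0(1) by (simp add: h_def P_simps P_of_Y[OF P_in] P_of_Z)
    then have "P (\<gamma> s u) = 0" using that by (simp add: P_simps)
    then show ?thesis using that nz z0(2) by (simp add: h_def)
  qed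
  have h_start: "h 0 u = u - p" if uM: "u \<in> M" for u
  proof -
    obtain t where t: "t \<ge> 0" "Q u = t *\<^sub>R z0" using uM unfolding M_iff by blast
    have eq: "(norm (Q u) - r) / norm z0 = t - r / norm z0"
      unfolding t(2) using t(1) nz(1) by (simp add: diff_divide_distrib)
    have "h 0 u = P u + (t *\<^sub>R z0 - p)" unfolding h_def start[OF uM] eq p_def scaleR_diff_left ..
    then show ?thesis using P_add_Q[of u] t(2) by (metis add_diff_eq)
  qed
  have hcont: "continuous_on ({0..1} \<times> M) (\<lambda>(s, u). h s u)"
  proof -
    have "continuous_on ({0..1} \<times> M) (\<lambda>z. \<gamma> (fst z) (snd z))"
      using cont by (simp add: case_prod_beta)
    then show ?thesis unfolding h_def case_prod_beta
      by (intro continuous_intros bounded_linear.continuous_on[OF bounded_linear_P]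
          bounded_linear.continuous_on[OF bounded_linear_Q]) (use nz in auto)
  qed
  define D where "D = F \<inter> M"
  \<comment> \<open>The points that hit the target sphere at some time; compactness of the time
    interval makes this set closed relative to \<open>D\<close>.\<close>
  define K where "K = {u\<in>D. \<exists>s\<in>{0..1}. h s u = 0}"
  have pF: "p \<in> F" unfolding p_def using subF z0F by (simp add: subspace_scale)
  have pM: "p \<in> M" using pF nz r by (subst MF) (simp_all add: p_def)
  have "p \<in> K" unfolding K_def D_def using pF pM h_start[OF pM] by (auto intro!: bexI[of _ 0])
  have K_closed: "u \<in> K" if "u \<in> D" "infdist u K = 0" for u
  proof -
    have "u \<in> closure K" using in_closure_iff_infdist_zero[of K u] \<open>p \<in> K\<close> that(2) by auto
    then obtain x where x: "\<And>n. x n \<in> K" "x \<longlonglongrightarrow> u" unfolding closure_sequential by blast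
    then have "\<forall>n. \<exists>s\<in>{0..1}. h s (x n) = 0" by (auto simp: K_def)
    then obtain s where s: "\<And>n. s n \<in> {0..1}" "\<And>n. h (s n) (x n) = 0" by metis
    obtain l q where l: "l \<in> {0..1}" "strict_mono (q :: nat \<Rightarrow> nat)" "(s \<circ> q) \<longlonglongrightarrow> l"
      using compact_imp_seq_compact[OF compact_Icc[of 0 "1::real"]] s(1) unfolding seq_compact_def by metis
    have "(\<lambda>n. (s (q n), x (q n))) \<longlonglongrightarrow> (l, u)"
      using l(3) LIMSEQ_subseq_LIMSEQ[OF x(2) l(2)] by (intro tendsto_Pair) (simp_all add: o_def)
    then have "((\<lambda>z. h (fst z) (snd z)) \<circ> (\<lambda>n. (s (q n), x (q n)))) \<longlonglongrightarrow> h (fst (l, u)) (snd (l, u))"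
      using hcont[unfolded continuous_on_sequentially case_prod_beta, rule_format, of "(l, u)" "\<lambda>n. (s (q n), x (q n))"]
        s(1) x(1) l(1) that(1) by (auto simp: K_def D_def)
    then have "h l u = 0" using s(2) by (simp add: o_def LIMSEQ_const_iff)
    then show ?thesis using that(1) l(1) by (auto simp: K_def)
  qed
  \<comment> \<open>On \<open>D\<close> this vanishes precisely on the relative boundary, where
    \<open>bdry\<close> excludes zeros of \<open>h s\<close>.\<close>
  define a where "a u = min (R - norm u) (inner u z0)" for u
  have a0: "a u \<ge> 0" if "u \<in> D" for u using that MF[of u] by (auto simp: a_def D_def)
  have a_zero: "norm u = R \<or> Q u = 0" if "u \<in> D" "a u = 0" for u
    using that Q0F[of u] by (auto simp: a_def D_def min_def split: if_splits)
  have aK: "a u > 0" if "u \<in> D" "s \<in> {0..1}" "h s u = 0" for u s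
  proof -
    have "a u \<noteq> 0" using a_zero[OF that(1)] bdry[OF that(2), of u] h_zero[OF that(3)] that(1) by (auto simp: D_def)
    then show ?thesis using a0[OF that(1)] by simp
  qed
  \<comment> \<open>A Urysohn function: 0 on the relative boundary, where the homotopy is frozen at
    its start, and 1 on \<open>K\<close>, where it has reached its end. The denominator is positive
    because \<open>K\<close> avoids the boundary.\<close>
  define \<theta> where "\<theta> u = a u / (a u + infdist u K)" for u
  have den: "a u + infdist u K > 0" if "u \<in> D" for u
  proof (cases "infdist u K = 0")
    case True
    then have "u \<in> K" using K_closed that by blast
    then show ?thesis using aK[OF that] infdist_nonneg[of u K] unfolding K_def by force
  next
    case False
    then show ?thesis using a0[OF that] infdist_nonneg[of u K] by linarith
  qed
  have \<theta>01: "\<theta> u \<in> {0..1}" if "u \<in> D" for u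
    using den[OF that] a0[OF that] infdist_nonneg[of u K] by (auto simp: \<theta>_def field_simps)
  have \<theta>c: "continuous_on D \<theta>"
    unfolding \<theta>_def a_def using den unfolding a_def by (intro continuous_intros) force
  define \<Phi> where "\<Phi> u = (if u \<in> M then h (\<theta> u) u else u - p)" for u
  have \<Phi>c: "continuous_on F \<Phi>"
  proof -
    define D' where "D' = F \<inter> {u. inner u z0 \<le> 0 \<or> norm u \<ge> R}"
    have F_eq: "F = D \<union> D'" using MF by (auto simp: D_def D'_def)
    have cl1: "closed {u. inner u z0 \<ge> 0 \<and> norm u \<le> R}"
      by (intro closed_Collect_conj closed_Collect_le continuous_intros)
    have cl2: "closed {u. inner u z0 \<le> 0 \<or> norm u \<ge> R}"
      by (intro closed_Collect_disj closed_Collect_le continuous_intros)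
    have "D = F \<inter> {u. inner u z0 \<ge> 0 \<and> norm u \<le> R}" using MF by (auto simp: D_def)
    then have clD: "closedin (top_of_set F) D" using cl1 by (metis closedin_closed_Int)
    have clD': "closedin (top_of_set F) D'" unfolding D'_def using cl2 by (rule closedin_closed_Int)
    have cD: "continuous_on D (\<lambda>u. h (\<theta> u) u)"
    proof -
      have "continuous_on D (\<lambda>u. (\<theta> u, u))" by (intro continuous_intros \<theta>c)
      moreover have "(\<lambda>u. (\<theta> u, u)) ` D \<subseteq> {0..1} \<times> M" using \<theta>01 by (auto simp: D_def)
      ultimately have "continuous_on D ((\<lambda>(s, u). h s u) \<circ> (\<lambda>u. (\<theta> u, u)))"
        by (intro continuous_on_compose continuous_on_subset[OF hcont])
      then show ?thesis by (simp add: o_def)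
    qed
    have agree: "h (\<theta> u) u = u - p" if "u \<in> D" "u \<in> D'" for u
    proof -
      have "a u = 0" using that MF[of u] by (auto simp: D_def D'_def a_def)
      then show ?thesis using h_start that(1) by (simp add: \<theta>_def D_def)
    qed
    have "continuous_on (D \<union> D') (\<lambda>u. if u \<in> M then h (\<theta> u) u else u - p)"
    proof (rule continuous_on_cases_local)
      show "closedin (top_of_set (D \<union> D')) D" "closedin (top_of_set (D \<union> D')) D'"
        unfolding F_eq[symmetric] by (fact clD clD')+
      fix u assume "u \<in> D \<and> u \<notin> M \<or> u \<in> D' \<and> u \<in> M"
      then have "u \<in> D" "u \<in> D'" by (auto simp: D_def D'_def)
      then show "h (\<theta> u) u = u - p" by (rule agree)
    qed (intro cD continuous_intros)+
    then show ?thesis unfolding \<Phi>_def[abs_def] F_eq[symmetric] .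
  qed
  have \<Phi>F: "\<Phi> u \<in> F" if "u \<in> F" for u
    using hF[of "\<theta> u" u] \<theta>01[of u] that pF subF by (auto simp: \<Phi>_def D_def subspace_diff)
  have \<Phi>_out: "\<Phi> u = u - p" if "norm (u - p) = R + norm p + 1" for u
  proof -
    have "norm u > R" using norm_triangle_ineq4[of u p] that by linarith
    then show ?thesis by (simp add: \<Phi>_def M_iff)
  qed
  have "F \<noteq> {0}" using z0F z0(2) by auto
  moreover have "R + norm p + 1 > 0" using r by (simp add: add_nonneg_pos add_pos_nonneg)
  ultimately obtain u where u: "u \<in> F" "\<Phi> u = 0"
    using zero_exists_of_translation_on_sphere[of "insert z0 (P ` B)" p "R + norm p + 1" \<Phi>]
      B(1) pF \<Phi>c \<Phi>F \<Phi>_out unfolding F_def by blast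
  \<comment> \<open>Outside \<open>M\<close> a zero of \<open>\<Phi>\<close> would be
    \<open>p\<close>, which lies in \<open>M\<close>.\<close>
  have uM: "u \<in> M" using u(2) pM by (cases "u \<in> M") (auto simp: \<Phi>_def)
  then have D: "u \<in> D" using u(1) by (simp add: D_def)
  have h0: "h (\<theta> u) u = 0" using u(2) uM by (simp add: \<Phi>_def)
  then have "u \<in> K" using D \<theta>01[OF D] by (auto simp: K_def)
  then have "\<theta> u = 1" using aK[OF D \<theta>01[OF D] h0] by (simp add: \<theta>_def)
  then show ?thesis using that[OF uM] h_zero h0 by auto
qed

end

section \<open>Descent along a finite-rank field\<close>

locale variational = linking_space +
  fixes I \<Psi> :: "'a \<Rightarrow> real" and r \<delta> :: real
  assumes I_lip: "locally_lipschitz I"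
    and I_usc: "upper_semicontinuous_wrt tau.mtopology I"
    and I_eq: "\<And>u. I u = 1/2 * (norm (Q u))\<^sup>2 - 1/2 * (norm (P u))\<^sup>2 - \<Psi> u"
    and Psi_bdd: "bdd_below (range \<Psi>)"
    and pos: "\<delta> > 0" "R > r" "r > 0"
    and I_S: "\<And>u. u \<in> Z \<Longrightarrow> norm u = r \<Longrightarrow> I u \<ge> \<delta>"
    and I_M0: "\<And>u. u \<in> M \<Longrightarrow> norm u = R \<or> Q u = 0 \<Longrightarrow> I u \<le> 0"
    and H: "condition_H tau.mtopology I \<Psi>"
begin

lemma I_continuous: "continuous_on UNIV I"
  unfolding continuous_on_eq_continuous_at[OF open_UNIV]
proof
  fix u
  obtain d L where d: "d > 0" "L-lipschitz_on (ball u d) I"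
    using I_lip unfolding locally_lipschitz_def by blast
  then have "continuous_on (ball u d) I" by (simp add: lipschitz_on_continuous_on)
  then show "isCont I u" using d(1) by (simp add: continuous_on_eq_continuous_at)
qed

text \<open>Both bounds express that \<open>\<Psi>\<close> is bounded below. Tau controls only
  \<open>Q u\<close> in norm: the first then bounds \<open>I\<close> from above, and the second
  bounds \<open>P u\<close> wherever \<open>I\<close> is bounded below.\<close>

lemma I_upper_bound:
  obtains m where "\<And>u. I u \<le> 1/2 * (norm (Q u))\<^sup>2 - m"
    "\<And>u. 1/2 * (norm (P u))\<^sup>2 \<le> 1/2 * (norm (Q u))\<^sup>2 - m - I u"
proof -
  obtain m where m: "\<And>u. m \<le> \<Psi> u" using Psi_bdd by (auto simp: bdd_below_def)
  have 1: "1/2 * (norm (P u))\<^sup>2 \<le> 1/2 * (norm (Q u))\<^sup>2 - m - I u" for u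
    using m[of u] I_eq[of u] by linarith
  have "I u \<le> 1/2 * (norm (Q u))\<^sup>2 - m" for u
    using 1[of u] zero_le_power2[of "norm (P u)"] by linarith
  then show ?thesis using that 1 by blast
qed

lemma grad_vectors_Psi:
  assumes "x \<in> grad_vectors I u"
  shows "Q u - P u - x \<in> grad_vectors \<Psi> u"
proof (rule grad_vectors_diff[where q = "\<lambda>u. 1/2 * (norm (Q u))\<^sup>2 - 1/2 * (norm (P u))\<^sup>2"])
  show "x \<in> grad_vectors (\<lambda>u. 1/2 * (norm (Q u))\<^sup>2 - 1/2 * (norm (P u))\<^sup>2 - \<Psi> u) u"
    using assms by (simp add: I_eq[abs_def])
  fix v :: 'a and \<epsilon> :: real assume e: "\<epsilon> > 0"
  define q where "q u = 1/2 * (norm (Q u))\<^sup>2 - 1/2 * (norm (P u))\<^sup>2" for u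
  define n where "n = norm v"
  \<comment> \<open>Absorbs the error \<open>2 * n * d\<close> from moving the base point by
    \<open>h\<close> and the error \<open>n\<^sup>2 * d\<close> from the quadratic term in
    \<open>s\<close>.\<close>
  define d where "d = \<epsilon> / (2 * n + n\<^sup>2 + 1)"
  have n0: "2 * n + n\<^sup>2 + 1 > 0" by (simp add: n_def add_nonneg_pos)
  have d: "d > 0" "d * (2 * n + n\<^sup>2 + 1) = \<epsilon>" using e n0 by (auto simp: d_def)
  have "q (u + h + s *\<^sub>R v) - q (u + h) \<le> (inner (Q u - P u) v + \<epsilon>) * s"
    if hs: "norm h < d" "0 < s" "s < d" for h s
  proof -
    have sq: "(norm (A + s *\<^sub>R B))\<^sup>2 = (norm A)\<^sup>2 + 2 * s * inner A B + s\<^sup>2 * (norm B)\<^sup>2" for A B :: 'a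
      unfolding power2_norm_eq_inner
      by (simp add: inner_add_left inner_add_right inner_commute power2_eq_square algebra_simps)
    have "q (u + h + s *\<^sub>R v) - q (u + h) =
        s * (inner (Q (u + h)) (Q v) - inner (P (u + h)) (P v)) + s\<^sup>2 * ((norm (Q v))\<^sup>2 - (norm (P v))\<^sup>2) / 2"
      unfolding q_def P_simps(1)[of "u + h"] Q_simps(1)[of "u + h"] P_simps(3) Q_simps(3) sq
      by (simp add: algebra_simps diff_divide_distrib)
    also have "inner (Q (u + h)) (Q v) - inner (P (u + h)) (P v) =
        inner (Q u - P u) v + (inner (Q h) v - inner (P h) v)"
      by (simp add: inner_Q[symmetric] inner_P[symmetric] P_simps Q_simps inner_add_left inner_diff_left
          Q_of_Z[OF Q_in] P_of_Y[OF P_in])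
    finally have eq: "q (u + h + s *\<^sub>R v) - q (u + h) =
        s * (inner (Q u - P u) v + (inner (Q h) v - inner (P h) v)) + s\<^sup>2 * ((norm (Q v))\<^sup>2 - (norm (P v))\<^sup>2) / 2" .
    have "\<bar>inner (Q h) v\<bar> \<le> norm (Q h) * n" "\<bar>inner (P h) v\<bar> \<le> norm (P h) * n"
      unfolding n_def by (rule Cauchy_Schwarz_ineq2)+
    moreover have "norm (Q h) * n \<le> d * n" "norm (P h) * n \<le> d * n"
      using hs(1) norm_Q_le[of h] norm_P_le[of h] by (auto simp: n_def intro!: mult_right_mono)
    ultimately have 1: "inner (Q h) v - inner (P h) v \<le> 2 * (d * n)" by linarith
    have "(norm (Q v))\<^sup>2 - (norm (P v))\<^sup>2 \<le> 2 * n\<^sup>2"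
      using norm_split[of v] zero_le_power2[of "norm (P v)"] zero_le_power2[of "norm (Q v)"]
      unfolding n_def by linarith
    then have "s * ((norm (Q v))\<^sup>2 - (norm (P v))\<^sup>2) \<le> s * (2 * n\<^sup>2)"
      using hs(2) by (intro mult_left_mono) auto
    also have "\<dots> \<le> d * (2 * n\<^sup>2)" using hs by (intro mult_right_mono) auto
    finally have 2: "s * ((norm (Q v))\<^sup>2 - (norm (P v))\<^sup>2) / 2 \<le> d * n\<^sup>2" by simp
    have "2 * (d * n) + d * n\<^sup>2 \<le> \<epsilon>" using d by (simp add: algebra_simps)
    then have "(inner (Q h) v - inner (P h) v) + s * ((norm (Q v))\<^sup>2 - (norm (P v))\<^sup>2) / 2 \<le> \<epsilon>"
      using 1 2 by linarith
    then have "s * ((inner (Q h) v - inner (P h) v) + s * ((norm (Q v))\<^sup>2 - (norm (P v))\<^sup>2) / 2) \<le> s * \<epsilon>"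
      using hs(2) by (intro mult_left_mono) auto
    then show ?thesis unfolding eq by (simp add: algebra_simps power2_eq_square)
  qed
  then show "\<exists>d>0. \<forall>h s. norm h < d \<and> 0 < s \<and> s < d \<longrightarrow>
      1/2 * (norm (Q (u + h + s *\<^sub>R v)))\<^sup>2 - 1/2 * (norm (P (u + h + s *\<^sub>R v)))\<^sup>2 -
      (1/2 * (norm (Q (u + h)))\<^sup>2 - 1/2 * (norm (P (u + h)))\<^sup>2) \<le> (inner (Q u - P u) v + \<epsilon>) * s"
    using d(1) unfolding q_def by blast
qed

section \<open>Stability of gradient and norm estimates in tau-neighbourhoods\<close>

lemma tau_lim_of_inverse_bound:
  assumes "\<And>n. N (y n - x) < 1 / Suc n"
  shows "(\<lambda>n. N (y n - x)) \<longlonglongrightarrow> 0"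
proof (rule tendsto_sandwich[OF _ _ tendsto_const LIMSEQ_Suc[OF lim_1_over_n]])
  show "\<forall>\<^sub>F n in sequentially. N (y n - x) \<le> 1 / real (Suc n)"
    by (intro always_eventually allI less_imp_le assms)
qed (simp add: N_nonneg)

text \<open>Otherwise gradients violating the bound occur at points tending to \<open>x\<close> in
  tau with energies in a fixed interval. (H) bounds them, and a weak limit is a gradient at
  \<open>x\<close> with inner product at most \<open>a\<close>; hence the strict premise and the
  weak conclusion.\<close>

lemma local_estimate:
  assumes w: "\<And>\<xi>. \<xi> \<in> grad_vectors I x \<Longrightarrow> inner \<xi> w > a"
  obtains \<rho> where "\<rho> > 0"
    "\<And>y \<xi>. N (y - x) < \<rho> \<Longrightarrow> I y \<ge> -1 \<Longrightarrow> \<xi> \<in> grad_vectors I y \<Longrightarrow> inner \<xi> w \<ge> a"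
proof (rule ccontr)
  assume no: "\<not> thesis"
  have "\<exists>y \<xi>. N (y - x) < 1 / Suc n \<and> I y \<ge> -1 \<and> \<xi> \<in> grad_vectors I y \<and> inner \<xi> w < a" for n
    using no that[of "1 / Suc n"] by (meson not_le of_nat_0_less_iff zero_less_Suc zero_less_divide_1_iff)
  then obtain y \<xi> where y: "\<And>n. N (y n - x) < 1 / Suc n" "\<And>n. I (y n) \<ge> -1"
    and \<xi>: "\<And>n. \<xi> n \<in> grad_vectors I (y n)" "\<And>n. inner (\<xi> n) w < a" by metis
  have lim: "(\<lambda>n. N (y n - x)) \<longlonglongrightarrow> 0"
    using y(1) by (rule tau_lim_of_inverse_bound)
  obtain m where m: "\<And>u. I u \<le> 1/2 * (norm (Q u))\<^sup>2 - m"
    "\<And>u. 1/2 * (norm (P u))\<^sup>2 \<le> 1/2 * (norm (Q u))\<^sup>2 - m - I u" using I_upper_bound by blast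
  \<comment> \<open>Bounds the \<open>Z\<close>-parts and thereby, through \<open>\<beta>\<close>,
    the energies from above; (H) asks for energies in a bounded interval, here from -1 to
    \<open>\<beta>\<close>.\<close>
  define k where "k = N x + 1"
  have Qk: "(norm (Q (y n)))\<^sup>2 \<le> k\<^sup>2" for n
  proof -
    have "N (y n) \<le> N (y n - x) + N x" using N_triangle[of "y n - x" x] by simp
    moreover have "1 / real (Suc n) \<le> 1" by simp
    ultimately have "N (y n) \<le> k" using y(1)[of n] unfolding k_def by linarith
    then have "norm (Q (y n)) \<le> k" using norm_Q_le_N[of "y n"] by linarith
    then show ?thesis by (intro power_mono) auto
  qed
  define \<beta> where "\<beta> = 1/2 * k\<^sup>2 - m"
  have \<beta>: "I (y n) \<le> \<beta>" for n using m(1)[of "y n"] Qk[of n] unfolding \<beta>_def by linarith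
  have Hy: "-1 \<le> \<beta>" using \<beta>[of 0] y(2)[of 0] by linarith
  have "limitin tau.mtopology y x sequentially" using lim limitin_tau by blast
  moreover have "\<forall>n. I (y n) \<in> {-1..\<beta>}" using y(2) \<beta> by auto
  ultimately obtain b where b: "\<And>n. gen_gradient \<Psi> (y n) \<subseteq> ball 0 b"
    using H[unfolded condition_H_def, rule_format, of "-1" \<beta> y x] Hy by blast
  \<comment> \<open>(H) bounds gradients of \<open>\<Psi>\<close>; those of \<open>I\<close> differ
    by \<open>Q (y n) - P (y n)\<close>, whose \<open>Y\<close>-part is bounded because
    \<open>I (y n) \<ge> -1\<close>.\<close>
  have \<xi>b: "norm (\<xi> n) \<le> sqrt (2 * (k\<^sup>2 - m + 1)) + b" for n
  proof -
    have "blinfun_inner_right (Q (y n) - P (y n) - \<xi> n) \<in> ball 0 b"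
      using b[of n] grad_vectors_Psi[OF \<xi>(1)[of n]] blinfun_inner_right_in_gen_gradient_iff by blast
    then have 1: "norm (Q (y n) - P (y n) - \<xi> n) < b" by (simp add: norm_blinfun_inner_right)
    have "(norm (Q (y n) - P (y n)))\<^sup>2 = (norm (Q (y n)))\<^sup>2 + (norm (P (y n)))\<^sup>2"
      unfolding power2_norm_eq_inner using inner_YZ[OF P_in Q_in, of "y n" "y n"]
      by (simp add: inner_diff_left inner_diff_right inner_commute)
    also have "\<dots> \<le> 2 * (k\<^sup>2 - m + 1)" using m(2)[of "y n"] Qk[of n] y(2)[of n] by (simp add: algebra_simps)
    finally have "norm (Q (y n) - P (y n)) \<le> sqrt (2 * (k\<^sup>2 - m + 1))" by (rule real_le_rsqrt)
    then show ?thesis using 1 norm_triangle_ineq4[of "Q (y n) - P (y n)" "Q (y n) - P (y n) - \<xi> n"] by simp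
  qed
  obtain q l where q: "strict_mono (q :: nat \<Rightarrow> nat)"
    and l: "\<And>v. (\<lambda>n. inner (\<xi> (q n)) v) \<longlonglongrightarrow> inner l v"
    and "norm l \<le> sqrt (2 * (k\<^sup>2 - m + 1)) + b"
    by (rule bounded_weakly_convergent_subseq[OF separable \<xi>b]) (rule that)
  have "limitin tau.mtopology (y \<circ> q) x sequentially"
    unfolding limitin_tau using LIMSEQ_subseq_LIMSEQ[OF lim q] by (simp add: o_def)
  moreover have "\<forall>n. I ((y \<circ> q) n) \<in> {-1..\<beta>}" using y(2) \<beta> by auto
  ultimately have "-1 \<le> \<beta> \<and> (\<forall>n. I ((y \<circ> q) n) \<in> {-1..\<beta>}) \<and> limitin tau.mtopology (y \<circ> q) x sequentially"
    using Hy by blast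
  \<comment> \<open>(H) is applied a second time, to the extracted points, because its closedness
    part requires gradients converging along the whole sequence.\<close>
  note closed = H[unfolded condition_H_def, rule_format, OF this, THEN conjunct2]
  have "blinfun_inner_right l \<in> gen_gradient I x"
  proof (rule closed[rule_format, OF conjI])
    show "weak_star_lim (\<lambda>n. blinfun_inner_right (\<xi> (q n))) (blinfun_inner_right l)"
      using l by (simp add: weak_star_lim_def)
    show "\<forall>n. blinfun_inner_right (\<xi> (q n)) \<in> gen_gradient I ((y \<circ> q) n)"
      using \<xi>(1) by (simp add: blinfun_inner_right_in_gen_gradient_iff)
  qed
  then have "inner l w > a" using w blinfun_inner_right_in_gen_gradient_iff by blast
  moreover have "inner l w \<le> a" by (rule LIMSEQ_le_const2[OF l]) (use \<xi>(2) in \<open>auto intro: less_imp_le\<close>)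
  ultimately show False by simp
qed

text \<open>Weak lower semicontinuity: tau-nearby points may have much larger norm, but not much
  smaller. The factor 2 is the slack that turns the limit inequality into one valid on a
  neighbourhood.\<close>

lemma norm_lower_estimate:
  obtains \<rho> where "\<rho> > 0" "\<And>y. N (y - x) < \<rho> \<Longrightarrow> 1 + norm x \<le> 2 * (1 + norm y)"
proof (rule ccontr)
  assume no: "\<not> thesis"
  have "\<exists>y. N (y - x) < 1 / Suc n \<and> 2 * (1 + norm y) < 1 + norm x" for n
    using no that[of "1 / Suc n"] by (meson not_le of_nat_0_less_iff zero_less_Suc zero_less_divide_1_iff)
  then obtain y where y: "\<And>n. N (y n - x) < 1 / Suc n" "\<And>n. 2 * (1 + norm (y n)) < 1 + norm x" by metis
  have "(\<lambda>n. N (y n - x)) \<longlonglongrightarrow> 0"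
    using y(1) by (rule tau_lim_of_inverse_bound)
  moreover have "norm (y n) \<le> (norm x - 1) / 2" for n using y(2)[of n] by simp
  ultimately have "norm x \<le> (norm x - 1) / 2" by (rule tau_lim_norm_le)
  then have "2 * norm x \<le> norm x - 1" by simp
  then show False using norm_ge_zero[of x] by linarith
qed

text \<open>The vector \<open>v\<close> is constant along the segment, so Clarke's derivative in
  direction \<open>- v\<close> bounds the one-sided difference quotients of a function of one
  variable.\<close>

lemma descent_along_field:
  assumes a: "a \<ge> 0"
    and grad: "\<And>t \<xi>. 0 \<le> t \<Longrightarrow> t \<le> T \<Longrightarrow> I (x - t *\<^sub>R v) \<ge> -1 \<Longrightarrow>
      \<xi> \<in> grad_vectors I (x - t *\<^sub>R v) \<Longrightarrow> inner \<xi> v \<ge> a"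
    and t: "0 \<le> t" "t \<le> T"
  shows "I (x - t *\<^sub>R v) \<le> max (I x - a * t) (-1)"
proof -
  define h where "h t = I (x - t *\<^sub>R v)" for t
  have "h t \<le> max (h 0 - a * t) (-1)"
  proof (rule dini_descent[OF _ _ a t])
    show "continuous_on {0..T} h"
      unfolding h_def by (intro continuous_on_compose2[OF I_continuous] continuous_intros) auto
    fix t \<epsilon> :: real assume t: "0 \<le> t" "t < T" "h t > -1" and e: "\<epsilon> > 0"
    have "clarke_deriv I (x - t *\<^sub>R v) (- v) \<le> ereal (- a)"
      using grad[of t] t by (intro clarke_deriv_le_of_grad_vectors[OF I_lip]) (auto simp: h_def)
    then obtain d where d: "d > 0" "\<And>k s. norm k < d \<Longrightarrow> 0 < s \<Longrightarrow> s < d \<Longrightarrow>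
        I (x - t *\<^sub>R v + k + s *\<^sub>R (- v)) - I (x - t *\<^sub>R v + k) \<le> (- a + \<epsilon>) * s"
      unfolding clarke_deriv_le_iff using e by meson
    have "h (t + s) \<le> h t + (\<epsilon> - a) * s" if "0 < s" "s < d" for s
      using d(2)[of 0 s] d(1) that by (simp add: h_def algebra_simps)
    then show "\<exists>d>0. \<forall>s. 0 < s \<and> s < d \<longrightarrow> h (t + s) \<le> h t + (\<epsilon> - a) * s" using d(1) by blast
  qed
  then show ?thesis by (simp add: h_def)
qed

text \<open>Three radii are used around each centre: the cover has radius \<open>p x\<close>, the
  bumps \<open>3 * p x\<close>, and the estimates hold up to \<open>4 * p x\<close>. A step of
  tau-length below \<open>p x\<close> that starts in a bump thus stays where the estimates hold, so
  one straight step with frozen \<open>V y\<close> is enough.\<close>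

lemma finite_rank_descent_field:
  assumes K: "compactin tau.mtopology K" and a: "a > 0"
    and w: "\<And>x. x \<in> K \<Longrightarrow> I x \<ge> l \<Longrightarrow>
      \<exists>w. norm w \<le> 1 + norm x \<and> (\<forall>\<xi>\<in>grad_vectors I x. inner \<xi> w > a)"
  obtains V W s0 \<rho> where "s0 > 0" "\<rho> > 0" "finite W" "\<And>y. V y \<in> span W"
    "\<And>x y. (\<lambda>n. N (x n - y)) \<longlonglongrightarrow> 0 \<Longrightarrow> (\<lambda>n. V (x n)) \<longlonglongrightarrow> V y"
    "\<And>y. norm (V y) \<le> 2 * (1 + norm y)"
    "\<And>y t. 0 \<le> t \<Longrightarrow> t \<le> s0 \<Longrightarrow> I (y - t *\<^sub>R V y) \<le> max (I y) (-1)"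
    "\<And>x y t. 0 \<le> t \<Longrightarrow> t \<le> s0 \<Longrightarrow> x \<in> K \<Longrightarrow> N (y - x) < \<rho> \<Longrightarrow> I y \<ge> l \<Longrightarrow>
      I (y - t *\<^sub>R V y) \<le> max (I y - a * t) (-1)"
proof -
  \<comment> \<open>Centres with \<open>I x < l\<close> will carry no vector: by upper
    semicontinuity a whole neighbourhood lies below \<open>l\<close>, where no decrease at rate
    \<open>a\<close> is asked for.\<close>
  define good where "good x \<rho> w \<longleftrightarrow> \<rho> > 0 \<and> (if I x \<ge> l then
      (\<forall>y. N (y - x) < 4 * \<rho> \<longrightarrow> norm w \<le> 2 * (1 + norm y) \<and>
        (I y \<ge> -1 \<longrightarrow> (\<forall>\<xi>\<in>grad_vectors I y. inner \<xi> w \<ge> a)))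
      else (\<forall>y. N (y - x) < 4 * \<rho> \<longrightarrow> I y < l))" for x \<rho> w
  have "\<exists>\<rho> w. good x \<rho> w" if xK: "x \<in> K" for x
  proof (cases "I x \<ge> l")
    case True
    obtain w where w: "norm w \<le> 1 + norm x" "\<And>\<xi>. \<xi> \<in> grad_vectors I x \<Longrightarrow> inner \<xi> w > a"
      using w[OF xK True] by blast
    obtain p1 where p1: "p1 > 0"
      "\<And>y \<xi>. N (y - x) < p1 \<Longrightarrow> I y \<ge> -1 \<Longrightarrow> \<xi> \<in> grad_vectors I y \<Longrightarrow> inner \<xi> w \<ge> a"
      using local_estimate[OF w(2)] by blast
    obtain p2 where p2: "p2 > 0" "\<And>y. N (y - x) < p2 \<Longrightarrow> 1 + norm x \<le> 2 * (1 + norm y)"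
      using norm_lower_estimate[of x] by blast
    have "norm w \<le> 2 * (1 + norm y)" if "N (y - x) < p2" for y
      using p2(2)[OF that] w(1) by linarith
    then have "good x (min p1 p2 / 4) w" unfolding good_def using True p1 p2(1) by auto
    then show ?thesis by blast
  next
    case False
    have "openin tau.mtopology {u. I u < l}" using I_usc by (simp add: upper_semicontinuous_wrt_def)
    then obtain p where "p > 0" "\<And>y. N (y - x) < p \<Longrightarrow> I y < l"
      using False unfolding openin_tau by (metis (mono_tags, lifting) mem_Collect_eq not_le)
    then have "good x (p / 4) 0" unfolding good_def using False by simp
    then show ?thesis by blast
  qed
  then obtain p w where pw: "\<And>x. x \<in> K \<Longrightarrow> good x (p x) (w x)" by metis
  have p: "p x > 0" if "x \<in> K" for x using pw[OF that] by (simp add: good_def)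
  have high: "norm (w x) \<le> 2 * (1 + norm y)" "\<And>\<xi>. I y \<ge> -1 \<Longrightarrow> \<xi> \<in> grad_vectors I y \<Longrightarrow> inner \<xi> (w x) \<ge> a"
    if "x \<in> K" "I x \<ge> l" "N (y - x) < 4 * p x" for x y
    using pw[OF that(1)] that(2,3) by (auto simp: good_def)
  have low: "I y < l" if "x \<in> K" "\<not> I x \<ge> l" "N (y - x) < 4 * p x" for x y
    using pw[OF that(1)] that(2,3) by (auto simp: good_def)
  define U where "U x = {y. N (y - x) < p x}" for x
  have "openin tau.mtopology (U x)" for x
    unfolding openin_tau
  proof
    fix y assume "y \<in> U x"
    then have y: "N (y - x) < p x" by (simp add: U_def)
    have "N (z - x) < p x" if "N (z - y) < p x - N (y - x)" for z
      using N_triangle[of "z - y" "y - x"] that by simp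
    then show "\<exists>\<rho>>0. \<forall>z. N (z - y) < \<rho> \<longrightarrow> z \<in> U x"
      using y by (intro exI[of _ "p x - N (y - x)"]) (auto simp: U_def)
  qed
  moreover have "K \<subseteq> \<Union>(U ` K)" using p by (auto simp: U_def N_zero)
  ultimately obtain F where F: "finite F" "F \<subseteq> U ` K" "K \<subseteq> \<Union>F"
    using compactinD[OF K, of "U ` K"] by blast
  then obtain A where A: "finite A" "A \<subseteq> K" "K \<subseteq> (\<Union>x\<in>A. U x)"
    by (metis finite_subset_image)
  define \<rho> where "\<rho> = Min (insert 1 (p ` A))"
  have \<rho>: "\<rho> > 0" "\<And>x. x \<in> A \<Longrightarrow> \<rho> \<le> p x"
    using A(1,2) p by (auto simp: \<rho>_def)
  define A' where "A' = {x\<in>A. I x \<ge> l}"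
  have A': "finite A'" "\<And>x. x \<in> A' \<Longrightarrow> x \<in> K" "\<And>x. x \<in> A' \<Longrightarrow> I x \<ge> l" "\<And>x. x \<in> A' \<Longrightarrow> \<rho> \<le> p x"
    using A \<rho>(2) by (auto simp: A'_def)
  define \<mu> where "\<mu> x y = max 0 (3 * p x - N (y - x))" for x y
  \<comment> \<open>The lower cut-off \<open>\<rho>\<close> keeps the weights defined and continuous
    on the whole space; near \<open>K\<close> and at energies at least \<open>l\<close> it is
    inactive and the weights sum to 1.\<close>
  define D where "D y = max \<rho> (\<Sum>x\<in>A'. \<mu> x y)" for y
  define V where "V y = (\<Sum>x\<in>A'. (\<mu> x y / D y) *\<^sub>R w x)" for y
  define C where "C = (\<Sum>x\<in>A'. norm (w x))"
  \<comment> \<open>\<open>C\<close> bounds \<open>norm (V y)\<close> uniformly, so steps up to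
    \<open>s0\<close> have tau-length below \<open>\<rho>\<close>. This is where the step size comes
    to depend on the finite cover, hence on \<open>K\<close>.\<close>
  define s0 where "s0 = \<rho> / (C + 1)"
  have C0: "C \<ge> 0" by (simp add: C_def sum_nonneg)
  have l0: "\<mu> x y \<ge> 0" for x y by (simp add: \<mu>_def)
  have D0: "D y > 0" for y using \<rho>(1) by (simp add: D_def less_max_iff_disj)
  have k0: "\<mu> x y / D y \<ge> 0" for x y using l0 D0 by (simp add: less_imp_le)
  have sig1: "(\<Sum>x\<in>A'. \<mu> x y / D y) \<le> 1" for y
    using D0[of y] by (simp add: sum_divide_distrib[symmetric] D_def)
  have k1: "\<mu> x y / D y \<le> 1" if "x \<in> A'" for x y
    using member_le_sum[of x A' "\<lambda>x. \<mu> x y / D y"] k0 that A'(1) sig1[of y] by force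
  have VC: "norm (V y) \<le> C" for y
  proof -
    have "norm (V y) \<le> (\<Sum>x\<in>A'. norm ((\<mu> x y / D y) *\<^sub>R w x))" unfolding V_def by (rule norm_sum)
    also have "\<dots> \<le> C" unfolding C_def
    proof (rule sum_mono)
      fix x assume "x \<in> A'"
      then have "(\<mu> x y / D y) * norm (w x) \<le> 1 * norm (w x)" by (intro mult_right_mono k1) auto
      then show "norm ((\<mu> x y / D y) *\<^sub>R w x) \<le> norm (w x)"
        by (simp only: norm_scaleR abs_of_nonneg[OF k0] mult_1)
    qed
    finally show ?thesis .
  qed
  have s0: "s0 > 0" "s0 * C < \<rho>"
  proof -
    show "s0 > 0" using \<rho>(1) C0 by (simp add: s0_def)
    have "s0 * (C + 1) = \<rho>" using C0 by (simp add: s0_def)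
    then show "s0 * C < \<rho>" using \<open>s0 > 0\<close> by (simp add: algebra_simps)
  qed
  have active: "N (y - t *\<^sub>R V y - x) < 4 * p x"
    if x: "x \<in> A'" "\<mu> x y > 0" and t: "0 \<le> t" "t \<le> s0" for x y t
  proof -
    have "N (t *\<^sub>R V y) \<le> t * norm (V y)" using N_le_norm[of "t *\<^sub>R V y"] t by simp
    also have "\<dots> \<le> s0 * C" using t VC C0 by (intro mult_mono) auto
    also have "\<dots> < p x" using s0(2) A'(4)[OF x(1)] by linarith
    finally have "N (- (t *\<^sub>R V y)) < p x" by (simp add: N_minus)
    moreover have "N (y - x) < 3 * p x" using x(2) by (simp add: \<mu>_def)
    moreover have "N (y - t *\<^sub>R V y - x) \<le> N (y - x) + N (- (t *\<^sub>R V y))"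
      using N_triangle[of "y - x" "- (t *\<^sub>R V y)"] by (simp add: algebra_simps)
    ultimately show ?thesis by linarith
  qed
  have descent: "I (y - t *\<^sub>R V y) \<le> max (I y - (a * (\<Sum>x\<in>A'. \<mu> x y / D y)) * t) (-1)"
    if t: "0 \<le> t" "t \<le> s0" for y t
  proof (rule descent_along_field[where T = s0, OF _ _ t])
    show "a * (\<Sum>x\<in>A'. \<mu> x y / D y) \<ge> 0" using a k0 by (intro mult_nonneg_nonneg sum_nonneg) auto
    fix t \<xi> assume t: "0 \<le> t" "t \<le> s0" "I (y - t *\<^sub>R V y) \<ge> -1" "\<xi> \<in> grad_vectors I (y - t *\<^sub>R V y)"
    have "a * (\<mu> x y / D y) \<le> (\<mu> x y / D y) * inner \<xi> (w x)" if x: "x \<in> A'" for x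
    proof (cases "\<mu> x y > 0")
      case True
      then have "inner \<xi> (w x) \<ge> a" using high(2) A' active[OF x True t(1,2)] x t(3,4) by blast
      then show ?thesis using k0[of x y] by (metis mult.commute mult_left_mono)
    next
      case False
      then have "\<mu> x y = 0" using l0[of x y] by simp
      then show ?thesis by simp
    qed
    then have "(\<Sum>x\<in>A'. a * (\<mu> x y / D y)) \<le> (\<Sum>x\<in>A'. (\<mu> x y / D y) * inner \<xi> (w x))" by (rule sum_mono)
    then show "a * (\<Sum>x\<in>A'. \<mu> x y / D y) \<le> inner \<xi> (V y)"
      by (simp only: V_def inner_sum_right inner_scaleR_right sum_distrib_left)
  qed
  show ?thesis
  proof (rule that[of s0 \<rho> "w ` A'" V])
    show "s0 > 0" "\<rho> > 0" "finite (w ` A')" using s0 \<rho> A' by auto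
    show "V y \<in> span (w ` A')" for y unfolding V_def by (intro span_sum span_scale span_base imageI)
    show "(\<lambda>n. V (x n)) \<longlonglongrightarrow> V y" if lim: "(\<lambda>n. N (x n - y)) \<longlonglongrightarrow> 0" for x y
    proof -
      have Nl: "(\<lambda>n. N (x n - k)) \<longlonglongrightarrow> N (y - k)" for k
      proof (rule LIMSEQ_I)
        fix e :: real assume "e > 0"
        then obtain n0 where n0: "\<And>n. n \<ge> n0 \<Longrightarrow> N (x n - y) < e"
          using LIMSEQ_D[OF lim] N_nonneg by fastforce
        have le: "\<bar>N (x n - k) - N (y - k)\<bar> \<le> N (x n - y)" for n
          using N_triangle[of "x n - y" "y - k"] N_triangle[of "y - x n" "x n - k"] N_minus_commute[of "x n" y]
          by simp
        have "norm (N (x n - k) - N (y - k)) < e" if "n \<ge> n0" for n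
          using le[of n] n0[OF that] unfolding real_norm_def by linarith
        then show "\<exists>n0. \<forall>n\<ge>n0. norm (N (x n - k) - N (y - k)) < e" by blast
      qed
      have ll: "(\<lambda>n. \<mu> k (x n)) \<longlonglongrightarrow> \<mu> k y" for k unfolding \<mu>_def by (intro tendsto_intros Nl)
      have "(\<lambda>n. D (x n)) \<longlonglongrightarrow> D y" unfolding D_def by (intro tendsto_intros ll)
      then show ?thesis unfolding V_def using D0[of y] by (intro tendsto_intros ll) auto
    qed
    show "norm (V y) \<le> 2 * (1 + norm y)" for y
    proof -
      have "norm (V y) \<le> (\<Sum>x\<in>A'. norm ((\<mu> x y / D y) *\<^sub>R w x))" unfolding V_def by (rule norm_sum)
      also have "\<dots> \<le> (\<Sum>x\<in>A'. (\<mu> x y / D y) * (2 * (1 + norm y)))"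
      proof (rule sum_mono)
        fix x assume x: "x \<in> A'"
        have "norm ((\<mu> x y / D y) *\<^sub>R w x) = (\<mu> x y / D y) * norm (w x)"
          by (simp only: norm_scaleR abs_of_nonneg[OF k0])
        also have "\<dots> \<le> (\<mu> x y / D y) * (2 * (1 + norm y))"
        proof (cases "\<mu> x y > 0")
          case True
          then have "norm (w x) \<le> 2 * (1 + norm y)"
            using high(1)[of x y] A' x active[OF x True, of 0] s0(1) by simp
          then show ?thesis using k0 by (intro mult_left_mono) auto
        next
          case False
          then have "\<mu> x y = 0" using l0[of x y] by simp
          then show ?thesis by simp
        qed
        finally show "norm ((\<mu> x y / D y) *\<^sub>R w x) \<le> (\<mu> x y / D y) * (2 * (1 + norm y))" .
      qed
      also have "\<dots> \<le> 1 * (2 * (1 + norm y))"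
        unfolding sum_distrib_right[symmetric] using sig1 by (intro mult_right_mono) auto
      finally show ?thesis by simp
    qed
    show "I (y - t *\<^sub>R V y) \<le> max (I y) (-1)" if t: "0 \<le> t" "t \<le> s0" for y t
    proof -
      have "0 \<le> (a * (\<Sum>x\<in>A'. \<mu> x y / D y)) * t"
        using a k0 t(1) by (intro mult_nonneg_nonneg sum_nonneg) auto
      then show ?thesis using descent[OF t, of y] by linarith
    qed
    show "I (y - t *\<^sub>R V y) \<le> max (I y - a * t) (-1)"
      if t: "0 \<le> t" "t \<le> s0" and x: "x \<in> K" "N (y - x) < \<rho>" and Iy: "I y \<ge> l" for x y t
    proof -
      obtain k where k: "k \<in> A" "N (x - k) < p k" using A(3) x(1) by (auto simp: U_def)
      have yk: "N (y - k) < 2 * p k"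
        using N_triangle[of "y - x" "x - k"] x(2) k(2) \<rho>(2)[OF k(1)] by simp
      have kK: "k \<in> K" using k(1) A(2) by blast
      \<comment> \<open>\<open>y\<close> lies in the neighbourhood of \<open>k\<close>, and a low
        centre would force \<open>I y < l\<close> there.\<close>
      have "I k \<ge> l"
      proof (rule ccontr)
        assume "\<not> I k \<ge> l"
        then have "I y < l" using low[OF kK, of y] yk p[OF kK] by linarith
        then show False using Iy by simp
      qed
      then have kA': "k \<in> A'" using k(1) by (simp add: A'_def)
      have "\<rho> \<le> \<mu> k y" using yk \<rho>(2)[OF k(1)] by (simp add: \<mu>_def)
      also have "\<dots> \<le> (\<Sum>x\<in>A'. \<mu> x y)"
        using member_le_sum[of k A' "\<lambda>x. \<mu> x y"] kA' A'(1) l0 by simp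
      finally have "D y = (\<Sum>x\<in>A'. \<mu> x y)" by (simp add: D_def)
      then have "(\<Sum>x\<in>A'. \<mu> x y / D y) = 1" using D0[of y] by (simp add: sum_divide_distrib[symmetric])
      then show ?thesis using descent[OF t, of y] by simp
    qed
  qed
qed

end

section \<open>The minimax level\<close>

context variational
begin

section \<open>The admissible class and its minimax level\<close>

definition \<Gamma> :: "(real \<Rightarrow> 'a \<Rightarrow> 'a) set" where "\<Gamma> = Gamma_class tau.mtopology I M"

definition level :: "(real \<Rightarrow> 'a \<Rightarrow> 'a) \<Rightarrow> real" where "level \<gamma> = (SUP u\<in>M. I (\<gamma> 1 u))"

definition c :: real where "c = (INF \<gamma>\<in>\<Gamma>. level \<gamma>)"

text \<open>Kept apart from \<open>\<Gamma>\<close> because it survives uniform limits, whereas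
  finite-dimensionality of the displacements need not.\<close>

definition tau_cont :: "('a \<Rightarrow> 'a) \<Rightarrow> bool" where
  "tau_cont \<phi> \<longleftrightarrow> (\<forall>x l. (\<forall>n. x n \<in> M) \<and> l \<in> M \<and> (\<lambda>n. N (x n - l)) \<longlonglongrightarrow> 0 \<longrightarrow>
     (\<lambda>n. N (\<phi> (x n) - \<phi> l)) \<longlonglongrightarrow> 0)"

lemma tau_contD:
  assumes "tau_cont \<phi>" "\<And>n. x n \<in> M" "l \<in> M" "(\<lambda>n. N (x n - l)) \<longlonglongrightarrow> 0"
  shows "(\<lambda>n. N (\<phi> (x n) - \<phi> l)) \<longlonglongrightarrow> 0"
  using assms by (simp add: tau_cont_def)

lemma Gamma_iff: "\<gamma> \<in> \<Gamma> \<longleftrightarrow> continuous_on ({0..1} \<times> M) (\<lambda>(s, u). \<gamma> s u) \<and>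
    tau_continuous_homotopy tau.mtopology M \<gamma> \<and>
    tau_locally_finite_dim tau.mtopology M (\<lambda>s u. u - \<gamma> s u) \<and>
    (\<forall>u\<in>M. \<gamma> 0 u = u) \<and> (\<forall>s\<in>{0..1}. \<forall>u\<in>M. I (\<gamma> s u) \<le> max (I u) (-1))"
  by (auto simp: \<Gamma>_def Gamma_class_def admissible_homotopy_def)

lemma tau_locally_finite_dimI:
  assumes "finite B" "\<And>s u. s \<in> {0..1} \<Longrightarrow> u \<in> M \<Longrightarrow> g s u \<in> span B"
  shows "tau_locally_finite_dim tau.mtopology M g"
  unfolding tau_locally_finite_dim_def
proof (intro ballI)
  fix s :: real and u assume su: "s \<in> {0..1}" "u \<in> M"
  let ?X = "prod_topology (top_of_set {0..1::real}) tau.mtopology"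
  have "openin ?X (topspace ?X)" by (rule openin_topspace)
  moreover have "(s, u) \<in> topspace ?X" using su by auto
  moreover have "(\<lambda>(t, v). g t v) ` (topspace ?X \<inter> {0..1} \<times> M) \<subseteq> span B" using assms(2) by auto
  ultimately show "\<exists>N. openin ?X N \<and> (s, u) \<in> N \<and>
      (\<exists>B. finite B \<and> (\<lambda>(t, v). g t v) ` (N \<inter> {0..1} \<times> M) \<subseteq> span B)"
    using assms(1) by blast
qed

text \<open>Keeps the infimum defining \<open>c\<close> from being taken over the empty set.\<close>

lemma id_in_Gamma: "(\<lambda>s u. u) \<in> \<Gamma>"
  unfolding Gamma_iff
proof (intro conjI)
  show "tau_locally_finite_dim tau.mtopology M (\<lambda>s u. u - u)"
    by (rule tau_locally_finite_dimI[of "{}"]) auto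
qed (auto simp: tau_continuous_homotopy_def case_prod_beta intro: continuous_on_snd continuous_on_id)

lemma R_pos: "R > 0" using pos by linarith

lemma zero_in_M: "0 \<in> M" using R_pos by (auto simp: M_iff Q_simps intro!: exI[of _ 0])

lemma norm_M: "u \<in> M \<Longrightarrow> norm u \<le> R" by (simp add: M_iff)

text \<open>Makes the real-valued supremum in \<open>level\<close> a genuine one: energies on the
  bounded set \<open>M\<close> are bounded above, and maps in \<open>\<Gamma>\<close> can raise them
  no further than -1.\<close>

lemma Gamma_bdd_above:
  assumes "\<gamma> \<in> \<Gamma>"
  shows "bdd_above ((\<lambda>u. I (\<gamma> 1 u)) ` M)"
proof -
  obtain m where m: "\<And>u. I u \<le> 1/2 * (norm (Q u))\<^sup>2 - m"
    "\<And>u. 1/2 * (norm (P u))\<^sup>2 \<le> 1/2 * (norm (Q u))\<^sup>2 - m - I u" using I_upper_bound by blast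
  have "I (\<gamma> 1 u) \<le> max (1/2 * R\<^sup>2 - m) (-1)" if u: "u \<in> M" for u
  proof -
    have "(norm (Q u))\<^sup>2 \<le> R\<^sup>2"
      using norm_Q_le[of u] norm_M[OF u] by (intro power_mono) auto
    then have "I u \<le> 1/2 * R\<^sup>2 - m" using m(1)[of u] by linarith
    moreover have "I (\<gamma> 1 u) \<le> max (I u) (-1)" using assms u by (simp add: Gamma_iff)
    ultimately show ?thesis by linarith
  qed
  then show ?thesis by (intro bdd_aboveI2)
qed

lemma I_le_level: "\<gamma> \<in> \<Gamma> \<Longrightarrow> u \<in> M \<Longrightarrow> I (\<gamma> 1 u) \<le> level \<gamma>"
  unfolding level_def by (rule cSUP_upper[OF _ Gamma_bdd_above])

lemma Gamma_finite_dim: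
  assumes "\<gamma> \<in> \<Gamma>"
  obtains B where "finite B" "\<And>s u. s \<in> {0..1} \<Longrightarrow> u \<in> M \<Longrightarrow> u - \<gamma> s u \<in> span B"
  using admissible_finite_dim[of "\<lambda>s u. u - \<gamma> s u"] assms unfolding Gamma_iff by blast

text \<open>Linking yields a point sent into the sphere on which \<open>I \<ge> \<delta>\<close>.
  Images of the relative boundary never meet this sphere, since their energy is at most 0 throughout
  the homotopy.\<close>

lemma level_ge:
  assumes "\<gamma> \<in> \<Gamma>"
  shows "level \<gamma> \<ge> \<delta>"
proof -
  obtain B where B: "finite B" "\<And>s u. s \<in> {0..1} \<Longrightarrow> u \<in> M \<Longrightarrow> u - \<gamma> s u \<in> span B"
    using Gamma_finite_dim[OF assms] by blast
  have S: "I v \<ge> \<delta>" if "P v = 0" "norm (Q v) = r" for v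
    using that P_add_Q[of v] Q_in[of v] I_S[of v] by simp
  have cont: "continuous_on ({0..1} \<times> M) (\<lambda>(s, u). \<gamma> s u)"
    and start: "\<And>u. u \<in> M \<Longrightarrow> \<gamma> 0 u = u"
    and le: "\<And>s u. s \<in> {0..1} \<Longrightarrow> u \<in> M \<Longrightarrow> I (\<gamma> s u) \<le> max (I u) (-1)"
    using assms unfolding Gamma_iff by blast+
  obtain u where "u \<in> M" "P (\<gamma> 1 u) = 0" "norm (Q (\<gamma> 1 u)) = r"
  proof (rule linking[OF B cont start pos(3,2)])
    fix s u assume su: "s \<in> {0..1::real}" "u \<in> M" "norm u = R \<or> Q u = 0"
    show "\<not> (P (\<gamma> s u) = 0 \<and> norm (Q (\<gamma> s u)) = r)"
      using S[of "\<gamma> s u"] le[OF su(1,2)] I_M0[OF su(2,3)] pos(1) by auto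
  qed
  then show ?thesis using S[of "\<gamma> 1 u"] I_le_level[OF assms] by fastforce
qed

lemma c_ge: "c \<ge> \<delta>"
  unfolding c_def using id_in_Gamma level_ge by (intro cINF_greatest) auto

lemma c_le_level: "\<gamma> \<in> \<Gamma> \<Longrightarrow> c \<le> level \<gamma>"
  unfolding c_def by (rule cINF_lower) (auto intro!: bdd_belowI2[of _ \<delta>] level_ge)

section \<open>Tau-continuous images of the linking set and deformation of end maps\<close>

lemma tau_cont_Gamma:
  assumes "\<gamma> \<in> \<Gamma>"
  shows "tau_cont (\<gamma> 1)"
  unfolding tau_cont_def
proof (intro allI impI, elim conjE)
  fix x l assume x: "\<forall>n. x n \<in> M" "l \<in> M" "(\<lambda>n. N (x n - l)) \<longlonglongrightarrow> 0"
  have "tau_continuous_homotopy tau.mtopology M \<gamma>" using assms by (simp add: Gamma_iff)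
  from this[unfolded tau_continuous_homotopy_def, rule_format, of "\<lambda>_. 1" 1 x l]
  show "(\<lambda>n. N (\<gamma> 1 (x n) - \<gamma> 1 l)) \<longlonglongrightarrow> 0" using x by (simp add: limitin_tau)
qed

lemma M_subseq:
  assumes "\<And>n. x n \<in> M"
  obtains l q where "l \<in> M" "strict_mono (q :: nat \<Rightarrow> nat)" "(\<lambda>n. N (x (q n) - l)) \<longlonglongrightarrow> 0"
proof -
  have "range x \<subseteq> M" using assms by blast
  then obtain l q where "l \<in> M" "strict_mono (q :: nat \<Rightarrow> nat)" "limitin tau.mtopology (x \<circ> q) l sequentially"
    using compactin_M unfolding tau.compactin_sequentially by blast
  then show ?thesis using that by (simp add: limitin_tau o_def)
qed

lemma tau_cont_compact_image:
  assumes "tau_cont \<phi>"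
  shows "compactin tau.mtopology (\<phi> ` M)"
  unfolding tau.compactin_sequentially
proof (intro conjI allI impI)
  fix y :: "nat \<Rightarrow> 'a" assume "range y \<subseteq> \<phi> ` M"
  then have "\<forall>n. \<exists>x\<in>M. y n = \<phi> x" by blast
  then obtain x where x: "\<And>n. x n \<in> M" "\<And>n. y n = \<phi> (x n)" by metis
  obtain l q where l: "l \<in> M" "strict_mono (q :: nat \<Rightarrow> nat)" "(\<lambda>n. N (x (q n) - l)) \<longlonglongrightarrow> 0"
    by (rule M_subseq[of x, OF x(1)]) (rule that)
  have "(\<lambda>n. N (\<phi> (x (q n)) - \<phi> l)) \<longlonglongrightarrow> 0"
    by (rule tau_contD[OF assms x(1) l(1) l(3)])
  then have "limitin tau.mtopology (y \<circ> q) (\<phi> l) sequentially" by (simp add: limitin_tau o_def x(2))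
  then show "\<exists>l r. l \<in> \<phi> ` M \<and> strict_mono r \<and> limitin tau.mtopology (y \<circ> r) l sequentially"
    using l by blast
qed simp

text \<open>Tau-compactness bounds displacements only in \<open>N\<close>; they lie in a fixed
  finite-dimensional span, on which a multiple of \<open>N\<close> dominates the norm.\<close>

lemma Gamma_norm_bounded:
  assumes "\<gamma> \<in> \<Gamma>"
  obtains b where "\<And>u. u \<in> M \<Longrightarrow> norm (\<gamma> 1 u) \<le> b"
proof -
  obtain B where B: "finite B" "\<And>s u. s \<in> {0..1} \<Longrightarrow> u \<in> M \<Longrightarrow> u - \<gamma> s u \<in> span B"
    using Gamma_finite_dim[OF assms] by blast
  obtain C where C: "C > 0" "\<And>v. v \<in> span B \<Longrightarrow> norm v \<le> C * N v"
    using norm_le_N_on_span[OF B(1)] by blast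
  have "\<exists>k. \<forall>u\<in>M. N (u - \<gamma> 1 u) \<le> k"
  proof (rule ccontr)
    assume "\<not> ?thesis"
    then have "\<forall>n::nat. \<exists>u\<in>M. N (u - \<gamma> 1 u) > real n" by (meson not_le)
    then obtain x where x: "\<And>n. x n \<in> M" "\<And>n. N (x n - \<gamma> 1 (x n)) > real n" by metis
    obtain l q where l: "l \<in> M" "strict_mono (q :: nat \<Rightarrow> nat)" "(\<lambda>n. N (x (q n) - l)) \<longlonglongrightarrow> 0"
      by (rule M_subseq[of x, OF x(1)]) (rule that)
    have "(\<lambda>n. N (\<gamma> 1 (x (q n)) - \<gamma> 1 l)) \<longlonglongrightarrow> 0"
      by (rule tau_contD[OF tau_cont_Gamma[OF assms] x(1) l(1) l(3)])
    then have "\<forall>\<^sub>F n in sequentially. N (\<gamma> 1 (x (q n)) - \<gamma> 1 l) < 1"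
      by (rule order_tendstoD(2)) simp
    then obtain n0 where n0: "\<And>n. n \<ge> n0 \<Longrightarrow> N (\<gamma> 1 (x (q n)) - \<gamma> 1 l) < 1"
      by (auto simp: eventually_sequentially)
    obtain n1 :: nat where n1: "real n1 > R + 1 + N (\<gamma> 1 l)" using reals_Archimedean2 by blast
    define n where "n = max n0 n1"
    have "real n1 \<le> real (q n)" using seq_suble[OF l(2), of n] by (simp add: n_def)
    also have "\<dots> < N (x (q n) - \<gamma> 1 (x (q n)))" by (rule x(2))
    also have "\<dots> \<le> N (x (q n)) + N (- \<gamma> 1 (x (q n)))" using N_triangle[of "x (q n)" "- \<gamma> 1 (x (q n))"] by simp
    also have "\<dots> \<le> R + N (\<gamma> 1 (x (q n)))"
      using N_le_norm[of "x (q n)"] norm_M[OF x(1)[of "q n"]] by (simp add: N_minus)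
    also have "\<dots> \<le> R + (N (\<gamma> 1 (x (q n)) - \<gamma> 1 l) + N (\<gamma> 1 l))"
      using N_triangle[of "\<gamma> 1 (x (q n)) - \<gamma> 1 l" "\<gamma> 1 l"] by simp
    also have "\<dots> < R + 1 + N (\<gamma> 1 l)" using n0[of n] by (simp add: n_def)
    finally show False using n1 by simp
  qed
  then obtain k where k: "\<And>u. u \<in> M \<Longrightarrow> N (u - \<gamma> 1 u) \<le> k" by blast
  have "norm (\<gamma> 1 u) \<le> R + C * k" if u: "u \<in> M" for u
  proof -
    have "norm (u - \<gamma> 1 u) \<le> C * N (u - \<gamma> 1 u)" using B(2)[of 1 u] u by (intro C(2)) auto
    also have "\<dots> \<le> C * k" using k[OF u] C(1) by (intro mult_left_mono) auto
    finally show ?thesis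
      using norm_triangle_ineq4[of u "u - \<gamma> 1 u"] norm_M[OF u] by simp
  qed
  then show ?thesis by (rule that)
qed

lemma tau_cont_uniform_limit:
  assumes cont: "\<And>k. tau_cont (\<psi> k)" and conv: "\<eta> \<longlonglongrightarrow> 0"
    and unif: "\<And>k u. u \<in> M \<Longrightarrow> norm (\<psi> k u - \<phi> u) \<le> \<eta> (k :: nat)"
  shows "tau_cont \<phi>"
  unfolding tau_cont_def
proof (intro allI impI, elim conjE)
  fix x l assume x: "\<forall>n. x n \<in> M" "l \<in> M" "(\<lambda>n. N (x n - l)) \<longlonglongrightarrow> 0"
  show "(\<lambda>n. N (\<phi> (x n) - \<phi> l)) \<longlonglongrightarrow> 0"
  proof (rule LIMSEQ_I)
    fix \<epsilon> :: real assume "\<epsilon> > 0"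
    then have "\<forall>\<^sub>F k in sequentially. \<eta> k < \<epsilon> / 3" by (intro order_tendstoD(2)[OF conv]) simp
    then obtain k where k: "\<eta> k < \<epsilon> / 3" by (auto simp: eventually_sequentially)
    have "(\<lambda>n. N (\<psi> k (x n) - \<psi> k l)) \<longlonglongrightarrow> 0" using tau_contD[OF cont[of k], of x l] x by simp
    then have "\<forall>\<^sub>F n in sequentially. N (\<psi> k (x n) - \<psi> k l) < \<epsilon> / 3"
      using \<open>\<epsilon> > 0\<close> by (intro order_tendstoD(2)) auto
    then obtain n0 where n0: "\<And>n. n \<ge> n0 \<Longrightarrow> N (\<psi> k (x n) - \<psi> k l) < \<epsilon> / 3"
      by (auto simp: eventually_sequentially)
    have "norm (N (\<phi> (x n) - \<phi> l) - 0) < \<epsilon>" if "n \<ge> n0" for n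
    proof -
      have "N (\<phi> (x n) - \<phi> l) \<le> N (\<phi> (x n) - \<psi> k (x n)) + N (\<psi> k (x n) - \<phi> l)"
        using N_triangle[of "\<phi> (x n) - \<psi> k (x n)" "\<psi> k (x n) - \<phi> l"] by simp
      moreover have "N (\<psi> k (x n) - \<phi> l) \<le> N (\<psi> k (x n) - \<psi> k l) + N (\<psi> k l - \<phi> l)"
        using N_triangle[of "\<psi> k (x n) - \<psi> k l" "\<psi> k l - \<phi> l"] by simp
      moreover have "N (\<phi> (x n) - \<psi> k (x n)) \<le> \<eta> k"
        using N_le_norm[of "\<psi> k (x n) - \<phi> (x n)"] unif[of "x n" k] x(1)
          N_minus_commute[of "\<phi> (x n)" "\<psi> k (x n)"] by simp
      moreover have "N (\<psi> k l - \<phi> l) \<le> \<eta> k"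
        using N_le_norm[of "\<psi> k l - \<phi> l"] unif[of l k] x(2) by simp
      ultimately have "N (\<phi> (x n) - \<phi> l) < \<epsilon>" using n0[OF that] k by linarith
      then show ?thesis by (simp add: N_nonneg)
    qed
    then show "\<exists>n0. \<forall>n\<ge>n0. norm (N (\<phi> (x n) - \<phi> l) - 0) < \<epsilon>" by blast
  qed
qed

text \<open>Runs \<open>\<gamma>\<close> in the first half of the time and the straight step in the
  second; writing this with \<open>min\<close> and \<open>max\<close> makes continuity at the
  junction automatic. Continuity of \<open>V\<close> from tau to the norm serves both continuity
  requirements of \<open>\<Gamma>\<close>.\<close>

lemma Gamma_extend:
  assumes \<gamma>: "\<gamma> \<in> \<Gamma>" and W: "finite W" "\<And>y. V y \<in> span W"
    and V: "\<And>x y. (\<lambda>n. N (x n - y)) \<longlonglongrightarrow> 0 \<Longrightarrow> (\<lambda>n. V (x n)) \<longlonglongrightarrow> V y"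
    and desc: "\<And>y t. 0 \<le> t \<Longrightarrow> t \<le> s0 \<Longrightarrow> I (y - t *\<^sub>R V y) \<le> max (I y) (-1)"
    and s0: "s0 > 0"
  shows "(\<lambda>s u. \<gamma> (min (2 * s) 1) u - (max 0 (2 * s - 1) * s0) *\<^sub>R V (\<gamma> 1 u)) \<in> \<Gamma>"
    (is "?\<gamma> \<in> \<Gamma>")
proof -
  have cont: "continuous_on ({0..1} \<times> M) (\<lambda>(s, u). \<gamma> s u)"
    and tcont: "tau_continuous_homotopy tau.mtopology M \<gamma>"
    and start: "\<And>u. u \<in> M \<Longrightarrow> \<gamma> 0 u = u"
    and le: "\<And>s u. s \<in> {0..1} \<Longrightarrow> u \<in> M \<Longrightarrow> I (\<gamma> s u) \<le> max (I u) (-1)"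
    using \<gamma> unfolding Gamma_iff by blast+
  obtain B where B: "finite B" "\<And>s u. s \<in> {0..1} \<Longrightarrow> u \<in> M \<Longrightarrow> u - \<gamma> s u \<in> span B"
    using Gamma_finite_dim[OF \<gamma>] by blast
  have Vc: "continuous_on UNIV V"
    unfolding continuous_on_sequentially o_def using V tau_lim_of_norm_lim by blast
  show ?thesis unfolding Gamma_iff
  proof (intro conjI ballI)
    have c1: "continuous_on ({0..1} \<times> M) (\<lambda>z. \<gamma> (min (2 * fst z) 1) (snd z))"
    proof -
      have "continuous_on ({0..1} \<times> M) ((\<lambda>(s, u). \<gamma> s u) \<circ> (\<lambda>z. (min (2 * fst z) 1, snd z)))"
        by (intro continuous_on_compose continuous_on_subset[OF cont] continuous_intros) auto
      then show ?thesis by (simp add: o_def)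
    qed
    have "continuous_on ({0..1} \<times> M) ((\<lambda>(s, u). \<gamma> s u) \<circ> (\<lambda>z. (1, snd z)))"
      by (intro continuous_on_compose continuous_on_subset[OF cont] continuous_intros) auto
    then have "continuous_on ({0..1} \<times> M) (\<lambda>z. \<gamma> 1 (snd z))" by (simp add: o_def)
    then have "continuous_on ({0..1} \<times> M) (\<lambda>z. V (\<gamma> 1 (snd z)))"
      by (intro continuous_on_compose2[OF Vc]) auto
    then show "continuous_on ({0..1} \<times> M) (\<lambda>(s, u). ?\<gamma> s u)"
      unfolding case_prod_beta by (intro continuous_intros c1)
    show "tau_continuous_homotopy tau.mtopology M ?\<gamma>"
      unfolding tau_continuous_homotopy_def limitin_tau
    proof (intro allI impI, elim conjE)
      fix s :: "nat \<Rightarrow> real" and s1 u u0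
      assume s: "\<forall>n. s n \<in> {0..1}" "s1 \<in> {0..1}" "s \<longlonglongrightarrow> s1"
        and u: "\<forall>n. u n \<in> M" "u0 \<in> M" "(\<lambda>n. N (u n - u0)) \<longlonglongrightarrow> 0"
      have "(\<lambda>n. min (2 * s n) 1) \<longlonglongrightarrow> min (2 * s1) 1" by (intro tendsto_intros s)
      then have "(\<lambda>n. N (\<gamma> (min (2 * s n) 1) (u n) - \<gamma> (min (2 * s1) 1) u0)) \<longlonglongrightarrow> 0"
        using tcont[unfolded tau_continuous_homotopy_def limitin_tau, rule_format,
            of "\<lambda>n. min (2 * s n) 1" "min (2 * s1) 1" u u0] s u by auto
      moreover have "(\<lambda>n. N (- ((max 0 (2 * s n - 1) * s0) *\<^sub>R V (\<gamma> 1 (u n)))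
          - - ((max 0 (2 * s1 - 1) * s0) *\<^sub>R V (\<gamma> 1 u0)))) \<longlonglongrightarrow> 0"
      proof (rule tau_lim_of_norm_lim)
        have "(\<lambda>n. V (\<gamma> 1 (u n))) \<longlonglongrightarrow> V (\<gamma> 1 u0)"
          using tau_contD[OF tau_cont_Gamma[OF \<gamma>], of u u0] u by (intro V) simp
        then show "(\<lambda>n. - ((max 0 (2 * s n - 1) * s0) *\<^sub>R V (\<gamma> 1 (u n))))
            \<longlonglongrightarrow> - ((max 0 (2 * s1 - 1) * s0) *\<^sub>R V (\<gamma> 1 u0))"
          by (intro tendsto_intros s)
      qed
      ultimately have sum: "(\<lambda>n. N (\<gamma> (min (2 * s n) 1) (u n) - \<gamma> (min (2 * s1) 1) u0)
          + N (- ((max 0 (2 * s n - 1) * s0) *\<^sub>R V (\<gamma> 1 (u n)))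
          - - ((max 0 (2 * s1 - 1) * s0) *\<^sub>R V (\<gamma> 1 u0)))) \<longlonglongrightarrow> 0"
        using tendsto_add[of _ 0 sequentially _ 0] by simp
      show "(\<lambda>n. N (?\<gamma> (s n) (u n) - ?\<gamma> s1 u0)) \<longlonglongrightarrow> 0"
      proof (rule tendsto_sandwich[OF _ _ tendsto_const sum])
        have split: "(A - C) - (B - D) = (A - B) + (- C - - D)" for A B C D :: 'a by simp
        show "\<forall>\<^sub>F n in sequentially. N (?\<gamma> (s n) (u n) - ?\<gamma> s1 u0) \<le>
          N (\<gamma> (min (2 * s n) 1) (u n) - \<gamma> (min (2 * s1) 1) u0)
          + N (- ((max 0 (2 * s n - 1) * s0) *\<^sub>R V (\<gamma> 1 (u n)))
          - - ((max 0 (2 * s1 - 1) * s0) *\<^sub>R V (\<gamma> 1 u0)))"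
          by (intro always_eventually allI) (subst split, rule N_triangle)
      qed (simp add: N_nonneg)
    qed
    show "tau_locally_finite_dim tau.mtopology M (\<lambda>s u. u - ?\<gamma> s u)"
    proof (rule tau_locally_finite_dimI[of "B \<union> W"])
      fix s :: real and u assume su: "s \<in> {0..1}" "u \<in> M"
      have "u - \<gamma> (min (2 * s) 1) u \<in> span (B \<union> W)"
        using B(2)[of "min (2 * s) 1" u] su span_mono[of B "B \<union> W"] by auto
      moreover have "(max 0 (2 * s - 1) * s0) *\<^sub>R V (\<gamma> 1 u) \<in> span (B \<union> W)"
        using W(2) span_mono[of W "B \<union> W"] by (intro span_scale) auto
      ultimately have "(u - \<gamma> (min (2 * s) 1) u) + (max 0 (2 * s - 1) * s0) *\<^sub>R V (\<gamma> 1 u) \<in> span (B \<union> W)"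
        by (rule span_add)
      then show "u - ?\<gamma> s u \<in> span (B \<union> W)" by (simp add: algebra_simps)
    qed (use B W in simp)
    fix u assume u: "u \<in> M"
    show "?\<gamma> 0 u = u" using start[OF u] by simp
    fix s :: real assume s: "s \<in> {0..1}"
    show "I (?\<gamma> s u) \<le> max (I u) (-1)"
    proof (cases "s \<le> 1/2")
      case True
      then have "max 0 (2 * s - 1) * s0 = 0" "min (2 * s) 1 = 2 * s" by auto
      then show ?thesis using le[of "2 * s" u] True s u by simp
    next
      case False
      have "(2 * s - 1) * s0 \<le> 1 * s0" using s s0 by (intro mult_right_mono) auto
      then have "I (\<gamma> 1 u - ((2 * s - 1) * s0) *\<^sub>R V (\<gamma> 1 u)) \<le> max (I (\<gamma> 1 u)) (-1)"
        using False s0 by (intro desc) auto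
      also have "\<dots> \<le> max (I u) (-1)" using le[of 1 u] u by auto
      finally have "I (\<gamma> 1 u - ((2 * s - 1) * s0) *\<^sub>R V (\<gamma> 1 u)) \<le> max (I u) (-1)" .
      moreover have "max 0 (2 * s - 1) = 2 * s - 1" "min (2 * s) 1 = 1" using False by auto
      ultimately show ?thesis by simp
    qed
  qed
qed

text \<open>Failure for every \<open>1 / Suc n\<close> would produce a Cerami sequence. The same
  \<open>\<epsilon>\<close> is band width and lower bound; \<open>\<epsilon> \<le> 1\<close> will
  keep the band above -1 because \<open>c > 0\<close>.\<close>

lemma no_cerami_lower_bound:
  assumes "\<nexists>u. cerami_seq I c u"
  obtains \<epsilon> where "\<epsilon> > 0" "\<epsilon> \<le> 1" "\<And>u. \<bar>I u - c\<bar> \<le> \<epsilon> \<Longrightarrow> (1 + norm u) * min_grad_norm I u \<ge> \<epsilon>"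
proof (rule ccontr)
  assume no: "\<not> thesis"
  have "\<exists>u. \<bar>I u - c\<bar> \<le> 1 / Suc n \<and> (1 + norm u) * min_grad_norm I u < 1 / Suc n" for n
  proof (rule ccontr)
    assume "\<not> ?thesis"
    then have "(1 + norm u) * min_grad_norm I u \<ge> 1 / Suc n" if "\<bar>I u - c\<bar> \<le> 1 / Suc n" for u
      using that by (meson not_le)
    then show False using no that[of "1 / Suc n"] by simp
  qed
  then obtain u where u: "\<And>n. \<bar>I (u n) - c\<bar> \<le> 1 / Suc n"
    "\<And>n. (1 + norm (u n)) * min_grad_norm I (u n) < 1 / Suc n" by metis
  have "min_grad_norm I x \<ge> 0" for x using min_grad_norm_attained[OF I_lip, of x] by (metis norm_ge_zero)
  then have g0: "(1 + norm (u n)) * min_grad_norm I (u n) \<ge> 0" for n by simp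
  have "(\<lambda>n. I (u n) - c) \<longlonglongrightarrow> 0"
  proof (rule Lim_null_comparison[OF _ LIMSEQ_Suc[OF lim_1_over_n]])
    show "\<forall>\<^sub>F n in sequentially. norm (I (u n) - c) \<le> 1 / real (Suc n)"
      using u(1) by (intro always_eventually) auto
  qed
  then have "(\<lambda>n. I (u n)) \<longlonglongrightarrow> c" by (simp add: LIM_zero_iff)
  moreover have "(\<lambda>n. (1 + norm (u n)) * min_grad_norm I (u n)) \<longlonglongrightarrow> 0"
  proof (rule tendsto_sandwich[OF _ _ tendsto_const LIMSEQ_Suc[OF lim_1_over_n]])
    show "\<forall>\<^sub>F n in sequentially. (1 + norm (u n)) * min_grad_norm I (u n) \<le> 1 / real (Suc n)"
      using u(2) by (intro always_eventually allI less_imp_le)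
  qed (use g0 in simp)
  ultimately show False using assms unfolding cerami_seq_def by blast
qed

text \<open>The minimal gradient is stretched to length \<open>1 + norm x\<close>, so the inner
  product with any gradient is at least \<open>(1 + norm x) * norm g\<close>, the very quantity
  bounded below by the Cerami condition.\<close>

lemma descent_direction:
  assumes "(1 + norm x) * min_grad_norm I x \<ge> \<epsilon>" "\<epsilon> > 0"
  obtains w where "norm w \<le> 1 + norm x" "\<And>\<xi>. \<xi> \<in> grad_vectors I x \<Longrightarrow> inner \<xi> w \<ge> \<epsilon>"
proof -
  obtain g where g: "min_grad_norm I x = norm g" "\<And>y. y \<in> grad_vectors I x \<Longrightarrow> inner g y \<ge> (norm g)\<^sup>2"
    using min_grad_norm_attained[OF I_lip] by metis
  have ng: "norm g > 0" using assms g(1) by (cases "g = 0") auto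
  have x1: "1 + norm x > 0" by (simp add: add_pos_nonneg)
  define k where "k = (1 + norm x) / norm g"
  have k: "k \<ge> 0" "k * norm g = 1 + norm x" using ng x1 by (auto simp: k_def)
  show ?thesis
  proof (rule that[of "k *\<^sub>R g"])
    show "norm (k *\<^sub>R g) \<le> 1 + norm x" using k by simp
    fix \<xi> assume "\<xi> \<in> grad_vectors I x"
    then have "k * (norm g)\<^sup>2 \<le> k * inner g \<xi>" using g(2) k(1) by (intro mult_left_mono)
    moreover have "k * (norm g)\<^sup>2 = (1 + norm x) * norm g" by (simp add: k(2)[symmetric] power2_eq_square)
    ultimately show "\<epsilon> \<le> inner \<xi> (k *\<^sub>R g)" using assms(1) g(1) by (simp add: inner_commute)
  qed
qed

text \<open>Iterate admissible deformations whose level drops by at least \<open>a * s\<close> while moving points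
  by at most \<open>2 * s * (1 + norm)\<close>, choosing \<open>s\<close> almost maximal at every stage. The step sizes are
  summable, so the maps converge uniformly; the field constructed for the limit set admits a step of
  fixed size along the tail of the sequence, contradicting the near-maximality.\<close>

theorem cerami_seq_exists: "\<exists>u. cerami_seq I c u"
proof (rule ccontr)
  assume "\<nexists>u. cerami_seq I c u"
  then obtain \<epsilon> where \<epsilon>: "\<epsilon> > 0" "\<epsilon> \<le> 1"
    "\<And>u. \<bar>I u - c\<bar> \<le> \<epsilon> \<Longrightarrow> (1 + norm u) * min_grad_norm I u \<ge> \<epsilon>"
    using no_cerami_lower_bound by blast
  \<comment> \<open>Strictly below \<open>\<epsilon>\<close>, as the local stability of gradient
    estimates starts from a strict inequality.\<close>
  define a where "a = \<epsilon> / 2"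
  have a: "a > 0" "a < \<epsilon>" using \<epsilon>(1) by (auto simp: a_def)
  define l where "l = c - \<epsilon>"
  have l: "l > -1" "l < c" using c_ge pos(1) \<epsilon> by (auto simp: l_def)
  define step where "step \<gamma> s \<gamma>' \<longleftrightarrow> \<gamma>' \<in> \<Gamma> \<and> s \<ge> 0 \<and> level \<gamma>' \<le> level \<gamma> - a * s \<and>
    (\<forall>u\<in>M. norm (\<gamma>' 1 u - \<gamma> 1 u) \<le> 2 * s * (1 + norm (\<gamma> 1 u)))" for \<gamma> s \<gamma>'
  have "\<exists>\<gamma>' s. step \<gamma> s \<gamma>' \<and> (\<forall>s' \<gamma>''. step \<gamma> s' \<gamma>'' \<longrightarrow> s' \<le> 2 * s)" if \<gamma>: "\<gamma> \<in> \<Gamma>" for \<gamma>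
  proof -
    define T where "T = {s. \<exists>\<gamma>'. step \<gamma> s \<gamma>'}"
    have id: "step \<gamma> 0 \<gamma>" using \<gamma> by (simp add: step_def)
    then have T0: "0 \<in> T" by (auto simp: T_def)
    have bT: "bdd_above T"
    \<comment> \<open>No level lies below \<open>c\<close>, so the total drop, and with it the step,
      is bounded.\<close>
    proof (rule bdd_aboveI[of _ "(level \<gamma> - c) / a"])
      fix s assume "s \<in> T"
      then obtain \<gamma>' where "step \<gamma> s \<gamma>'" by (auto simp: T_def)
      then have "c \<le> level \<gamma> - a * s" using c_le_level by (fastforce simp: step_def)
      then show "s \<le> (level \<gamma> - c) / a" using a(1) by (simp add: field_simps)
    qed
    have up: "s' \<le> Sup T" if "step \<gamma> s' \<gamma>''" for s' \<gamma>''
      using cSup_upper[OF _ bT] that by (auto simp: T_def)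
    show ?thesis
    proof (cases "Sup T > 0")
      case True
      then obtain s where "s \<in> T" "s > Sup T / 2" using less_cSupD[of T "Sup T / 2"] T0 by auto
      then obtain \<gamma>' where "step \<gamma> s \<gamma>'" by (auto simp: T_def)
      then show ?thesis using up \<open>s > Sup T / 2\<close> by (intro exI[of _ \<gamma>'] exI[of _ s]) force
    next
      case False
      \<comment> \<open>If no positive step exists, the trivial step of size 0 is maximal.\<close>
      then show ?thesis using id up by (intro exI[of _ \<gamma>] exI[of _ 0]) force
    qed
  qed
  then obtain nx sz where nx: "\<And>\<gamma>. \<gamma> \<in> \<Gamma> \<Longrightarrow> step \<gamma> (sz \<gamma>) (nx \<gamma>)"
    "\<And>\<gamma> s' \<gamma>''. \<gamma> \<in> \<Gamma> \<Longrightarrow> step \<gamma> s' \<gamma>'' \<Longrightarrow> s' \<le> 2 * sz \<gamma>" by metis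
  obtain \<gamma>0 where \<gamma>0: "\<gamma>0 \<in> \<Gamma>" "level \<gamma>0 < c + \<epsilon>"
    using cInf_lessD[of "level ` \<Gamma>" "c + \<epsilon>"] id_in_Gamma \<epsilon>(1) unfolding c_def by auto
  define g where "g k = (nx ^^ k) \<gamma>0" for k
  define s where "s k = sz (g k)" for k
  have gG: "g k \<in> \<Gamma>" for k
    by (induction k) (use \<gamma>0 nx(1) in \<open>auto simp: g_def step_def\<close>)
  have st: "step (g k) (s k) (g (Suc k))" for k using nx(1)[OF gG[of k]] by (simp add: g_def s_def)
  have s0: "s k \<ge> 0" and lev: "level (g (Suc k)) \<le> level (g k) - a * s k"
    and mv: "\<And>u. u \<in> M \<Longrightarrow> norm (g (Suc k) 1 u - g k 1 u) \<le> 2 * s k * (1 + norm (g k 1 u))" for k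
    using st[of k] by (auto simp: step_def)
  have lev_sum: "level (g n) \<le> level \<gamma>0 - a * (\<Sum>k<n. s k)" for n
  proof (induction n)
    case (Suc n) then show ?case using lev[of n] by (simp add: algebra_simps)
  qed (simp add: g_def)
  have sum_le: "(\<Sum>k<n. s k) \<le> (level \<gamma>0 - c) / a" for n
    using lev_sum[of n] c_le_level[OF gG[of n]] a(1) by (simp add: field_simps)
  have summ: "summable s" by (rule summableI_nonneg_bounded[OF s0 sum_le])
  define S where "S = suminf s"
  have S: "(\<Sum>k<n. s k) \<le> S" for n unfolding S_def using summ s0 by (intro sum_le_suminf) auto
  have s_lim: "s \<longlonglongrightarrow> 0" using summ by (rule summable_LIMSEQ_zero)
  obtain b where b: "\<And>u. u \<in> M \<Longrightarrow> norm (\<gamma>0 1 u) \<le> b" using Gamma_norm_bounded[OF \<gamma>0(1)] by blast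
  have b0: "b \<ge> 0" using b[OF zero_in_M] norm_ge_zero order_trans by blast
  \<comment> \<open>Discrete Gronwall bound: each step multiplies \<open>1 + norm\<close> by at most
    \<open>1 + 2 * s k \<le> exp (2 * s k)\<close>, and the steps sum to \<open>S\<close>.\<close>
  define C where "C = exp (2 * S) * (1 + b)"
  have C0: "C > 0" using b0 by (simp add: C_def)
  have bound: "1 + norm (g k 1 u) \<le> C" if u: "u \<in> M" for k u
  proof -
    have "1 + norm (g k 1 u) \<le> exp (2 * (\<Sum>i<k. s i)) * (1 + b)"
    proof (induction k)
      case 0 then show ?case using b[OF u] by (simp add: g_def)
    next
      case (Suc k)
      have "norm (g (Suc k) 1 u) \<le> norm (g k 1 u) + norm (g (Suc k) 1 u - g k 1 u)"
        using norm_triangle_ineq[of "g k 1 u" "g (Suc k) 1 u - g k 1 u"] by simp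
      then have "1 + norm (g (Suc k) 1 u) \<le> (1 + 2 * s k) * (1 + norm (g k 1 u))"
        using mv[OF u, of k] by (simp add: algebra_simps)
      also have "\<dots> \<le> exp (2 * s k) * (exp (2 * (\<Sum>i<k. s i)) * (1 + b))"
        using Suc exp_ge_add_one_self[of "2 * s k"] by (intro mult_mono) auto
      finally show ?case by (simp add: exp_add[symmetric] algebra_simps mult_exp_exp)
    qed
    also have "\<dots> \<le> C" unfolding C_def using S[of k] b0 by (intro mult_right_mono) auto
    finally show ?thesis .
  qed
  have mv': "norm (g (Suc k) 1 u - g k 1 u) \<le> 2 * C * s k" if u: "u \<in> M" for k u
  proof -
    have "2 * s k * (1 + norm (g k 1 u)) \<le> 2 * s k * C" using bound[OF u] s0 by (intro mult_left_mono) auto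
    then show ?thesis using mv[OF u, of k] by (simp add: mult.commute mult.left_commute)
  qed
  have le: "norm (g (k + n) 1 u - g k 1 u) \<le> 2 * C * ((\<Sum>i<k + n. s i) - (\<Sum>i<k. s i))"
    if u: "u \<in> M" for k n u
  proof (induction n)
    case (Suc n)
    have "norm (g (k + Suc n) 1 u - g k 1 u) \<le>
        norm (g (Suc (k + n)) 1 u - g (k + n) 1 u) + norm (g (k + n) 1 u - g k 1 u)"
      using norm_triangle_ineq[of "g (Suc (k + n)) 1 u - g (k + n) 1 u" "g (k + n) 1 u - g k 1 u"] by simp
    then show ?case using Suc mv'[OF u, of "k + n"] by (simp add: algebra_simps)
  qed simp
  define \<phi> where "\<phi> u = lim (\<lambda>k. g k 1 u)" for u
  have \<phi>: "(\<lambda>k. g k 1 u) \<longlonglongrightarrow> \<phi> u" if u: "u \<in> M" for u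
  proof -
    have "Cauchy (\<lambda>k. g k 1 u)"
    proof (rule metric_CauchyI)
      fix d :: real assume "d > 0"
      then have "d / (2 * C) > 0" using C0 by simp
      moreover have "Cauchy (\<lambda>n. \<Sum>i<n. s i)" using summ by (simp add: summable_iff_convergent Cauchy_convergent_iff)
      ultimately obtain n0 where n0: "\<And>m n. m \<ge> n0 \<Longrightarrow> n \<ge> n0 \<Longrightarrow> dist (\<Sum>i<m. s i) (\<Sum>i<n. s i) < d / (2 * C)"
        using metric_CauchyD by blast
      have lt: "dist (g m 1 u) (g n 1 u) < d" if "n \<ge> n0" "n \<le> m" for m n
      proof -
        obtain j where j: "m = n + j" using \<open>n \<le> m\<close> le_Suc_ex by blast
        have "(\<Sum>i<m. s i) - (\<Sum>i<n. s i) < d / (2 * C)"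
          using n0[of m n] that unfolding dist_real_def by linarith
        then have "2 * C * ((\<Sum>i<m. s i) - (\<Sum>i<n. s i)) < d" using C0 by (simp add: field_simps)
        then show ?thesis using le[OF u, of n j] unfolding j dist_norm by linarith
      qed
      have "dist (g m 1 u) (g n 1 u) < d" if "m \<ge> n0" "n \<ge> n0" for m n
        using lt[of n m] lt[of m n] that by (cases "n \<le> m") (auto simp: dist_commute)
      then show "\<exists>n0. \<forall>m\<ge>n0. \<forall>n\<ge>n0. dist (g m 1 u) (g n 1 u) < d" by blast
    qed
    then show ?thesis by (simp add: \<phi>_def Cauchy_convergent convergent_LIMSEQ_iff[symmetric])
  qed
  define \<eta> where "\<eta> k = 2 * C * (S - (\<Sum>i<k. s i))" for k
  have \<eta>_lim: "\<eta> \<longlonglongrightarrow> 0"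
  proof -
    have "\<eta> \<longlonglongrightarrow> 2 * C * (S - S)"
      unfolding \<eta>_def S_def by (intro tendsto_intros summable_LIMSEQ summ)
    then show ?thesis by simp
  qed
  have unif: "norm (g k 1 u - \<phi> u) \<le> \<eta> k" if u: "u \<in> M" for k u
  proof -
    have le': "norm (g (n + k) 1 u - g k 1 u) \<le> \<eta> k" for n
    proof -
      have "2 * C * ((\<Sum>i<k + n. s i) - (\<Sum>i<k. s i)) \<le> \<eta> k"
        unfolding \<eta>_def using S[of "k + n"] C0 by (intro mult_left_mono) auto
      then show ?thesis using le[OF u, of k n] by (simp add: add.commute)
    qed
    have "(\<lambda>n. norm (g (n + k) 1 u - g k 1 u)) \<longlonglongrightarrow> norm (\<phi> u - g k 1 u)"
      by (intro tendsto_intros LIMSEQ_ignore_initial_segment \<phi> u)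
    then have "norm (\<phi> u - g k 1 u) \<le> \<eta> k" by (rule LIMSEQ_le_const2) (use le' in blast)
    then show ?thesis by (simp add: norm_minus_commute)
  qed
  have "tau_cont \<phi>"
    using tau_cont_uniform_limit[of "\<lambda>k. g k 1" \<eta> \<phi>] tau_cont_Gamma[OF gG] \<eta>_lim unif by blast
  then have K: "compactin tau.mtopology (\<phi> ` M)" by (rule tau_cont_compact_image)
  have I\<phi>: "I (\<phi> u) \<le> c + \<epsilon>" if u: "u \<in> M" for u
  proof -
    have "isCont I (\<phi> u)" using I_continuous by (simp add: continuous_on_eq_continuous_at)
    then have "(\<lambda>k. I (g k 1 u)) \<longlonglongrightarrow> I (\<phi> u)" using \<phi>[OF u] by (rule isCont_tendsto_compose)
    moreover have "I (g k 1 u) \<le> c + \<epsilon>" for k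
    proof -
      have "0 \<le> a * (\<Sum>i<k. s i)" using a(1) s0 by (simp add: sum_nonneg)
      then show ?thesis using I_le_level[OF gG[of k] u] lev_sum[of k] \<gamma>0(2) by linarith
    qed
    ultimately show ?thesis by (intro LIMSEQ_le_const2) auto
  qed
  have dir: "\<exists>w. norm w \<le> 1 + norm x \<and> (\<forall>\<xi>\<in>grad_vectors I x. inner \<xi> w > a)"
    if "x \<in> \<phi> ` M" "I x \<ge> l" for x
  proof -
    have "I x \<le> c + \<epsilon>" using that(1) I\<phi> by blast
    then have "\<bar>I x - c\<bar> \<le> \<epsilon>" using that(2) unfolding l_def by linarith
    then obtain w where w: "norm w \<le> 1 + norm x" "\<And>\<xi>. \<xi> \<in> grad_vectors I x \<Longrightarrow> inner \<xi> w \<ge> \<epsilon>"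
      using descent_direction[OF \<epsilon>(3) \<epsilon>(1)] by blast
    have "inner \<xi> w > a" if "\<xi> \<in> grad_vectors I x" for \<xi> using w(2)[OF that] a(2) by linarith
    then show ?thesis using w(1) by blast
  qed
  obtain V W t0 \<rho> where t0: "t0 > 0" "\<rho> > 0" and W: "finite W" "\<And>y. V y \<in> span W"
    and V: "\<And>x y. (\<lambda>n. N (x n - y)) \<longlonglongrightarrow> 0 \<Longrightarrow> (\<lambda>n. V (x n)) \<longlonglongrightarrow> V y"
      "\<And>y. norm (V y) \<le> 2 * (1 + norm y)"
      "\<And>y t. 0 \<le> t \<Longrightarrow> t \<le> t0 \<Longrightarrow> I (y - t *\<^sub>R V y) \<le> max (I y) (-1)"
      "\<And>x y t. 0 \<le> t \<Longrightarrow> t \<le> t0 \<Longrightarrow> x \<in> \<phi> ` M \<Longrightarrow> N (y - x) < \<rho> \<Longrightarrow> I y \<ge> l \<Longrightarrow>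
        I (y - t *\<^sub>R V y) \<le> max (I y - a * t) (-1)"
    by (rule finite_rank_descent_field[where l = l, OF K a(1)]) (erule (1) dir, rule that)
  have "\<forall>\<^sub>F k in sequentially. \<eta> k < \<rho> \<and> s k < t0 / 2"
    using order_tendstoD(2)[OF \<eta>_lim t0(2)] order_tendstoD(2)[OF s_lim, of "t0 / 2"] t0(1)
    by (simp add: eventually_conj_iff)
  \<comment> \<open>Late enough that the image of \<open>g k\<close> lies where the limit field
    descends, and that \<open>s k\<close> is less than half the step \<open>t0\<close> available
    there.\<close>
  then obtain k where k: "\<eta> k < \<rho>" "s k < t0 / 2" by (auto simp: eventually_sequentially)
  define \<gamma>' where "\<gamma>' = (\<lambda>s u. g k (min (2 * s) 1) u - (max 0 (2 * s - 1) * t0) *\<^sub>R V (g k 1 u))"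
  have \<gamma>'G: "\<gamma>' \<in> \<Gamma>" unfolding \<gamma>'_def by (rule Gamma_extend[OF gG W V(1) V(3) t0(1)])
  have \<gamma>'1: "\<gamma>' 1 u = g k 1 u - t0 *\<^sub>R V (g k 1 u)" for u by (simp add: \<gamma>'_def)
  have "I (\<gamma>' 1 u) \<le> max (level (g k) - a * t0) l" if u: "u \<in> M" for u
  proof (cases "I (g k 1 u) \<ge> l")
    case True
    have "N (g k 1 u - \<phi> u) < \<rho>" using N_le_norm[of "g k 1 u - \<phi> u"] unif[OF u, of k] k(1) by linarith
    then have "I (\<gamma>' 1 u) \<le> max (I (g k 1 u) - a * t0) (-1)"
      unfolding \<gamma>'1 using True u t0(1) by (intro V(4)) auto
    then show ?thesis using I_le_level[OF gG[of k] u] l(1) by linarith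
  next
    case False
    have "I (\<gamma>' 1 u) \<le> max (I (g k 1 u)) (-1)" unfolding \<gamma>'1 using t0(1) by (intro V(3)) auto
    then show ?thesis using False l(1) by linarith
  qed
  then have "level \<gamma>' \<le> max (level (g k) - a * t0) l"
    unfolding level_def[of \<gamma>'] using zero_in_M by (intro cSUP_least) auto
  \<comment> \<open>The alternative \<open>l\<close> in the maximum is excluded by
    \<open>l < c \<le> level \<gamma>'\<close>.\<close>
  then have "level \<gamma>' \<le> level (g k) - a * t0" using c_le_level[OF \<gamma>'G] l(2) by linarith
  moreover have "norm (\<gamma>' 1 u - g k 1 u) \<le> 2 * t0 * (1 + norm (g k 1 u))" for u
  proof -
    have "t0 * norm (V (g k 1 u)) \<le> t0 * (2 * (1 + norm (g k 1 u)))"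
      using V(2) t0(1) by (intro mult_left_mono) auto
    then show ?thesis using t0(1) by (simp add: \<gamma>'1)
  qed
  ultimately have "step (g k) t0 \<gamma>'" using \<gamma>'G t0(1) by (simp add: step_def)
  then have "t0 \<le> 2 * s k" using nx(2)[OF gG] by (simp add: s_def)
  then show False using k(2) by simp
qed

end

theorem theorem4p1:
  fixes Y Z :: "'a::{real_inner, complete_space} set"
    and J :: "nat set" and e :: "nat \<Rightarrow> 'a"
    and I \<Psi> :: "'a \<Rightarrow> real"
    and z0 :: 'a and \<delta> r R c :: real
    and S M M0 :: "'a set" and \<tau> :: "'a topology"
  assumes separable: "separable_space (euclidean :: 'a topology)"
    and Y: "subspace Y" "closed Y"
    and Z: "Z = orthogonal_comp Y"
    and e: "total_orthonormal_seq Y J e"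
    and tau: "\<tau> = tau_topology Y J e"
    and I_lip: "locally_lipschitz I"
    and I_usc: "upper_semicontinuous_wrt \<tau> I"
    and I_eq: "\<And>u. I u = 1/2 * (norm (orth_proj Z u))\<^sup>2 - 1/2 * (norm (orth_proj Y u))\<^sup>2 - \<Psi> u"
    and Psi_lip: "locally_lipschitz \<Psi>"
    and Psi_bdd: "bdd_below (range \<Psi>)"
    and z0: "z0 \<in> Z - {0}"
    and pos: "\<delta> > 0" "R > r" "r > 0"
    and S: "S = {u \<in> Z. norm u = r}"
    and M: "M = {u. \<exists>y t. u = y + t *\<^sub>R z0 \<and> y \<in> Y \<and> t \<ge> 0 \<and> norm u \<le> R}"
    and M0: "M0 = {u. \<exists>y t. u = y + t *\<^sub>R z0 \<and> y \<in> Y \<and>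
                      (norm u = R \<and> t \<ge> 0 \<or> norm u \<le> R \<and> t = 0)}"
    and I_S: "\<And>u. u \<in> S \<Longrightarrow> I u \<ge> \<delta>"
    and I_M0: "\<And>u. u \<in> M0 \<Longrightarrow> I u \<le> 0"
    and H: "condition_H \<tau> I \<Psi>"
    and c: "c = (INF \<gamma>\<in>Gamma_class \<tau> I M. SUP u\<in>M. I (\<gamma> 1 u))"
  shows "(\<exists>u. cerami_seq I c u) \<and> c \<ge> \<delta>"
proof -
  interpret L: linking_space Y Z J e z0 R
    by unfold_locales (use separable Y Z e z0 in auto)
  have M_eq: "L.M = M" by (simp add: L.M_def M)
  have tau_eq: "\<tau> = L.tau.mtopology" by (simp add: tau L.tau_topology_eq)
  interpret V: variational Y Z J e z0 R I \<Psi> r \<delta>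
  proof
    show "upper_semicontinuous_wrt L.tau.mtopology I" "condition_H L.tau.mtopology I \<Psi>"
      using I_usc H by (simp_all add: tau_eq)
    show "I u = 1/2 * (norm (L.Q u))\<^sup>2 - 1/2 * (norm (L.P u))\<^sup>2 - \<Psi> u" for u
      unfolding L.P_def L.Q_def by (rule I_eq)
    show "I u \<ge> \<delta>" if "u \<in> Z" "norm u = r" for u using that I_S by (simp add: S)
    \<comment> \<open>For a point of \<open>M\<close>, vanishing of \<open>Q u\<close> means
      \<open>t = 0\<close> because \<open>z0\<close> is nonzero; this matches the description of
      \<open>M0\<close>.\<close>
    show "I u \<le> 0" if u: "u \<in> L.M" and bd: "norm u = R \<or> L.Q u = 0" for u
    proof (rule I_M0)
      obtain t where t: "t \<ge> 0" "L.Q u = t *\<^sub>R z0" "norm u \<le> R" using u unfolding L.M_iff by blast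
      have "u = L.P u + t *\<^sub>R z0" using L.P_add_Q[of u] t(2) by simp
      moreover have "norm u = R \<and> t \<ge> 0 \<or> norm u \<le> R \<and> t = 0" using bd t z0 by auto
      ultimately show "u \<in> M0" unfolding M0 using L.P_in[of u] by blast
    qed
  qed (fact I_lip Psi_bdd pos)+
  have "c = V.c" by (simp add: c V.c_def V.level_def V.\<Gamma>_def tau_eq M_eq)
  then show ?thesis using V.cerami_seq_exists V.c_ge by simp
qed

end
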